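(* Let $S\in \mathrm{Sp}(n,\mathbb{R})$ have $n\times n$ blocks $S=\begin{pmatrix}A&B\\C&D\end{pmatrix}$ with $\det A\neq0$, let $a\in S^0_{0,0}(\mathbb{R}^{2n})$, and let $\mathcal K$ be the quadratic Fourier integral operator associated with the canonical map $S$ and symbol $a$, i.e. $$\mathcal Kf(x)=\int_{\mathbb{R}^n}e^{2\pi i\Phi(x,\xi)}a(x,\xi)\hat f(\xi)\,d\xi,\qquad \Phi(x,\xi)=\tfrac12 CA^{-1}x\cdot x+A^{-1}x\cdot\xi-\tfrac12A^{-1}B\xi\cdot\xi .$$ Then, for every $f\in L^2(\mathbb{R}^n)$, $$WF_{\mathrm w}(\mathcal Kf)\subseteq S(WF_{\mathrm w}(f)).$$
   Context: $\mathrm{Sp}(n,\mathbb{R})$ is the group of real $2n\times2n$ matrices $S$ with $S^\top JS=J$, $J=\begin{pmatrix}0&I_n\\-I_n&0\end{pmatrix}$. The Fourier transform is $\hat f(\xi)=\int_{\mathbb{R}^n}e^{-2\pi ix\cdot\xi}f(x)\,dx$. $a\in S^0_{0,0}(\mathbb{R}^{2n})$ means that $a\in C^\infty(\mathbb{R}^{2n})$ and all its partial derivatives of every order (including order 0) are bounded. The operator $\mathcal K$ is defined on $\mathcal S(\mathbb{R}^n)$ by the formula and extends to a bounded operator on $L^2(\mathbb{R}^n)$. The Wigner distribution of $f\in L^2(\mathbb{R}^n)$ is $Wf(x,\xi)=\int_{\mathbb{R}^n}e^{-2\pi i\xi\cdot y}f(x+\frac y2)\overline{f(x-\frac y2)}\,dy$.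 Let $\langle X\rangle=(1+|X|^2)^{1/2}$. A cone is a subset of $\mathbb{R}^{2n}\setminus\{0\}$ invariant under multiplication by positive reals. The Wigner wave front set $WF_{\mathrm w}(f)\subseteq\mathbb{R}^{2n}\setminus\{0\}$ is defined by: $0\ne X_0\notin WF_{\mathrm w}(f)$ iff there is an open cone $\Gamma_{X_0}\subseteq\mathbb{R}^{2n}\setminus\{0\}$ containing $X_0$ such that $\int_{\Gamma_{X_0}}\langle X\rangle^{2s}|Wf(X)|^2dX<\infty$ for every $s\ge0$. *)

theory Defs
  imports "HOL-Analysis.Analysis"
begin

section \<open>Symplectic matrices\<close>

text \<open>Matrices of size $2n \times 2n$ are indexed by the sum type \<open>'n + 'n\<close>; phase space
  $\mathbf{R}^{2n}$ is the Euclidean space \<open>(real ^ 'n) \<times> (real ^ 'n)\<close> of pairs $(x, \xi)$.\<close>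

definition block_matrix ::
  "'a ^ 'n ^ 'n \<Rightarrow> 'a ^ 'n ^ 'n \<Rightarrow> 'a ^ 'n ^ 'n \<Rightarrow> 'a ^ 'n ^ 'n \<Rightarrow> 'a ^ ('n + 'n) ^ ('n + 'n)"
  where "block_matrix A B C D =
    (\<chi> i j. case i of
        Inl k \<Rightarrow> (case j of Inl l \<Rightarrow> A $ k $ l | Inr l \<Rightarrow> B $ k $ l)
      | Inr k \<Rightarrow> (case j of Inl l \<Rightarrow> C $ k $ l | Inr l \<Rightarrow> D $ k $ l))"

definition symplectic_J :: "real ^ ('n::finite + 'n) ^ ('n + 'n)"
  where "symplectic_J = block_matrix 0 (mat 1) (- mat 1) 0"

definition Sp :: "(real ^ ('n::finite + 'n) ^ ('n + 'n)) set"
  where "Sp = {S. transpose S ** symplectic_J ** S = symplectic_J}"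

definition stack :: "(real ^ 'n) \<times> (real ^ 'n) \<Rightarrow> real ^ ('n + 'n)"
  where "stack X = (\<chi> i. case i of Inl k \<Rightarrow> fst X $ k | Inr k \<Rightarrow> snd X $ k)"

definition unstack :: "real ^ ('n + 'n) \<Rightarrow> (real ^ 'n) \<times> (real ^ 'n)"
  where "unstack v = ((\<chi> k. v $ Inl k), (\<chi> k. v $ Inr k))"

definition phase_map ::
  "real ^ ('n::finite + 'n) ^ ('n + 'n) \<Rightarrow> (real ^ 'n) \<times> (real ^ 'n) \<Rightarrow> (real ^ 'n) \<times> (real ^ 'n)"
  where "phase_map S X = unstack (S *v stack X)"

lemma sum_UNIV_Plus:
  fixes f :: "'a::finite + 'b::finite \<Rightarrow> 'c::comm_monoid_add"
  shows "sum f UNIV = (\<Sum>i\<in>UNIV. f (Inl i)) + (\<Sum>i\<in>UNIV. f (Inr i))"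
  unfolding UNIV_Plus_UNIV [symmetric] by (subst sum.Plus) simp_all

lemma phase_map_block_matrix:
  "phase_map (block_matrix A B C D) (x, \<xi>) = (A *v x + B *v \<xi>, C *v x + D *v \<xi>)"
  by (simp add: phase_map_def unstack_def stack_def block_matrix_def
      matrix_vector_mult_def vec_eq_iff sum_UNIV_Plus)


section \<open>Smooth functions, symbols, Schwartz functions\<close>

fun iter_partial :: "'a::euclidean_space list \<Rightarrow> ('a \<Rightarrow> complex) \<Rightarrow> 'a \<Rightarrow> complex"
  where
    "iter_partial [] f = f"
  | "iter_partial (b # bs) f = (\<lambda>x. frechet_derivative (iter_partial bs f) (at x) b)"

text \<open>Differentiability of every iterated partial derivative implies its continuity, so the
  following is $C^\infty$.\<close>

definition smooth :: "('a::euclidean_space \<Rightarrow> complex) \<Rightarrow> bool"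
  where "smooth f \<longleftrightarrow> (\<forall>bs\<in>lists Basis. \<forall>x. iter_partial bs f differentiable (at x))"

definition symbol_S00 :: "('a::euclidean_space \<Rightarrow> complex) set"
  where "symbol_S00 = {a. smooth a \<and> (\<forall>bs\<in>lists Basis. bounded (range (iter_partial bs a)))}"

definition schwartz :: "('a::euclidean_space \<Rightarrow> complex) set"
  where "schwartz = {f. smooth f \<and>
    (\<forall>bs\<in>lists Basis. \<forall>k::nat. bounded (range (\<lambda>x. norm x ^ k *\<^sub>R iter_partial bs f x)))}"


section \<open>Square-integrable functions and bounded operators\<close>

text \<open>Elements of $L^2$ are represented by Borel functions, and identities between them are
  required only almost everywhere.\<close>

definition L2 :: "('a::euclidean_space \<Rightarrow> complex) set"
  where "L2 = {f. f \<in> borel_measurable lborel \<and> integrable lborel (\<lambda>x. (cmod (f x))\<^sup>2)}"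

definition L2_norm :: "('a::euclidean_space \<Rightarrow> complex) \<Rightarrow> real"
  where "L2_norm f = sqrt (LINT x|lborel. (cmod (f x))\<^sup>2)"

text \<open>Linearity and the norm bound force \<open>T\<close> to respect equality almost everywhere.\<close>

definition bounded_L2_operator ::
  "(('a::euclidean_space \<Rightarrow> complex) \<Rightarrow> 'a \<Rightarrow> complex) \<Rightarrow> bool"
  where "bounded_L2_operator T \<longleftrightarrow>
    (\<forall>f\<in>L2. T f \<in> L2) \<and>
    (\<forall>f\<in>L2. \<forall>g\<in>L2. AE x in lborel. T (\<lambda>y. f y + g y) x = T f x + T g x) \<and>
    (\<forall>c. \<forall>f\<in>L2. AE x in lborel. T (\<lambda>y. c * f y) x = c * T f x) \<and>
    (\<exists>M. \<forall>f\<in>L2. L2_norm (T f) \<le> M * L2_norm f)"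


section \<open>Quadratic Fourier integral operators\<close>

definition fourier :: "('a::euclidean_space \<Rightarrow> complex) \<Rightarrow> 'a \<Rightarrow> complex"
  where "fourier f \<xi> = (LINT x|lborel. cis (- 2 * pi * (x \<bullet> \<xi>)) * f x)"

definition FIO_phase ::
  "real ^ 'n ^ 'n \<Rightarrow> real ^ 'n ^ 'n \<Rightarrow> real ^ 'n ^ 'n \<Rightarrow> real ^ 'n \<Rightarrow> real ^ 'n \<Rightarrow> real"
  where "FIO_phase A B C x \<xi> =
    1 / 2 * (((C ** matrix_inv A) *v x) \<bullet> x) + (matrix_inv A *v x) \<bullet> \<xi>
    - 1 / 2 * (((matrix_inv A ** B) *v \<xi>) \<bullet> \<xi>)"

definition FIO_integral ::
  "real ^ 'n ^ 'n \<Rightarrow> real ^ 'n ^ 'n \<Rightarrow> real ^ 'n ^ 'n \<Rightarrow>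
    ((real ^ 'n) \<times> (real ^ 'n) \<Rightarrow> complex) \<Rightarrow> (real ^ 'n \<Rightarrow> complex) \<Rightarrow> real ^ 'n \<Rightarrow> complex"
  where "FIO_integral A B C a f x =
    (LINT \<xi>|lborel. cis (2 * pi * FIO_phase A B C x \<xi>) * a (x, \<xi>) * fourier f \<xi>)"

text \<open>\<open>K\<close> is the bounded extension to $L^2$ of the operator given by the integral formula on
  Schwartz functions; by density it is unique up to equality almost everywhere.\<close>

definition is_quadratic_FIO ::
  "real ^ 'n ^ 'n \<Rightarrow> real ^ 'n ^ 'n \<Rightarrow> real ^ 'n ^ 'n \<Rightarrow>
    ((real ^ 'n) \<times> (real ^ 'n) \<Rightarrow> complex) \<Rightarrow>
    ((real ^ 'n \<Rightarrow> complex) \<Rightarrow> real ^ 'n \<Rightarrow> complex) \<Rightarrow> bool"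
  where "is_quadratic_FIO A B C a K \<longleftrightarrow>
    bounded_L2_operator K \<and>
    (\<forall>f\<in>schwartz. AE x in lborel. K f x = FIO_integral A B C a f x)"


section \<open>Wigner distribution and Wigner wave front set\<close>

definition wigner :: "('a::euclidean_space \<Rightarrow> complex) \<Rightarrow> 'a \<times> 'a \<Rightarrow> complex"
  where "wigner f = (\<lambda>(x, \<xi>).
    LINT y|lborel. cis (- 2 * pi * (\<xi> \<bullet> y)) * f (x + y /\<^sub>R 2) * cnj (f (x - y /\<^sub>R 2)))"

definition japanese_bracket :: "'a::real_normed_vector \<Rightarrow> real"
  where "japanese_bracket X = sqrt (1 + (norm X)\<^sup>2)"

text \<open>Unlike \<^const>\<open>cone\<close>, the cones here exclude the origin.\<close>

definition punctured_cone :: "'a::real_vector set \<Rightarrow> bool"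
  where "punctured_cone \<Gamma> \<longleftrightarrow> 0 \<notin> \<Gamma> \<and> (\<forall>X\<in>\<Gamma>. \<forall>t>0. t *\<^sub>R X \<in> \<Gamma>)"

definition WF_wigner :: "('a::euclidean_space \<Rightarrow> complex) \<Rightarrow> ('a \<times> 'a) set"
  where "WF_wigner f = {X\<^sub>0. X\<^sub>0 \<noteq> 0 \<and>
    \<not> (\<exists>\<Gamma>. open \<Gamma> \<and> punctured_cone \<Gamma> \<and> X\<^sub>0 \<in> \<Gamma> \<and>
        (\<forall>s\<ge>0. (\<integral>\<^sup>+X\<in>\<Gamma>. ennreal (japanese_bracket X powr (2 * s) * (cmod (wigner f X))\<^sup>2) \<partial>lborel)
                < \<infinity>))}"

end

theory Submission
  imports Defs "HOL-Probability.Probability"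
begin

text \<open>Let \<open>V\<close> denote the short-time Fourier transform with a Gaussian window. A Plancherel argument shows
  that, for each midpoint \<open>p\<close>, the integral of \<open>|V f (p + q / 2)|\<^sup>2 |V f (p - q / 2)|\<^sup>2\<close> over \<open>q\<close> is a
  Gaussian average of \<open>|W f|\<^sup>2\<close> around \<open>p\<close>. Hence rapid decay of the Wigner distribution in a cone is the
  same, up to shrinking the cone, as rapid decay of \<open>|V f (z)|\<^sup>2 |V f (z')|\<^sup>2\<close> over the pairs whose midpoint
  lies in the cone. Integration by parts bounds the matrix elements of the operator between
  time-frequency shifted Gaussians at \<open>z\<close> and \<open>w\<close> by every negative power of the distance from \<open>w\<close> to the
  image of \<open>z\<close> under the canonical map, so \<open>|V (K f) (w)|\<^sup>2\<close> is dominated by averages of \<open>|V f|\<^sup>2\<close> around the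
  preimage of \<open>w\<close>. Off the image cone the midpoint distance is comparable to the size of the
  midpoint, and these averages absorb the polynomial weight. No convergence issue arises after
  the first step, because only integrals of nonnegative functions remain.\<close>

section \<open>Affine changes of variables\<close>

text \<open>The obstacle is interference: two phase space points far outside a cone contribute to
  the Wigner distribution at their midpoint, which may lie inside the cone. A weight on
  \<open>V f\<close> alone does not see this, so the weight sits at midpoints of pairs. It survives
  the operator because the canonical map \<open>S\<close> is linear: the midpoint of
  \<open>w\<close> and \<open>w'\<close> misses the image of the midpoint of \<open>z\<close> and
  \<open>z'\<close> by the mean of the errors \<open>w - S z\<close> and \<open>w' - S z'\<close>,
  and the bracket of a mean is at most the product of the brackets, which the kernel pays for factor
  by factor. Each passage compares a weight at one point with a weight at another and needs a fresh
  cone around the same ray. Off the old cone only a constant is available, hence the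
  \<open>+ 1\<close> beside the cutoff weights; it is harmless because the unweighted energy is the
  square of the finite integral of |V f|^2. \<open>K\<close> is given by an integral only on
  Schwartz functions, so its matrix elements are computed on Gaussian windows and carried to all of
  \<open>L2\<close> by approximate representers of the functionals
  \<open>ip (K f) (window w)\<close>.\<close>

lemma lborel_distr_translate:
  "distr lborel borel (\<lambda>x::'a::euclidean_space. x + c) = lborel"
  using lborel_distr_plus[of c] by (simp add: add.commute cong: distr_cong)

lemma lborel_distr_reflect:
  "distr lborel borel (\<lambda>x::'a::euclidean_space. c - x) = lborel"
proof -
  have "lborel = density (distr lborel borel (\<lambda>x. c + (-1) *\<^sub>R x)) (\<lambda>_. ennreal (\<bar>-1\<bar> ^ DIM('a)))"
    by (rule lborel_affine) simp
  then show ?thesis by (simp add: density_1)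
qed

lemma nn_integral_translate:
  fixes f :: "'a::euclidean_space \<Rightarrow> ennreal"
  assumes [measurable]: "f \<in> borel_measurable borel"
  shows "(\<integral>\<^sup>+x. f (x + c) \<partial>lborel) = (\<integral>\<^sup>+x. f x \<partial>lborel)"
  by (subst (2) lborel_distr_translate[of c, symmetric]) (simp add: nn_integral_distr)

lemma nn_integral_reflect:
  fixes f :: "'a::euclidean_space \<Rightarrow> ennreal"
  assumes [measurable]: "f \<in> borel_measurable borel"
  shows "(\<integral>\<^sup>+x. f (c - x) \<partial>lborel) = (\<integral>\<^sup>+x. f x \<partial>lborel)"
  by (subst (2) lborel_distr_reflect[of c, symmetric]) (simp add: nn_integral_distr)

lemma integral_translate:
  fixes f :: "'a::euclidean_space \<Rightarrow> 'b::{banach, second_countable_topology}"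
  assumes [measurable]: "f \<in> borel_measurable borel"
  shows "(LINT x|lborel. f (x + c)) = (LINT x|lborel. f x)"
  by (subst (2) lborel_distr_translate[of c, symmetric]) (simp add: integral_distr)

lemma integrable_translate:
  fixes f :: "'a::euclidean_space \<Rightarrow> 'b::{banach, second_countable_topology}"
  assumes "integrable lborel f"
  shows "integrable lborel (\<lambda>x. f (x + c))"
proof -
  have [measurable]: "f \<in> borel_measurable borel" using assms by auto
  show ?thesis using assms
    by (subst (asm) lborel_distr_translate[of c, symmetric]) (simp add: integrable_distr_eq)
qed

lemma nn_integral_scale:
  fixes f :: "'a::euclidean_space \<Rightarrow> ennreal"
  assumes [measurable]: "f \<in> borel_measurable borel" and "c \<noteq> 0"
  shows "(\<integral>\<^sup>+x. f x \<partial>lborel) = ennreal (\<bar>c\<bar> ^ DIM('a)) * (\<integral>\<^sup>+x. f (c *\<^sub>R x) \<partial>lborel)"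
  by (subst lborel_affine[OF assms(2), of 0])
     (simp add: nn_integral_density nn_integral_distr nn_integral_cmult)

lemma integrable_scale:
  fixes f :: "'a::euclidean_space \<Rightarrow> 'b::{banach, second_countable_topology}"
  assumes f: "integrable lborel f" and "c \<noteq> 0"
  shows "integrable lborel (\<lambda>x. f (c *\<^sub>R x))"
  using f f[THEN borel_measurable_integrable] \<open>c \<noteq> 0\<close> unfolding integrable_iff_bounded
  by (subst (asm) nn_integral_scale[where c=c]) (auto simp: ennreal_mult_less_top)

lemma integral_scale:
  fixes f :: "'a::euclidean_space \<Rightarrow> 'b::{banach, second_countable_topology}"
  assumes f: "integrable lborel f" and "c \<noteq> 0"
  shows "(LINT x|lborel. f x) = (\<bar>c\<bar> ^ DIM('a)) *\<^sub>R (LINT x|lborel. f (c *\<^sub>R x))"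
  using f[THEN borel_measurable_integrable] integrable_scale[OF f \<open>c \<noteq> 0\<close>]
  by (subst lborel_affine[OF assms(2), of 0])
     (simp add: integral_density integral_distr)

text \<open>\<open>lborel\<close> is the image of a product of one-dimensional measures. The two
  uses are Gaussians and the integrable majorant of negative powers of the bracket.\<close>

lemma lborel_product_integral:
  fixes f :: "'a::euclidean_space \<Rightarrow> real \<Rightarrow> 'b::{real_normed_field,banach,second_countable_topology}"
  assumes f: "\<And>b. b \<in> Basis \<Longrightarrow> integrable lborel (f b)"
  shows "integrable lborel (\<lambda>x::'a. \<Prod>b\<in>Basis. f b (x \<bullet> b))"
    and "(LINT x|lborel. (\<Prod>b\<in>Basis. f b (x \<bullet> b))) = (\<Prod>b\<in>Basis. LINT t|lborel. f b t)"
proof -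
  interpret product_sigma_finite "\<lambda>_::'a. lborel :: real measure" ..
  have [measurable]: "b \<in> Basis \<Longrightarrow> f b \<in> borel_measurable borel" for b
    using f[of b] by auto
  show "integrable lborel (\<lambda>x::'a. \<Prod>b\<in>Basis. f b (x \<bullet> b))"
    unfolding lborel_def[where 'a='a] lborel_eq_real[symmetric]
    using product_integrable_prod[of Basis f] f
    by (simp add: integrable_distr_eq lborel_eq_real[symmetric])
  show "(LINT x|lborel. (\<Prod>b\<in>Basis. f b (x \<bullet> b))) = (\<Prod>b\<in>Basis. LINT t|lborel. f b t)"
    unfolding lborel_def[where 'a='a] 
    using product_integral_prod[of Basis f] f
    by (simp add: integral_distr lborel_eq_real[symmetric])
qed

section \<open>Gaussian integrals\<close>

text \<open>A rescaling of the characteristic function of the standard normal distribution.\<close>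

lemma gaussian_fourier_real:
  fixes a \<xi> :: real
  assumes "a > 0"
  shows "integrable lborel (\<lambda>x. cis (- 2 * pi * (x * \<xi>)) * complex_of_real (exp (- a * x\<^sup>2)))" (is ?A)
    and "(LINT x|lborel. cis (- 2 * pi * (x * \<xi>)) * complex_of_real (exp (- a * x\<^sup>2)))
          = complex_of_real (sqrt (pi / a) * exp (- (pi\<^sup>2 / a * \<xi>\<^sup>2)))" (is ?B)
proof -
  \<comment> \<open>The density has exponent -x^2/2, which becomes -a x^2 at \<open>c * x\<close>;
    the value of \<open>t\<close> below makes \<open>t * (c * x)\<close> the Fourier phase.\<close>
  define c where "c = sqrt (2 * a)"
  have c: "c > 0" "c\<^sup>2 = 2 * a" using assms by (auto simp: c_def)
  define t where "t = - 2 * pi * \<xi> / c"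
  let ?g = "\<lambda>x. std_normal_density x *\<^sub>R iexp (t * x)"
  interpret prob_space std_normal_distribution by (rule prob_space_normal_density) simp
  have "integrable std_normal_distribution (\<lambda>x. iexp (t * x))"
    by (rule integrable_const_bound[where B=1]) auto
  then have ig: "integrable lborel ?g"
    by (subst (asm) integrable_density) (auto simp: normal_density_nonneg)
  have vg: "(LINT x|lborel. ?g x) = exp (- (t^2) / 2)"
    using fun_cong[OF char_std_normal_distribution, of t] unfolding char_def
    by (subst (asm) integral_density) (auto simp: normal_density_nonneg)
  have e: "?g (0 + c * x) = complex_of_real (1 / sqrt (2 * pi)) * (cis (- 2 * pi * (x * \<xi>)) * complex_of_real (exp (- a * x\<^sup>2)))" for x
  proof -
    have "t * (c * x) = - 2 * pi * (x * \<xi>)" using c by (simp add: t_def)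
    moreover have "(c * x)\<^sup>2 / 2 = a * x\<^sup>2" using c by (simp add: power_mult_distrib)
    ultimately show ?thesis
      by (simp add: std_normal_density_def cis_conv_exp scaleR_conv_of_real mult_ac)
  qed
  have i1: "integrable lborel (\<lambda>x. ?g (0 + c * x))"
    using lborel_integrable_real_affine[OF ig, of c 0] c by auto
  then have "integrable lborel (\<lambda>x. complex_of_real (sqrt (2 * pi)) * (?g (0 + c * x)))"
    by (rule integrable_mult_right)
  then show ?A unfolding e by (simp add: mult.assoc[symmetric] flip: of_real_mult)
  have "exp (- (t^2) / 2) = \<bar>c\<bar> *\<^sub>R (LINT x|lborel. ?g (0 + c * x))"
    unfolding vg[symmetric] using c by (intro lborel_integral_real_affine) simp
  also have "\<dots> = complex_of_real (c / sqrt (2 * pi)) * (LINT x|lborel. cis (- 2 * pi * (x * \<xi>)) * complex_of_real (exp (- a * x\<^sup>2)))"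
    unfolding e using c by (simp add: scaleR_conv_of_real)
  finally have "(LINT x|lborel. cis (- 2 * pi * (x * \<xi>)) * complex_of_real (exp (- a * x\<^sup>2)))
     = complex_of_real (sqrt (2 * pi) / c) * exp (- (t^2) / 2)"
    using c by (simp add: field_simps)
  also have "sqrt (2 * pi) / c = sqrt (pi / a)" using assms by (simp add: c_def real_sqrt_divide real_sqrt_mult)
  finally have *: "(LINT x|lborel. cis (- 2 * pi * (x * \<xi>)) * complex_of_real (exp (- a * x\<^sup>2)))
     = complex_of_real (sqrt (pi / a)) * exp (- (t^2) / 2)" .
  have "- (t^2) / 2 = - (pi\<^sup>2 / a * \<xi>\<^sup>2)"
    using c assms by (simp add: t_def power_divide power_mult_distrib)
  then show ?B unfolding * by simp
qed

lemma gaussian_fourier: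
  fixes \<xi> :: "'a::euclidean_space"
  assumes "a > 0"
  shows "integrable lborel (\<lambda>x. cis (- 2 * pi * (x \<bullet> \<xi>)) * complex_of_real (exp (- a * (norm x)\<^sup>2)))"
    and "(LINT x|lborel. cis (- 2 * pi * (x \<bullet> \<xi>)) * complex_of_real (exp (- a * (norm x)\<^sup>2)))
          = complex_of_real (sqrt (pi / a) ^ DIM('a) * exp (- (pi\<^sup>2 / a * (norm \<xi>)\<^sup>2)))"
proof -
  have n: "(norm y)\<^sup>2 = (\<Sum>b\<in>Basis. (y \<bullet> b)\<^sup>2)" for y :: 'a
    unfolding dot_square_norm[symmetric] by (subst euclidean_inner) (simp add: power2_eq_square)
  have cs: "cis (\<Sum>b\<in>S. f b) = (\<Prod>b\<in>S. cis (f b))" for f :: "'a \<Rightarrow> real" and S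
    by (induction S rule: infinite_finite_induct) (auto simp flip: cis_mult)
  have e: "cis (- 2 * pi * (x \<bullet> \<xi>)) * complex_of_real (exp (- a * (norm x)\<^sup>2)) =
     (\<Prod>b\<in>Basis. cis (- 2 * pi * ((x \<bullet> b) * (\<xi> \<bullet> b))) * complex_of_real (exp (- a * (x \<bullet> b)\<^sup>2)))" for x
    unfolding n by (subst euclidean_inner)
      (simp add: sum_distrib_left cs exp_sum prod.distrib sum_negf[symmetric] del: sum_negf)
  show "integrable lborel (\<lambda>x. cis (- 2 * pi * (x \<bullet> \<xi>)) * complex_of_real (exp (- a * (norm x)\<^sup>2)))"
    unfolding e by (rule lborel_product_integral gaussian_fourier_real assms)+
  show "(LINT x|lborel. cis (- 2 * pi * (x \<bullet> \<xi>)) * complex_of_real (exp (- a * (norm x)\<^sup>2)))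
          = complex_of_real (sqrt (pi / a) ^ DIM('a) * exp (- (pi\<^sup>2 / a * (norm \<xi>)\<^sup>2)))"
    unfolding e
    by (subst lborel_product_integral(2)[OF gaussian_fourier_real(1)[OF assms]])
       (simp only: gaussian_fourier_real(2)[OF assms] n sum_distrib_left of_real_prod[symmetric] prod.distrib prod_constant exp_sum[OF finite_Basis] sum_negf[symmetric])
qed

lemma gaussian_integral:
  assumes "a > 0"
  shows "integrable lborel (\<lambda>x::'a::euclidean_space. exp (- a * (norm x)\<^sup>2))"
    and "(LINT x|lborel. exp (- a * (norm (x::'a))\<^sup>2)) = sqrt (pi / a) ^ DIM('a)"
    and "(\<integral>\<^sup>+x. ennreal (exp (- a * (norm (x::'a))\<^sup>2)) \<partial>lborel) = ennreal (sqrt (pi / a) ^ DIM('a))"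
proof -
  show 1: "integrable lborel (\<lambda>x::'a::euclidean_space. exp (- a * (norm x)\<^sup>2))"
    using integrable_norm[OF gaussian_fourier(1)[OF assms, of 0]] by (simp add: norm_mult)
  have "complex_of_real (LINT x|lborel. exp (- a * (norm (x::'a))\<^sup>2)) = complex_of_real (sqrt (pi / a) ^ DIM('a))"
    using gaussian_fourier(2)[OF assms, of "0::'a"] by simp
  then show 2: "(LINT x|lborel. exp (- a * (norm (x::'a))\<^sup>2)) = sqrt (pi / a) ^ DIM('a)"
    unfolding of_real_eq_iff .
  show "(\<integral>\<^sup>+x. ennreal (exp (- a * (norm (x::'a))\<^sup>2)) \<partial>lborel) = ennreal (sqrt (pi / a) ^ DIM('a))"
    using nn_integral_eq_integral[OF 1] 2 by simp
qed

section \<open>Inner product and norm of square-integrable functions\<close>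

text \<open>The discriminant argument: integrating 2t|fg| \<le> t^2 f^2 + g^2 gives a quadratic
  inequality in \<open>t\<close>, which is evaluated at its optimal point
  \<open>c / a\<close>.\<close>

lemma Cauchy_Schwarz_integral:
  fixes f g :: "'a \<Rightarrow> real"
  assumes [measurable]: "f \<in> borel_measurable M" "g \<in> borel_measurable M"
    and f: "integrable M (\<lambda>x. (f x)\<^sup>2)" and g: "integrable M (\<lambda>x. (g x)\<^sup>2)"
  shows "integrable M (\<lambda>x. f x * g x)"
    and "(LINT x|M. \<bar>f x * g x\<bar>) \<le> sqrt (LINT x|M. (f x)\<^sup>2) * sqrt (LINT x|M. (g x)\<^sup>2)"
proof -
  have am: "2 * \<bar>x * y\<bar> \<le> x\<^sup>2 + y\<^sup>2" for x y :: real
    using sum_squares_bound[of "\<bar>x\<bar>" "\<bar>y\<bar>"] by (simp add: abs_mult)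
  show fg: "integrable M (\<lambda>x. f x * g x)"
  proof (rule Bochner_Integration.integrable_bound)
    show "integrable M (\<lambda>x. (f x)\<^sup>2 + (g x)\<^sup>2)" using f g by simp
    show "AE x in M. norm (f x * g x) \<le> norm ((f x)\<^sup>2 + (g x)\<^sup>2)"
    proof (rule AE_I2)
      fix x show "norm (f x * g x) \<le> norm ((f x)\<^sup>2 + (g x)\<^sup>2)" 
        using am[of "f x" "g x"] by simp
    qed
  qed simp
  define a b c where "a = (LINT x|M. (f x)\<^sup>2)" and "b = (LINT x|M. (g x)\<^sup>2)"
    and "c = (LINT x|M. \<bar>f x * g x\<bar>)"
  have nn: "a \<ge> 0" "b \<ge> 0" "c \<ge> 0" by (auto simp: a_def b_def c_def)
  have key: "2 * t * c \<le> t\<^sup>2 * a + b" if "t \<ge> 0" for t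
  proof -
    have "2 * t * c = (LINT x|M. 2 * t * \<bar>f x * g x\<bar>)" by (simp add: c_def)
    also have "\<dots> \<le> (LINT x|M. t\<^sup>2 * (f x)\<^sup>2 + (g x)\<^sup>2)"
    proof (rule integral_mono)
      fix x
      show "2 * t * \<bar>f x * g x\<bar> \<le> t\<^sup>2 * (f x)\<^sup>2 + (g x)\<^sup>2"
        using am[of "t * f x" "g x"] that by (simp add: abs_mult power_mult_distrib mult.assoc)
    qed (use f g fg in auto)
    also have "\<dots> = t\<^sup>2 * a + b" using f g by (simp add: a_def b_def)
    finally show ?thesis .
  qed
  have "c\<^sup>2 \<le> a * b"
  proof (cases "a = 0")
    case True
    have "c = 0"
    proof (rule ccontr)
      assume "c \<noteq> 0"
      \<comment> \<open>With \<open>a = 0\<close> the bound is linear in \<open>t\<close>; this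
        choice would give 2(b + 1) \<le> b.\<close>
      with key[of "(b + 1) / c"] True nn show False by simp
    qed
    with nn show ?thesis by simp
  next
    case False
    with key[of "c / a"] nn show ?thesis by (simp add: field_simps power2_eq_square)
  qed
  then have "c \<le> sqrt (a * b)" using nn by (simp add: real_le_rsqrt)
  then show "(LINT x|M. \<bar>f x * g x\<bar>) \<le> sqrt (LINT x|M. (f x)\<^sup>2) * sqrt (LINT x|M. (g x)\<^sup>2)"
    unfolding a_def b_def c_def by (simp add: real_sqrt_mult)
qed

text \<open>The squared form stays meaningful for infinite values. A vanishing factor is treated
  first, because in \<open>ennreal\<close> the product of 0 and infinity is 0 and the right-hand
  side then says that the left must vanish.\<close>

lemma Cauchy_Schwarz_nn_integral_sq:
  fixes f g :: "'a \<Rightarrow> real"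
  assumes [measurable]: "f \<in> borel_measurable M" "g \<in> borel_measurable M"
  shows "(\<integral>\<^sup>+x. ennreal \<bar>f x * g x\<bar> \<partial>M)\<^sup>2 \<le> (\<integral>\<^sup>+x. ennreal ((f x)\<^sup>2) \<partial>M) * (\<integral>\<^sup>+x. ennreal ((g x)\<^sup>2) \<partial>M)"
proof -
  let ?F = "\<integral>\<^sup>+x. ennreal ((f x)\<^sup>2) \<partial>M" and ?G = "\<integral>\<^sup>+x. ennreal ((g x)\<^sup>2) \<partial>M"
  consider "?F = 0 \<or> ?G = 0" | "?F \<noteq> 0" "?G \<noteq> 0" "?F = \<infinity> \<or> ?G = \<infinity>" | "?F < \<infinity>" "?G < \<infinity>"
    by (cases "?F = 0 \<or> ?G = 0"; cases "?F = \<infinity> \<or> ?G = \<infinity>") (auto simp: less_top)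
  then show ?thesis
  proof cases
    case 1
    then have "(AE x in M. f x = 0) \<or> (AE x in M. g x = 0)"
      by (auto simp: nn_integral_0_iff_AE)
    then have "AE x in M. ennreal \<bar>f x * g x\<bar> = 0" by auto
    then have "(\<integral>\<^sup>+x. ennreal \<bar>f x * g x\<bar> \<partial>M) = 0"
      by (subst nn_integral_0_iff_AE) auto
    then show ?thesis by simp
  next
    case 2
    then have "?F * ?G = \<infinity>" by (auto simp: ennreal_mult_top ennreal_top_mult)
    then show ?thesis by simp
  next
    case 3
    then have f: "integrable M (\<lambda>x. (f x)\<^sup>2)" and g: "integrable M (\<lambda>x. (g x)\<^sup>2)"
      by (auto intro!: integrableI_bounded)
    note cs = Cauchy_Schwarz_integral[OF assms f g]
    have "(\<integral>\<^sup>+x. ennreal \<bar>f x * g x\<bar> \<partial>M) = ennreal (LINT x|M. \<bar>f x * g x\<bar>)"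
      using cs(1) by (intro nn_integral_eq_integral) auto
    also have "\<dots>\<^sup>2 = ennreal ((LINT x|M. \<bar>f x * g x\<bar>)\<^sup>2)"
      by (simp add: ennreal_power)
    also have "\<dots> \<le> ennreal ((sqrt (LINT x|M. (f x)\<^sup>2) * sqrt (LINT x|M. (g x)\<^sup>2))\<^sup>2)"
      by (intro ennreal_leI power_mono cs) simp
    also have "\<dots> = ennreal (LINT x|M. (f x)\<^sup>2) * ennreal (LINT x|M. (g x)\<^sup>2)"
      by (simp add: power_mult_distrib ennreal_mult)
    also have "\<dots> = ?F * ?G" using f g by (simp add: nn_integral_eq_integral)
    finally show ?thesis .
  qed
qed

definition ip :: "('a::euclidean_space \<Rightarrow> complex) \<Rightarrow> ('a \<Rightarrow> complex) \<Rightarrow> complex"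
  where "ip f g = (LINT x|lborel. f x * cnj (g x))"

lemma L2_measurable [measurable_dest]: "f \<in> L2 \<Longrightarrow> f \<in> borel_measurable borel"
  by (simp add: L2_def)

lemma L2_sq_integrable: "f \<in> L2 \<Longrightarrow> integrable lborel (\<lambda>x. (cmod (f x))\<^sup>2)"
  by (simp add: L2_def)

lemma L2I: "f \<in> borel_measurable borel \<Longrightarrow> integrable lborel (\<lambda>x. (cmod (f x))\<^sup>2) \<Longrightarrow> f \<in> L2"
  by (simp add: L2_def)

lemma L2_norm_nonneg [simp]: "L2_norm f \<ge> 0"
  by (simp add: L2_norm_def)

lemma L2_norm_sq: "(L2_norm f)\<^sup>2 = (LINT x|lborel. (cmod (f x))\<^sup>2)"
  by (simp add: L2_norm_def)

lemma L2_norm_sq_nn: "f \<in> L2 \<Longrightarrow> (\<integral>\<^sup>+x. ennreal ((cmod (f x))\<^sup>2) \<partial>lborel) = ennreal ((L2_norm f)\<^sup>2)"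
  by (simp add: L2_norm_sq nn_integral_eq_integral L2_sq_integrable)

lemma ip_self: "ip f f = complex_of_real ((L2_norm f)\<^sup>2)"
  unfolding ip_def L2_norm_sq by (simp flip: complex_norm_square of_real_power)

lemma L2_times_integrable:
  assumes "f \<in> L2" "g \<in> L2"
  shows "integrable lborel (\<lambda>x. f x * g x)"
proof -
  have [measurable]: "f \<in> borel_measurable borel" "g \<in> borel_measurable borel"
    using assms by (auto simp: L2_def)
  have "integrable lborel (\<lambda>x. cmod (f x) * cmod (g x))"
    using assms by (intro Cauchy_Schwarz_integral) (auto simp: L2_def)
  then show ?thesis
    by (rule Bochner_Integration.integrable_bound) (auto simp: norm_mult)
qed

lemma borel_measurable_cnj [measurable (raw)]:
  "f \<in> borel_measurable M \<Longrightarrow> (\<lambda>x. cnj (f x)) \<in> borel_measurable M"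
  by (rule measurable_compose[OF _ borel_measurable_continuous_onI]) (auto intro: continuous_intros)

lemma L2_cnj: "f \<in> L2 \<Longrightarrow> (\<lambda>x. cnj (f x)) \<in> L2"
  by (auto simp: L2_def)

lemma L2_cmult: "f \<in> L2 \<Longrightarrow> (\<lambda>x. c * f x) \<in> L2"
  by (auto simp: L2_def norm_mult power_mult_distrib)

lemma L2_add:
  assumes "f \<in> L2" "g \<in> L2"
  shows "(\<lambda>x. f x + g x) \<in> L2"
proof (rule L2I)
  have [measurable]: "f \<in> borel_measurable borel" "g \<in> borel_measurable borel"
    using assms by (auto simp: L2_def)
  show "(\<lambda>x. f x + g x) \<in> borel_measurable borel" by simp
  have "integrable lborel (\<lambda>x. 2 * (cmod (f x))\<^sup>2 + 2 * (cmod (g x))\<^sup>2)"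
    using assms by (auto simp: L2_def)
  then show "integrable lborel (\<lambda>x. (cmod (f x + g x))\<^sup>2)"
  proof (rule Bochner_Integration.integrable_bound, simp, intro AE_I2)
    fix x
    have "(cmod (f x + g x))\<^sup>2 \<le> (cmod (f x) + cmod (g x))\<^sup>2"
      by (intro power_mono norm_triangle_ineq) auto
    also have "\<dots> \<le> 2 * (cmod (f x))\<^sup>2 + 2 * (cmod (g x))\<^sup>2"
      using sum_squares_bound[of "cmod (f x)" "cmod (g x)"] by (simp add: power2_sum)
    finally show "norm ((cmod (f x + g x))\<^sup>2) \<le> norm (2 * (cmod (f x))\<^sup>2 + 2 * (cmod (g x))\<^sup>2)"
      by simp
  qed
qed

lemma L2_diff: "f \<in> L2 \<Longrightarrow> g \<in> L2 \<Longrightarrow> (\<lambda>x. f x - g x) \<in> L2"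
  using L2_add[of f "\<lambda>x. - 1 * g x"] L2_cmult[of g "-1"] by simp

lemma ip_integrable: "f \<in> L2 \<Longrightarrow> g \<in> L2 \<Longrightarrow> integrable lborel (\<lambda>x. f x * cnj (g x))"
  by (intro L2_times_integrable L2_cnj)

lemma ip_add_left: "f \<in> L2 \<Longrightarrow> g \<in> L2 \<Longrightarrow> h \<in> L2 \<Longrightarrow> ip (\<lambda>x. f x + g x) h = ip f h + ip g h"
  by (simp add: ip_def ip_integrable distrib_right)

lemma ip_cmult_left: "ip (\<lambda>x. c * f x) g = c * ip f g"
  by (simp add: ip_def mult.assoc)

lemma ip_commute: "ip g f = cnj (ip f g)"
  using Bochner_Integration.integral_cnj[of lborel "\<lambda>x. f x * cnj (g x)"] by (simp add: ip_def mult.commute)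

lemma ip_add_right: "f \<in> L2 \<Longrightarrow> g \<in> L2 \<Longrightarrow> h \<in> L2 \<Longrightarrow> ip h (\<lambda>x. f x + g x) = ip h f + ip h g"
  by (simp add: ip_def ip_integrable distrib_left)

lemma ip_cmult_right: "ip f (\<lambda>x. c * g x) = cnj c * ip f g"
  by (simp add: ip_def mult.left_commute[of _ "cnj c"])

lemma ip_diff_left: "f \<in> L2 \<Longrightarrow> g \<in> L2 \<Longrightarrow> h \<in> L2 \<Longrightarrow> ip (\<lambda>x. f x - g x) h = ip f h - ip g h"
  by (simp add: ip_def ip_integrable left_diff_distrib)

lemma ip_diff_right: "f \<in> L2 \<Longrightarrow> g \<in> L2 \<Longrightarrow> h \<in> L2 \<Longrightarrow> ip h (\<lambda>x. f x - g x) = ip h f - ip h g"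
  by (simp add: ip_def ip_integrable right_diff_distrib)

lemma L2_Cauchy_Schwarz_abs:
  assumes "f \<in> L2" "g \<in> L2"
  shows "(LINT x|lborel. cmod (f x) * cmod (g x)) \<le> L2_norm f * L2_norm g"
  using Cauchy_Schwarz_integral(2)[of "\<lambda>x. cmod (f x)" lborel "\<lambda>x. cmod (g x)"] assms
  unfolding L2_norm_def by (auto simp: L2_def)

lemma ip_bound:
  assumes "f \<in> L2" "g \<in> L2"
  shows "cmod (ip f g) \<le> L2_norm f * L2_norm g"
proof -
  have "cmod (ip f g) \<le> (LINT x|lborel. cmod (f x * cnj (g x)))"
    unfolding ip_def by (rule integral_norm_bound)
  then show ?thesis using L2_Cauchy_Schwarz_abs[OF assms] by (simp add: norm_mult)
qed

lemma L2_norm_cmult: "L2_norm (\<lambda>x. c * f x) = cmod c * L2_norm f"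
  by (simp add: L2_norm_def norm_mult power_mult_distrib real_sqrt_mult)

lemma L2_norm_add_sq:
  assumes "f \<in> L2" "g \<in> L2"
  shows "(L2_norm (\<lambda>x. f x + g x))\<^sup>2 = (L2_norm f)\<^sup>2 + 2 * Re (ip f g) + (L2_norm g)\<^sup>2"
proof -
  have "complex_of_real ((L2_norm (\<lambda>x. f x + g x))\<^sup>2) = ip f f + ip f g + (ip g f + ip g g)"
    unfolding ip_self[symmetric] using assms by (simp add: ip_add_left ip_add_right L2_add)
  then have "Re (complex_of_real ((L2_norm (\<lambda>x. f x + g x))\<^sup>2)) = Re (ip f f + ip f g + (ip g f + ip g g))"
    by simp
  then show ?thesis using ip_commute[of g f] by (simp add: ip_self)
qed

lemma L2_translate:
  assumes "f \<in> L2"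
  shows "(\<lambda>x. f (x + c)) \<in> L2" and "L2_norm (\<lambda>x. f (x + c)) = L2_norm f"
proof -
  have [measurable]: "f \<in> borel_measurable borel" using assms by auto
  show "(\<lambda>x. f (x + c)) \<in> L2"
    using integrable_translate[OF L2_sq_integrable[OF assms]] by (intro L2I) auto
  show "L2_norm (\<lambda>x. f (x + c)) = L2_norm f"
    unfolding L2_norm_def using integral_translate[of "\<lambda>x. (cmod (f x))\<^sup>2" c] by simp
qed

section \<open>Plancherel's theorem\<close>

text \<open>Induction over integrable functions: indicators are handled by inner and outer
  regularity of Lebesgue measure and a Urysohn function, sums by halving the error, limits by
  dominated convergence.\<close>

lemma integrable_approx_continuous:
  fixes F :: "'a::euclidean_space \<Rightarrow> complex"
  assumes "integrable lborel F" "e > 0"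
  shows "\<exists>G. continuous_on UNIV G \<and> bounded (range G) \<and> integrable lborel G \<and>
    (LINT x|lborel. cmod (F x - G x)) < e"
  using assms
proof (induction arbitrary: e rule: integrable_induct)
  case (base A c)
  have A: "A \<in> sets lebesgue" using base(1) by simp
  \<comment> \<open>The added 1 keeps the divisor positive when \<open>c = 0\<close>.\<close>
  define k where "k = cmod c + 1"
  define d where "d = e / k / 2"
  have k: "k > 0" by (simp add: k_def add_nonneg_pos)
  have d: "d > 0" "2 * d * k = e" using \<open>e > 0\<close> k by (auto simp: d_def)
  obtain T where T: "open T" "A \<subseteq> T" "emeasure lebesgue (T - A) < ennreal d"
    using sets_lebesgue_outer_open[OF A d(1)] by metis
  obtain K where K: "closed K" "K \<subseteq> A" "emeasure lebesgue (A - K) < ennreal d"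
    using sets_lebesgue_inner_closed[OF A d(1)] by metis
  have TB[measurable]: "T \<in> sets borel" "K \<in> sets borel" "A \<in> sets borel"
    using T(1) K(1) base(1) by (auto intro: borel_open borel_closed)
  have "emeasure lborel (T - K) \<le> emeasure lborel ((T - A) \<union> (A - K))"
    by (rule emeasure_mono) (use TB in auto)
  also have "\<dots> \<le> emeasure lborel (T - A) + emeasure lborel (A - K)"
    by (rule emeasure_subadditive) (use TB in auto)
  also have "\<dots> = emeasure lebesgue (T - A) + emeasure lebesgue (A - K)" using TB by simp
  also have "\<dots> < ennreal d + ennreal d" using T(3) K(3) by (rule add_strict_mono)
  finally have TK: "emeasure lborel (T - K) < ennreal (2 * d)" using d by (simp flip: ennreal_plus)
  have disj: "K \<inter> - T = {}" using T K by auto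
  \<comment> \<open>Being 1 on the closed inner set \<open>K\<close> and 0 off the open outer set
    \<open>T\<close>, this function differs from the indicator of \<open>A\<close> only on the small
    set \<open>T - K\<close>.\<close>
  obtain f :: "'a \<Rightarrow> real" where f: "continuous_on UNIV f"
    "\<And>x. f x \<in> closed_segment 1 0" "\<And>x. x \<in> K \<Longrightarrow> f x = 1" "\<And>x. x \<in> -T \<Longrightarrow> f x = 0"
    using Urysohn_local[of UNIV K "-T" 1 "0::real"] T K disj by (auto simp: closed_closedin[symmetric])
  have f01: "0 \<le> f x" "f x \<le> 1" for x using f(2)[of x] by (auto simp: closed_segment_eq_real_ivl)
  have [measurable]: "f \<in> borel_measurable borel"
    using f(1) by (rule borel_measurable_continuous_onI)
  define G where "G x = f x *\<^sub>R c" for x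
  have ind: "cmod (indicator A x *\<^sub>R c - G x) \<le> indicator (T - K) x *\<^sub>R cmod c" for x
  proof -
    have "\<bar>indicator A x - f x\<bar> \<le> indicator (T - K) x"
      using f01[of x] f(3,4)[of x] T(2) K(2) by (auto simp: indicator_def split: if_splits)
    then show ?thesis unfolding G_def scaleR_left_diff_distrib[symmetric] norm_scaleR
      by (simp add: mult_right_mono)
  qed
  have TKi: "integrable lborel (indicator (T - K) :: 'a \<Rightarrow> real)"
    using TK by (intro integrable_real_indicator) (auto simp: less_top[symmetric] intro: less_trans)
  have iA: "integrable lborel (\<lambda>x. indicator A x *\<^sub>R c)"
    using base by (intro integrable_scaleR_left integrable_real_indicator) auto
  have [measurable]: "G \<in> borel_measurable borel" by (simp add: G_def[abs_def])
  have iD: "integrable lborel (\<lambda>x. indicator A x *\<^sub>R c - G x)"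
    by (rule Bochner_Integration.integrable_bound[OF integrable_scaleR_left[OF TKi, of "cmod c"]])
       (use ind in auto)
  have iG: "integrable lborel G"
    using Bochner_Integration.integrable_diff[OF iA iD] by simp
  have "(LINT x|lborel. cmod (indicator A x *\<^sub>R c - G x)) \<le> (LINT x|lborel. indicator (T - K) x *\<^sub>R cmod c)"
    using iD TKi ind by (intro integral_mono) auto
  also have "\<dots> = measure lborel (T - K) * cmod c" by simp
  also have "\<dots> \<le> 2 * d * cmod c"
  proof (rule mult_right_mono)
    show "measure lborel (T - K) \<le> 2 * d"
      using TK d unfolding measure_def by (intro enn2real_leI) (auto simp: less_imp_le)
  qed simp
  also have "\<dots> = 2 * d * k - 2 * d" by (simp add: k_def algebra_simps)
  also have "\<dots> < e" using d by simp
  finally have "(LINT x|lborel. cmod (indicator A x *\<^sub>R c - G x)) < e" .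
  moreover have "continuous_on UNIV G" unfolding G_def by (intro continuous_intros f)
  moreover have "bounded (range G)"
    using f01 mult_right_mono[OF f01(2), of "cmod c"] by (intro boundedI[where B="cmod c"]) (auto simp: G_def)
  ultimately show ?case using iG by blast
next
  case (add f g)
  have "e / 2 > 0" using \<open>e > 0\<close> by simp
  from add.IH(1)[OF this] obtain G where
    G: "continuous_on UNIV G" "bounded (range G)" "integrable lborel G" "(LINT x|lborel. cmod (f x - G x)) < e/2"
    by (elim exE conjE)
  from add.IH(2)[OF \<open>e / 2 > 0\<close>] obtain H where
    H: "continuous_on UNIV H" "bounded (range H)" "integrable lborel H" "(LINT x|lborel. cmod (g x - H x)) < e/2"
    by (elim exE conjE)
  have "(LINT x|lborel. cmod (f x + g x - (G x + H x))) \<le> (LINT x|lborel. cmod (f x - G x) + cmod (g x - H x))"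
  proof (rule integral_mono)
    fix x show "cmod (f x + g x - (G x + H x)) \<le> cmod (f x - G x) + cmod (g x - H x)"
      using norm_triangle_ineq[of "f x - G x" "g x - H x"] by (simp add: add_diff_add)
  qed (use add G H in auto)
  also have "\<dots> < e" using add G H by simp
  finally have "(LINT x|lborel. cmod (f x + g x - (G x + H x))) < e" .
  moreover have "bounded (range (\<lambda>x. G x + H x))" using G(2) H(2) by (rule bounded_plus_comp)
  ultimately show ?case using G H
    by (intro exI[of _ "\<lambda>x. G x + H x"]) (auto intro!: continuous_intros)
next
  case (lim f s)
  have "(\<lambda>i. LINT x|lborel. cmod (s i x - f x)) \<longlonglongrightarrow> integral\<^sup>L (lborel :: 'a measure) (\<lambda>x. 0 :: real)"
  proof (rule integral_dominated_convergence)
    \<comment> \<open>The induction principle supplies approximants bounded by twice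
      \<open>f\<close>; the difference from \<open>f\<close> adds one more.\<close>
    show "integrable lborel (\<lambda>x. 3 * cmod (f x))" using lim by simp
    show "AE x in lborel. (\<lambda>i. cmod (s i x - f x)) \<longlonglongrightarrow> 0"
      using lim.hyps(2) by (intro AE_I2 tendsto_norm_zero LIM_zero) simp
    show "AE x in lborel. norm (cmod (s i x - f x)) \<le> 3 * cmod (f x)" for i
    proof (rule AE_I2)
      fix x :: 'a
      show "norm (cmod (s i x - f x)) \<le> 3 * cmod (f x)"
        using norm_triangle_ineq4[of "s i x" "f x"] lim.hyps(3)[of x i] by simp
    qed
  qed (use lim in auto)
  then have "eventually (\<lambda>i. (LINT x|lborel. cmod (s i x - f x)) < e/2) sequentially"
    using \<open>e > 0\<close> by (intro order_tendstoD) auto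
  then obtain i where i: "(LINT x|lborel. cmod (s i x - f x)) < e/2" by (auto simp: eventually_sequentially)
  have "e / 2 > 0" using \<open>e > 0\<close> by simp
  from lim.IH[OF this, of i] obtain G where G: "continuous_on UNIV G" "bounded (range G)" "integrable lborel G"
    "(LINT x|lborel. cmod (s i x - G x)) < e/2"
    by (elim exE conjE)
  have "(LINT x|lborel. cmod (f x - G x)) \<le> (LINT x|lborel. cmod (s i x - f x) + cmod (s i x - G x))"
  proof (rule integral_mono)
    fix x show "cmod (f x - G x) \<le> cmod (s i x - f x) + cmod (s i x - G x)"
      using norm_triangle_ineq4[of "s i x - G x" "s i x - f x"] by simp
  qed (use lim G in auto)
  also have "\<dots> < e" using lim G i by simp
  finally show ?case using G by blast
qed



text \<open>For bounded \<open>F\<close>, an L1 approximation \<open>G\<close> of the second factor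
  changes the autocorrelation by at most \<open>B * e\<close>, uniformly in the shift. A change of
  variables then moves the shift onto \<open>G\<close>, where continuity and boundedness allow
  dominated convergence.\<close>

lemma L2_autocorrelation_continuous_bounded:
  fixes F :: "'a::euclidean_space \<Rightarrow> complex"
  assumes F: "integrable lborel F" and B: "\<And>x. cmod (F x) \<le> B" and X: "X \<longlonglongrightarrow> 0"
  shows "(\<lambda>n. LINT y|lborel. F (y + X n) * cnj (F y)) \<longlonglongrightarrow> (LINT y|lborel. F y * cnj (F y))"
proof (rule LIMSEQ_I)
  fix r :: real assume "r > 0"
  have B0: "B \<ge> 0" using B[of 0] norm_ge_zero[of "F 0"] by linarith
  have [measurable]: "F \<in> borel_measurable borel" using F by auto
  define k where "k = B + 1"
  \<comment> \<open>Two replacements of \<open>F\<close> by \<open>G\<close>, each costing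
    \<open>B * e\<close>, must stay below \<open>r / 2\<close> together.\<close>
  define e where "e = r / k / 4"
  have k: "k > 0" using B0 by (simp add: k_def)
  have e: "e > 0" "4 * e * k = r" using \<open>r > 0\<close> k by (auto simp: e_def)
  have "2 * (B * e) = (4 * e * k) / 2 - 2 * e" by (simp add: k_def algebra_simps)
  with e have e2: "2 * (B * e) < r / 2" by simp
  obtain G where G: "continuous_on UNIV G" "bounded (range G)" "integrable lborel G" "(LINT x|lborel. cmod (F x - G x)) < e"
    using integrable_approx_continuous[OF F e(1)] by blast
  obtain C where C: "\<And>x. cmod (G x) \<le> C" using G(2) by (auto simp: bounded_iff)
  have [measurable]: "G \<in> borel_measurable borel" using G by auto
  have bi: "integrable lborel (\<lambda>y. H y * K y)" if "integrable lborel H" "\<And>y. cmod (K y) \<le> D" "K \<in> borel_measurable borel"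
    for H K :: "'a \<Rightarrow> complex" and D
  proof (rule Bochner_Integration.integrable_bound[of _ "\<lambda>y. D * cmod (H y)"])
    show "AE x in lborel. cmod (H x * K x) \<le> norm (D * cmod (H x))"
    proof (rule AE_I2)
      fix x show "cmod (H x * K x) \<le> norm (D * cmod (H x))"
        using mult_right_mono[OF that(2)[of x] norm_ge_zero[of "H x"]]
        by (simp add: norm_mult mult.commute[of "cmod (H x)"] order_trans[OF _ abs_ge_self])
    qed
  qed (use that in auto)
  have est: "cmod ((LINT y|lborel. F (y + u) * cnj (F y)) - (LINT y|lborel. F (y + u) * cnj (G y))) \<le> B * e" for u
  proof -
    have i: "integrable lborel (\<lambda>y. F (y + u) * cnj (F y))" "integrable lborel (\<lambda>y. F (y + u) * cnj (G y))"
      using bi[OF integrable_translate[OF F], of "\<lambda>y. cnj (F y)" B] bi[OF integrable_translate[OF F], of "\<lambda>y. cnj (G y)" C] B C by auto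
    have "cmod ((LINT y|lborel. F (y + u) * cnj (F y)) - (LINT y|lborel. F (y + u) * cnj (G y)))
      = cmod (LINT y|lborel. F (y + u) * cnj (F y) - F (y + u) * cnj (G y))"
      using i by simp
    also have "\<dots> \<le> (LINT y|lborel. cmod (F (y + u) * cnj (F y) - F (y + u) * cnj (G y)))"
      by (rule integral_norm_bound)
    also have "\<dots> \<le> (LINT y|lborel. B * cmod (F y - G y))"
    proof (rule integral_mono)
      fix y
      have "cmod (F (y + u) * cnj (F y) - F (y + u) * cnj (G y)) = cmod (F (y + u)) * cmod (F y - G y)"
        by (simp add: norm_mult flip: right_diff_distrib complex_cnj_diff)
      then show "cmod (F (y + u) * cnj (F y) - F (y + u) * cnj (G y)) \<le> B * cmod (F y - G y)"
        using B by (simp add: mult_right_mono)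
    qed (use i F G in auto)
    also have "\<dots> \<le> B * e" using G(4) B0 by (simp add: mult_left_mono)
    finally show ?thesis .
  qed
  have "(\<lambda>n. LINT y|lborel. F (y + X n) * cnj (G y)) = (\<lambda>n. LINT y|lborel. F y * cnj (G (y - X n)))"
  proof
    fix n show "(LINT y|lborel. F (y + X n) * cnj (G y)) = (LINT y|lborel. F y * cnj (G (y - X n)))"
      using integral_translate[of "\<lambda>y. F y * cnj (G (y - X n))" "X n"] by simp
  qed
  also have "\<dots> \<longlonglongrightarrow> (LINT y|lborel. F y * cnj (G y))"
  proof (rule integral_dominated_convergence[where w="\<lambda>y. C * cmod (F y)"])
    show "AE x in lborel. (\<lambda>i. F x * cnj (G (x - X i))) \<longlonglongrightarrow> F x * cnj (G x)"
    proof (rule AE_I2)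
      fix x :: 'a
      have "(\<lambda>i. x - X i) \<longlonglongrightarrow> x - 0" by (intro tendsto_intros X)
      then have "(\<lambda>i. G (x - X i)) \<longlonglongrightarrow> G x"
        using G(1) continuous_on_tendsto_compose[OF G(1), of "\<lambda>i. x - X i" x] by simp
      then show "(\<lambda>i. F x * cnj (G (x - X i))) \<longlonglongrightarrow> F x * cnj (G x)" by (intro tendsto_intros)
    qed
    show "AE x in lborel. cmod (F x * cnj (G (x - X i))) \<le> C * cmod (F x)" for i
      by (rule AE_I2) (simp add: norm_mult mult.commute[of C] mult_left_mono C)
  qed (use F in auto)
  finally have "eventually (\<lambda>n. dist (LINT y|lborel. F (y + X n) * cnj (G y)) (LINT y|lborel. F y * cnj (G y)) < r / 2) sequentially"
    using \<open>r > 0\<close> by (intro tendstoD) auto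
  then obtain N where N: "\<And>n. n \<ge> N \<Longrightarrow> dist (LINT y|lborel. F (y + X n) * cnj (G y)) (LINT y|lborel. F y * cnj (G y)) < r / 2"
    by (auto simp: eventually_sequentially)
  show "\<exists>N. \<forall>n\<ge>N. cmod ((LINT y|lborel. F (y + X n) * cnj (F y)) - (LINT y|lborel. F y * cnj (F y))) < r"
  proof (intro exI allI impI)
    fix n assume "n \<ge> N"
    have tri: "cmod (a - d) \<le> cmod (a - b) + cmod (b - c) + cmod (d - c)" for a b c d :: complex
      using norm_triangle_ineq[of "a - b" "b - c"] norm_triangle_ineq4[of "a - c" "d - c"] by simp
    from N[OF \<open>n \<ge> N\<close>] est[of "X n"] est[of 0] e2
    show "cmod ((LINT y|lborel. F (y + X n) * cnj (F y)) - (LINT y|lborel. F y * cnj (F y))) < r"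
      using tri[of "LINT y|lborel. F (y + X n) * cnj (F y)" "LINT y|lborel. F y * cnj (F y)"
        "LINT y|lborel. F (y + X n) * cnj (G y)" "LINT y|lborel. F y * cnj (G y)"]
      unfolding dist_norm add_0_right by linarith
  qed
qed

text \<open>Truncation at height \<open>m\<close> reduces to bounded functions. The truncation error
  tends to 0 in the norm of \<open>L2\<close>, and it enters the autocorrelation uniformly in the
  shift because translations are isometries.\<close>

lemma L2_autocorrelation_continuous:
  fixes F :: "'a::euclidean_space \<Rightarrow> complex"
  assumes F: "integrable lborel F" "F \<in> L2" and X: "X \<longlonglongrightarrow> 0"
  shows "(\<lambda>n. LINT y|lborel. F (y + X n) * cnj (F y)) \<longlonglongrightarrow> (LINT y|lborel. F y * cnj (F y))"
proof (rule LIMSEQ_I)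
  fix r :: real assume "r > 0"
  have [measurable]: "F \<in> borel_measurable borel" using F by auto
  define T where "T m x = (if cmod (F x) \<le> real m then F x else 0)" for m x
  have [measurable]: "T m \<in> borel_measurable borel" for m by (simp add: T_def[abs_def])
  have TF: "cmod (T m x) \<le> cmod (F x)" "cmod (F x - T m x) \<le> cmod (F x)" for m x by (auto simp: T_def)
  have TL2: "T m \<in> L2" for m
    using TF(1)[of m] by (intro L2I Bochner_Integration.integrable_bound[OF L2_sq_integrable[OF F(2)]])
      (auto intro!: power_mono)
  have DL2: "(\<lambda>x. F x - T m x) \<in> L2" for m by (intro L2_diff F TL2)
  have Ti: "integrable lborel (T m)" for m
    using TF(1)[of m] by (intro Bochner_Integration.integrable_bound[OF F(1)]) auto
  have "(\<lambda>m. LINT x|lborel. (cmod (F x - T m x))\<^sup>2) \<longlonglongrightarrow> integral\<^sup>L (lborel :: 'a measure) (\<lambda>x. 0 :: real)"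
  proof (rule integral_dominated_convergence[where w="\<lambda>x. (cmod (F x))\<^sup>2" and M="lborel :: 'a measure"])
    show "AE x in lborel. (\<lambda>i. (cmod (F x - T i x))\<^sup>2) \<longlonglongrightarrow> 0"
    proof (rule AE_I2)
      fix x :: 'a
      obtain m0 :: nat where "cmod (F x) \<le> m0" using real_arch_simple by blast
      then have "eventually (\<lambda>m. (cmod (F x - T m x))\<^sup>2 = 0) sequentially"
        by (auto simp: eventually_sequentially T_def intro!: exI[of _ m0])
      then show "(\<lambda>i. (cmod (F x - T i x))\<^sup>2) \<longlonglongrightarrow> 0" by (rule tendsto_eventually)
    qed
    show "AE x in lborel. norm ((cmod (F x - T m x))\<^sup>2) \<le> (cmod (F x))\<^sup>2" for m
      using TF(2)[of _ m] by (intro AE_I2) (auto intro!: power_mono)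
  qed (use F in \<open>auto simp: L2_def\<close>)
  then have "(\<lambda>m. L2_norm (\<lambda>x. F x - T m x)) \<longlonglongrightarrow> 0"
    unfolding L2_norm_def using tendsto_real_sqrt by fastforce
  then have "(\<lambda>m. L2_norm (\<lambda>x. F x - T m x) * L2_norm F) \<longlonglongrightarrow> 0 * L2_norm F" by (intro tendsto_intros)
  \<comment> \<open>The error for one shift consists of two terms bounded by this product, hence is
    below \<open>r / 3\<close>; it is incurred at shift \<open>X n\<close> and at shift 0.\<close>
  then have "eventually (\<lambda>m. L2_norm (\<lambda>x. F x - T m x) * L2_norm F < r / 6) sequentially"
    using \<open>r > 0\<close> by (intro order_tendstoD(2)) auto
  then obtain m where m: "L2_norm (\<lambda>x. F x - T m x) * L2_norm F < r / 6"
    by (auto simp: eventually_sequentially)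
  have TFn: "L2_norm (T m) \<le> L2_norm F" unfolding L2_norm_def
    using L2_sq_integrable[OF TL2[of m]] L2_sq_integrable[OF F(2)] TF(1)[of m]
    by (intro real_sqrt_le_mono integral_mono) (auto intro!: power_mono)
  have est: "cmod ((LINT y|lborel. F (y + u) * cnj (F y)) - (LINT y|lborel. T m (y + u) * cnj (T m y))) < r / 3" for u
  proof -
    note tr = L2_translate[OF F(2), of u] L2_translate[OF TL2[of m], of u] L2_translate[OF DL2[of m], of u]
    have "(LINT y|lborel. F (y + u) * cnj (F y)) - (LINT y|lborel. T m (y + u) * cnj (T m y))
      = ip (\<lambda>y. F (y + u)) (\<lambda>y. F y - T m y) + ip (\<lambda>y. F (y + u) - T m (y + u)) (T m)"
      unfolding ip_diff_right[OF F(2) TL2 tr(1)] ip_diff_left[OF tr(1) tr(3) TL2] by (simp add: ip_def)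
    also have "cmod \<dots> \<le> L2_norm (\<lambda>y. F (y + u)) * L2_norm (\<lambda>y. F y - T m y) + L2_norm (\<lambda>y. F (y + u) - T m (y + u)) * L2_norm (T m)"
      using tr F TL2[of m] DL2[of m] by (intro norm_triangle_mono ip_bound) auto
    also have "\<dots> \<le> 2 * (L2_norm (\<lambda>x. F x - T m x) * L2_norm F)"
      using mult_left_mono[OF TFn L2_norm_nonneg[of "\<lambda>x. F x - T m x"]]
        mult.commute[of "L2_norm F" "L2_norm (\<lambda>x. F x - T m x)"]
      unfolding tr(2) tr(6) by linarith
    also have "\<dots> < r / 3" using m by simp
    finally show ?thesis .
  qed
  have "cmod (T m x) \<le> real m" for x by (simp add: T_def)
  from L2_autocorrelation_continuous_bounded[OF Ti this X]
  have "eventually (\<lambda>n. dist (LINT y|lborel. T m (y + X n) * cnj (T m y)) (LINT y|lborel. T m y * cnj (T m y)) < r / 3) sequentially"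
    using \<open>r > 0\<close> by (intro tendstoD) auto
  then obtain N where N: "\<And>n. n \<ge> N \<Longrightarrow> dist (LINT y|lborel. T m (y + X n) * cnj (T m y)) (LINT y|lborel. T m y * cnj (T m y)) < r / 3"
    by (auto simp: eventually_sequentially)
  show "\<exists>N. \<forall>n\<ge>N. cmod ((LINT y|lborel. F (y + X n) * cnj (F y)) - (LINT y|lborel. F y * cnj (F y))) < r"
  proof (intro exI allI impI)
    fix n assume "n \<ge> N"
    have tri: "cmod (a - d) \<le> cmod (a - b) + cmod (b - c) + cmod (d - c)" for a b c d :: complex
      using norm_triangle_ineq[of "a - b" "b - c"] norm_triangle_ineq4[of "a - c" "d - c"] by simp
    from N[OF \<open>n \<ge> N\<close>] est[of "X n"] est[of 0]
    show "cmod ((LINT y|lborel. F (y + X n) * cnj (F y)) - (LINT y|lborel. F y * cnj (F y))) < r"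
      using tri[of "LINT y|lborel. F (y + X n) * cnj (F y)" "LINT y|lborel. F y * cnj (F y)"
        "LINT y|lborel. T m (y + X n) * cnj (T m y)" "LINT y|lborel. T m y * cnj (T m y)"]
      unfolding dist_norm add_0_right by linarith
  qed
qed

lemma integrable_pair_mult:
  fixes f :: "'a::euclidean_space \<Rightarrow> complex" and g :: "'b::euclidean_space \<Rightarrow> complex"
  assumes f: "integrable lborel f" and g: "integrable lborel g"
  shows "integrable (lborel \<Otimes>\<^sub>M lborel) (\<lambda>(x, y). f x * g y)"
proof (rule lborel_pair.Fubini_integrable)
  have [measurable]: "f \<in> borel_measurable borel" "g \<in> borel_measurable borel" using f g by auto
  show "(\<lambda>(x, y). f x * g y) \<in> borel_measurable (lborel \<Otimes>\<^sub>M lborel)" by measurable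
  show "integrable lborel (\<lambda>x. LINT y|lborel. norm (case (x, y) of (x, y) \<Rightarrow> f x * g y))"
    using f by (simp add: norm_mult)
  show "AE x in lborel. integrable lborel (\<lambda>y. case (x, y) of (x, y) \<Rightarrow> f x * g y)"
    using g by simp
qed

section \<open>Fourier transforms of integrable functions\<close>

lemma cis_measurable [measurable (raw)]: 
  "f \<in> borel_measurable M \<Longrightarrow> (\<lambda>x. cis (f x)) \<in> borel_measurable M"
  by (rule measurable_compose[OF _ borel_measurable_continuous_onI]) (auto intro: continuous_intros)

lemma integrable_cis_mult:
  assumes "integrable M f" "g \<in> borel_measurable M"
  shows "integrable M (\<lambda>x. cis (g x) * f x)"
  using assms by (intro Bochner_Integration.integrable_bound[OF assms(1)]) (auto simp: norm_mult)

lemma fourier_measurable [measurable]: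
  assumes [measurable]: "f \<in> borel_measurable borel"
  shows "fourier f \<in> borel_measurable borel"
proof -
  have "(\<lambda>\<xi>. LINT x|lborel. cis (- 2 * pi * (x \<bullet> \<xi>)) * f x) \<in> borel_measurable lborel" 
    by (rule lborel.borel_measurable_lebesgue_integral) (simp add: split_beta')
  then show ?thesis unfolding fourier_def[abs_def] by simp
qed

lemma fourier_multiplication_formula:
  fixes f g :: "'a::euclidean_space \<Rightarrow> complex"
  assumes f: "integrable lborel f" and g: "integrable lborel g"
  shows "(LINT \<xi>|lborel. f \<xi> * fourier g \<xi>) = (LINT x|lborel. fourier f x * g x)"
proof -
  have [measurable]: "f \<in> borel_measurable borel" "g \<in> borel_measurable borel" using f g by auto
  have i: "integrable (lborel \<Otimes>\<^sub>M lborel) (\<lambda>(\<xi>, x). f \<xi> * (cis (- 2 * pi * (x \<bullet> \<xi>)) * g x))"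
    using integrable_cis_mult[OF integrable_pair_mult[OF f g], of "\<lambda>(\<xi>, x). - 2 * pi * (x \<bullet> \<xi>)"]
    by (simp add: split_beta' mult_ac)
  have "(LINT \<xi>|lborel. f \<xi> * fourier g \<xi>) = (LINT \<xi>|lborel. LINT x|lborel. f \<xi> * (cis (- 2 * pi * (x \<bullet> \<xi>)) * g x))"
    by (simp add: fourier_def)
  also have "\<dots> = (LINT x|lborel. LINT \<xi>|lborel. f \<xi> * (cis (- 2 * pi * (x \<bullet> \<xi>)) * g x))"
    using lborel_pair.Fubini_integral[OF i] by simp
  also have "\<dots> = (LINT x|lborel. LINT \<xi>|lborel. (cis (- 2 * pi * (\<xi> \<bullet> x)) * f \<xi>) * g x)"
    by (simp add: mult_ac inner_commute)
  also have "\<dots> = (LINT x|lborel. fourier f x * g x)"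
    by (simp add: fourier_def)
  finally show ?thesis .
qed

text \<open>Integrating the modulus over the shift first gives the square of the L1 norm, which
  licenses Fubini. The substitution \<open>u + y\<close> then factors the phase into the transform
  of \<open>F\<close> and its conjugate.\<close>

lemma fourier_autocorrelation:
  fixes F :: "'a::euclidean_space \<Rightarrow> complex"
  assumes F: "integrable lborel F"
  defines "A \<equiv> \<lambda>u. LINT y|lborel. F (y + u) * cnj (F y)"
  shows "integrable lborel A" and "fourier A \<xi> = complex_of_real ((cmod (fourier F \<xi>))\<^sup>2)"
proof -
  have [measurable]: "F \<in> borel_measurable borel" using F by auto
  have i: "integrable (lborel \<Otimes>\<^sub>M lborel) (\<lambda>(y, u). F (y + u) * cnj (F y))"
  proof (rule lborel_pair.Fubini_integrable)
    have "(LINT u|lborel. norm (F (y + u) * cnj (F y))) = (LINT u|lborel. norm (F u)) * norm (F y)" for y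
      using integral_translate[of "\<lambda>u. norm (F u)" y] by (simp add: norm_mult add.commute)
    then show "integrable lborel (\<lambda>y. LINT u|lborel. norm (case (y, u) of (y, u) \<Rightarrow> F (y + u) * cnj (F y)))"
      using F by simp
    show "AE y in lborel. integrable lborel (\<lambda>u. case (y, u) of (y, u) \<Rightarrow> F (y + u) * cnj (F y))"
      using integrable_translate[OF F] by (simp add: add.commute)
  qed measurable
  show "integrable lborel A"
    unfolding A_def using lborel_pair.integrable_snd[OF i] by simp
  have i2: "integrable (lborel \<Otimes>\<^sub>M lborel) (\<lambda>(y, u). cis (- 2 * pi * (u \<bullet> \<xi>)) * (F (y + u) * cnj (F y)))"
    using integrable_cis_mult[OF i, of "\<lambda>(y, u). - 2 * pi * (u \<bullet> \<xi>)"] by (simp add: split_beta')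
  have "fourier A \<xi> = (LINT u|lborel. LINT y|lborel. cis (- 2 * pi * (u \<bullet> \<xi>)) * (F (y + u) * cnj (F y)))"
    by (simp add: fourier_def A_def)
  also have "\<dots> = (LINT y|lborel. LINT u|lborel. cis (- 2 * pi * (u \<bullet> \<xi>)) * (F (y + u) * cnj (F y)))"
    using lborel_pair.Fubini_integral[OF i2] by simp
  also have "\<dots> = (LINT y|lborel. fourier F \<xi> * cnj (cis (- 2 * pi * (y \<bullet> \<xi>)) * F y))"
  proof (rule Bochner_Integration.integral_cong[OF refl])
    fix y
    have "(LINT u|lborel. cis (- 2 * pi * (u \<bullet> \<xi>)) * (F (y + u) * cnj (F y)))
      = (LINT u|lborel. (cis (- 2 * pi * ((u + y) \<bullet> \<xi>)) * F (u + y)) * cnj (cis (- 2 * pi * (y \<bullet> \<xi>)) * F y))"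
      by (intro Bochner_Integration.integral_cong refl)
         (simp add: inner_add_left add.commute cis_cnj mult_ac flip: cis_mult cis_inverse, simp add: cis_mult algebra_simps)
    also have "\<dots> = fourier F \<xi> * cnj (cis (- 2 * pi * (y \<bullet> \<xi>)) * F y)"
      unfolding fourier_def using integral_translate[of "\<lambda>u. cis (- 2 * pi * (u \<bullet> \<xi>)) * F u" y] by simp
    finally show "(LINT u|lborel. cis (- 2 * pi * (u \<bullet> \<xi>)) * (F (y + u) * cnj (F y))) = fourier F \<xi> * cnj (cis (- 2 * pi * (y \<bullet> \<xi>)) * F y)" .
  qed
  also have "\<dots> = fourier F \<xi> * cnj (fourier F \<xi>)"
    unfolding fourier_def by (simp only: integral_mult_right_zero Bochner_Integration.integral_cnj)
  finally show "fourier A \<xi> = complex_of_real ((cmod (fourier F \<xi>))\<^sup>2)"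
    by (simp only: complex_norm_square)
qed

lemma fourier_bound:
  fixes F :: "'a::euclidean_space \<Rightarrow> complex"
  shows "cmod (fourier F \<xi>) \<le> (LINT x|lborel. cmod (F x))"
proof -
  have "cmod (fourier F \<xi>) \<le> (LINT x|lborel. cmod (cis (- 2 * pi * (x \<bullet> \<xi>)) * F x))"
    unfolding fourier_def by (rule integral_norm_bound)
  then show ?thesis by (simp add: norm_mult)
qed

lemma fourier_gaussian:
  assumes "a > 0"
  shows "fourier (\<lambda>x::'a::euclidean_space. complex_of_real (exp (- a * (norm x)\<^sup>2))) \<xi> =
    complex_of_real (sqrt (pi / a) ^ DIM('a) * exp (- (pi\<^sup>2 / a * (norm \<xi>)\<^sup>2)))"
  unfolding fourier_def by (rule gaussian_fourier(2)[OF assms])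

text \<open>The squared modulus of the Fourier transform is the transform of the autocorrelation, so the
  multiplication formula moves the Gaussian weight onto an approximate identity.\<close>

lemma fourier_gaussian_weight:
  fixes F :: "'a::euclidean_space \<Rightarrow> complex"
  assumes F: "integrable lborel F" and c: "c > 0"
  defines "A \<equiv> \<lambda>u. LINT y|lborel. F (y + u) * cnj (F y)"
  shows "(\<integral>\<^sup>+\<xi>. ennreal (exp (- (pi * c\<^sup>2) * (norm \<xi>)\<^sup>2) * (cmod (fourier F \<xi>))\<^sup>2) \<partial>lborel)
       = ennreal (Re (LINT v|lborel. A (c *\<^sub>R v) * complex_of_real (exp (- pi * (norm v)\<^sup>2))))"
proof -
  have [measurable]: "F \<in> borel_measurable borel" using F by auto
  let ?a = "pi * c\<^sup>2"
  have a: "?a > 0" using c by simp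
  define B where "B = (LINT x|lborel. cmod (F x))"
  have i1: "integrable lborel (\<lambda>\<xi>. exp (- ?a * (norm \<xi>)\<^sup>2) * (cmod (fourier F \<xi>))\<^sup>2)"
  proof (rule Bochner_Integration.integrable_bound)
    show "integrable lborel (\<lambda>\<xi>::'a. exp (- ?a * (norm \<xi>)\<^sup>2) * B\<^sup>2)"
      using gaussian_integral(1)[OF a, where 'a='a] by simp
    show "AE x in lborel. norm (exp (- ?a * (norm x)\<^sup>2) * (cmod (fourier F x))\<^sup>2) \<le> norm (exp (- ?a * (norm x)\<^sup>2) * B\<^sup>2)"
      by (rule AE_I2) (simp add: fourier_bound B_def power_mono)
  qed measurable
  have gi: "integrable lborel (\<lambda>x::'a. complex_of_real (exp (- ?a * (norm x)\<^sup>2)))"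
    using gaussian_integral(1)[OF a, where 'a='a] by simp
  have Ai: "integrable lborel A" and FA: "\<And>\<xi>. fourier A \<xi> = complex_of_real ((cmod (fourier F \<xi>))\<^sup>2)"
    using fourier_autocorrelation[OF F] unfolding A_def by auto
  have iAg: "integrable lborel (\<lambda>u. A u * fourier (\<lambda>x. complex_of_real (exp (- ?a * (norm x)\<^sup>2))) u)"
    unfolding fourier_gaussian[OF a]
  proof (rule Bochner_Integration.integrable_bound)
    show "integrable lborel (\<lambda>u. A u * complex_of_real (sqrt (pi / ?a) ^ DIM('a)))" using Ai by simp
    show "AE x in lborel. cmod (A x * complex_of_real (sqrt (pi / ?a) ^ DIM('a) * exp (- (pi\<^sup>2 / ?a * (norm x)\<^sup>2))))
         \<le> cmod (A x * complex_of_real (sqrt (pi / ?a) ^ DIM('a)))"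
      using a by (intro AE_I2) (auto simp: norm_mult mult.assoc intro!: mult_left_mono mult_right_le_one_le)
    show "(\<lambda>u. A u * complex_of_real (sqrt (pi / ?a) ^ DIM('a) * exp (- (pi\<^sup>2 / ?a * (norm u)\<^sup>2)))) \<in> borel_measurable lborel"
      using Ai by measurable
  qed
  have "complex_of_real (LINT \<xi>|lborel. exp (- ?a * (norm \<xi>)\<^sup>2) * (cmod (fourier F \<xi>))\<^sup>2)
      = (LINT \<xi>|lborel. complex_of_real (exp (- ?a * (norm \<xi>)\<^sup>2)) * fourier A \<xi>)"
    unfolding FA by (simp flip: of_real_mult of_real_power)
  also have "\<dots> = (LINT u|lborel. A u * fourier (\<lambda>x. complex_of_real (exp (- ?a * (norm x)\<^sup>2))) u)"
    using fourier_multiplication_formula[OF gi Ai] by (simp add: mult.commute)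
  also have "\<dots> = (\<bar>c\<bar> ^ DIM('a)) *\<^sub>R (LINT v|lborel. A (c *\<^sub>R v) * fourier (\<lambda>x. complex_of_real (exp (- ?a * (norm x)\<^sup>2))) (c *\<^sub>R v))"
    using c by (intro integral_scale[OF iAg]) auto
  also have "\<dots> = (LINT v|lborel. (\<bar>c\<bar> ^ DIM('a)) *\<^sub>R (A (c *\<^sub>R v) * fourier (\<lambda>x. complex_of_real (exp (- ?a * (norm x)\<^sup>2))) (c *\<^sub>R v)))"
    by simp
  also have "\<dots> = (LINT v|lborel. A (c *\<^sub>R v) * complex_of_real (exp (- pi * (norm v)\<^sup>2)))"
  proof (rule Bochner_Integration.integral_cong[OF refl])
    fix v :: 'a
    \<comment> \<open>The Jacobian of the dilation by \<open>c\<close> cancels the total mass of the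
      transformed Gaussian, leaving a fixed Gaussian of integral 1.\<close>
    have "sqrt (pi / ?a) = 1 / c" using c by (simp add: real_sqrt_divide)
    then have s: "\<bar>c\<bar> ^ DIM('a) * sqrt (pi / ?a) ^ DIM('a) = 1"
      using c by (simp flip: power_mult_distrib)
    have e: "pi\<^sup>2 / ?a * (norm (c *\<^sub>R v))\<^sup>2 = pi * (norm v)\<^sup>2"
      using c by (simp add: power_mult_distrib power2_eq_square)
    have "(\<bar>c\<bar> ^ DIM('a)) *\<^sub>R (A (c *\<^sub>R v) * complex_of_real (sqrt (pi / ?a) ^ DIM('a) * E)) = (\<bar>c\<bar> ^ DIM('a) * sqrt (pi / ?a) ^ DIM('a)) *\<^sub>R (A (c *\<^sub>R v) * complex_of_real E)" for E
      by (simp add: scaleR_conv_of_real mult_ac)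
    then show "(\<bar>c\<bar> ^ DIM('a)) *\<^sub>R (A (c *\<^sub>R v) * fourier (\<lambda>x. complex_of_real (exp (- ?a * (norm x)\<^sup>2))) (c *\<^sub>R v))
        = A (c *\<^sub>R v) * complex_of_real (exp (- pi * (norm v)\<^sup>2))"
      unfolding fourier_gaussian[OF a] e s by simp
  qed
  finally have "complex_of_real (LINT \<xi>|lborel. exp (- ?a * (norm \<xi>)\<^sup>2) * (cmod (fourier F \<xi>))\<^sup>2)
     = (LINT v|lborel. A (c *\<^sub>R v) * complex_of_real (exp (- pi * (norm v)\<^sup>2)))" .
  from arg_cong[OF this, of Re]
  have "(LINT \<xi>|lborel. exp (- ?a * (norm \<xi>)\<^sup>2) * (cmod (fourier F \<xi>))\<^sup>2)
     = Re (LINT v|lborel. A (c *\<^sub>R v) * complex_of_real (exp (- pi * (norm v)\<^sup>2)))"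
    by (simp only: Re_complex_of_real)
  then show ?thesis using i1 by (simp add: nn_integral_eq_integral)
qed

text \<open>The Gaussian weight is removed by letting \<open>c\<close> tend to 0: monotone
  convergence on the frequency side, dominated convergence on the other side, where continuity of
  the autocorrelation at 0 produces its value there, the squared norm of \<open>F\<close>.\<close>

theorem plancherel:
  fixes F :: "'a::euclidean_space \<Rightarrow> complex"
  assumes F: "integrable lborel F" "F \<in> L2"
  shows "(\<integral>\<^sup>+\<xi>. ennreal ((cmod (fourier F \<xi>))\<^sup>2) \<partial>lborel) = (\<integral>\<^sup>+x. ennreal ((cmod (F x))\<^sup>2) \<partial>lborel)"
proof -
  have [measurable]: "F \<in> borel_measurable borel" using F by auto
  define A where "A u = (LINT y|lborel. F (y + u) * cnj (F y))" for u
  define c where "c n = 1 / real (Suc n)" for n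
  have c: "c n > 0" for n by (simp add: c_def)
  have c0: "c \<longlonglongrightarrow> 0" unfolding c_def using LIMSEQ_inverse_real_of_nat by (simp add: inverse_eq_divide)
  have [measurable]: "A \<in> borel_measurable borel"
    using fourier_autocorrelation(1)[OF F(1)] unfolding A_def by auto
  have cdec: "c n \<le> c m" if "m \<le> n" for m n using that by (simp add: c_def frac_le)
  let ?G = "\<lambda>n \<xi>. ennreal (exp (- (pi * (c n)\<^sup>2) * (norm \<xi>)\<^sup>2) * (cmod (fourier F \<xi>))\<^sup>2)"
  have lim1: "(\<lambda>n. \<integral>\<^sup>+\<xi>. ?G n \<xi> \<partial>lborel) \<longlonglongrightarrow> (\<integral>\<^sup>+\<xi>. ennreal ((cmod (fourier F \<xi>))\<^sup>2) \<partial>lborel)"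
  proof (rule nn_integral_LIMSEQ)
    show "incseq ?G"
    proof (intro incseq_SucI le_funI ennreal_leI mult_right_mono)
      fix n and \<xi> :: 'a
      have "(c (Suc n))\<^sup>2 \<le> (c n)\<^sup>2" using cdec[of n "Suc n"] c by (intro power_mono) (auto simp: less_imp_le)
      then have "pi * (c (Suc n))\<^sup>2 * (norm \<xi>)\<^sup>2 \<le> pi * (c n)\<^sup>2 * (norm \<xi>)\<^sup>2"
        by (intro mult_right_mono mult_left_mono) auto
      then show "exp (- (pi * (c n)\<^sup>2) * (norm \<xi>)\<^sup>2) \<le> exp (- (pi * (c (Suc n))\<^sup>2) * (norm \<xi>)\<^sup>2)" by simp
    qed simp
    show "(\<lambda>i. ?G i x) \<longlonglongrightarrow> ennreal ((cmod (fourier F x))\<^sup>2)" for x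
    proof (rule tendsto_ennrealI)
      have "(\<lambda>i. exp (- (pi * (c i)\<^sup>2) * (norm x)\<^sup>2) * (cmod (fourier F x))\<^sup>2) \<longlonglongrightarrow> exp (- (pi * 0\<^sup>2) * (norm x)\<^sup>2) * (cmod (fourier F x))\<^sup>2"
        by (intro tendsto_intros c0)
      then show "(\<lambda>i. exp (- (pi * (c i)\<^sup>2) * (norm x)\<^sup>2) * (cmod (fourier F x))\<^sup>2) \<longlonglongrightarrow> (cmod (fourier F x))\<^sup>2"
        by simp
    qed
  qed measurable
  have Ab: "cmod (A u) \<le> (L2_norm F)\<^sup>2" for u
    using ip_bound[OF L2_translate(1)[OF F(2), of u] F(2)] L2_translate(2)[OF F(2), of u]
    unfolding A_def ip_def power2_eq_square by simp
  have g1: "integrable lborel (\<lambda>v::'a. exp (- pi * (norm v)\<^sup>2))" "(LINT v|lborel. exp (- pi * (norm (v::'a))\<^sup>2)) = 1"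
    using gaussian_integral(1,2)[of pi, where 'a='a] by simp_all
  have "(\<lambda>n. LINT v|lborel. A (c n *\<^sub>R v) * complex_of_real (exp (- pi * (norm v)\<^sup>2)))
     \<longlonglongrightarrow> (LINT v|lborel. A 0 * complex_of_real (exp (- pi * (norm (v::'a))\<^sup>2)))"
  proof (rule integral_dominated_convergence)
    show "integrable lborel (\<lambda>v::'a. (L2_norm F)\<^sup>2 * exp (- pi * (norm v)\<^sup>2))" using g1 by simp
    show "AE v in lborel. (\<lambda>n. A (c n *\<^sub>R v) * complex_of_real (exp (- pi * (norm v)\<^sup>2))) \<longlonglongrightarrow> A 0 * complex_of_real (exp (- pi * (norm v)\<^sup>2))"
    proof (rule AE_I2)
      fix v :: 'a
      have "(\<lambda>n. c n *\<^sub>R v) \<longlonglongrightarrow> 0 *\<^sub>R v" by (intro tendsto_intros c0)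
      then have "(\<lambda>n. A (c n *\<^sub>R v)) \<longlonglongrightarrow> A 0"
        using L2_autocorrelation_continuous[OF F, of "\<lambda>n. c n *\<^sub>R v"] by (simp add: A_def)
      then show "(\<lambda>n. A (c n *\<^sub>R v) * complex_of_real (exp (- pi * (norm v)\<^sup>2))) \<longlonglongrightarrow> A 0 * complex_of_real (exp (- pi * (norm v)\<^sup>2))"
        by (intro tendsto_intros)
    qed
    show "AE v in lborel. norm (A (c n *\<^sub>R v) * complex_of_real (exp (- pi * (norm v)\<^sup>2))) \<le> (L2_norm F)\<^sup>2 * exp (- pi * (norm v)\<^sup>2)" for n
      using Ab by (intro AE_I2) (simp add: norm_mult)
  qed measurable
  also have "(LINT v|lborel. A 0 * complex_of_real (exp (- pi * (norm (v::'a))\<^sup>2))) = A 0"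
    using g1 by simp
  also have "A 0 = complex_of_real ((L2_norm F)\<^sup>2)"
    using ip_self[of F] by (simp add: A_def ip_def)
  finally have "(\<lambda>n. Re (LINT v|lborel. A (c n *\<^sub>R v) * complex_of_real (exp (- pi * (norm v)\<^sup>2)))) \<longlonglongrightarrow> Re (complex_of_real ((L2_norm F)\<^sup>2))"
    by (rule tendsto_Re)
  then have "(\<lambda>n. \<integral>\<^sup>+\<xi>. ?G n \<xi> \<partial>lborel) \<longlonglongrightarrow> ennreal ((L2_norm F)\<^sup>2)"
    unfolding fourier_gaussian_weight[OF F(1) c] A_def by (intro tendsto_ennrealI) simp
  with lim1 have "(\<integral>\<^sup>+\<xi>. ennreal ((cmod (fourier F \<xi>))\<^sup>2) \<partial>lborel) = ennreal ((L2_norm F)\<^sup>2)"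
    by (rule LIMSEQ_unique)
  then show ?thesis using L2_norm_sq_nn[OF F(2)] by simp
qed

section \<open>The short-time Fourier transform\<close>

text \<open>The window is not normalised: its squared norm \<open>sqrt (1 / 2) ^ DIM('a)\<close> is the constant of the
  isometry below.\<close>

definition window :: "'a::euclidean_space \<times> 'a \<Rightarrow> 'a \<Rightarrow> complex"
  where "window z y = complex_of_real (exp (- pi * (norm (y - fst z))\<^sup>2)) * cis (2 * pi * (y \<bullet> snd z))"

definition stft :: "('a::euclidean_space \<Rightarrow> complex) \<Rightarrow> 'a \<times> 'a \<Rightarrow> complex"
  where "stft f z = ip f (window z)"

lemma window_measurable [measurable]: "(\<lambda>p. window (fst p) (snd p)) \<in> borel_measurable borel"
  unfolding window_def[abs_def]
  by (rule borel_measurable_continuous_onI) (intro continuous_intros)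

lemma window_measurable1 [measurable]: "window z \<in> borel_measurable borel"
  unfolding window_def[abs_def] by (rule borel_measurable_continuous_onI) (intro continuous_intros)

lemma cmod_window: "cmod (window z y) = exp (- pi * (norm (y - fst z))\<^sup>2)"
  by (simp add: window_def norm_mult)

lemma cmod_window_sq: "(cmod (window z y))\<^sup>2 = exp (- (2 * pi) * (norm (y - fst z))\<^sup>2)"
  by (simp add: cmod_window flip: exp_double)

lemma window_L2: "window z \<in> L2"
  and L2_norm_window: "(L2_norm (window (z :: 'a::euclidean_space \<times> 'a)))\<^sup>2 = sqrt (1 / 2) ^ DIM('a)"
proof -
  have i: "integrable lborel (\<lambda>y::'a. exp (- (2 * pi) * (norm y)\<^sup>2))" by (rule gaussian_integral) simp
  show "window z \<in> L2"
    using integrable_translate[OF i, of "- fst z"] by (intro L2I) (auto simp: cmod_window_sq)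
  show "(L2_norm (window z))\<^sup>2 = sqrt (1 / 2) ^ DIM('a)"
    unfolding L2_norm_sq cmod_window_sq
    using integral_translate[of "\<lambda>y. exp (- (2 * pi) * (norm y)\<^sup>2)" "- fst z"] gaussian_integral(2)[of "2 * pi", where 'a='a]
    by simp
qed

lemma L2_norm_window_le: "L2_norm (window z) \<le> 1"
proof (rule power2_le_imp_le)
  show "(L2_norm (window z))\<^sup>2 \<le> 1\<^sup>2" unfolding L2_norm_window by (simp add: power_le_one)
qed simp

lemma stft_measurable [measurable]:
  fixes f :: "'a::euclidean_space \<Rightarrow> complex"
  assumes [measurable]: "f \<in> borel_measurable borel"
  shows "stft f \<in> borel_measurable borel"
proof -
  have "(\<lambda>p::('a \<times> 'a) \<times> 'a. window (fst p) (snd p)) \<in> borel_measurable (lborel \<Otimes>\<^sub>M lborel)"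
    unfolding lborel_prod by measurable
  then have w: "(\<lambda>p::('a \<times> 'a) \<times> 'a. cnj (window (fst p) (snd p))) \<in> borel_measurable (lborel \<Otimes>\<^sub>M lborel)"
    by (rule borel_measurable_cnj)
  have "(\<lambda>z::'a \<times> 'a. LINT y|lborel. f y * cnj (window z y)) \<in> borel_measurable lborel"
    using w by (intro lborel.borel_measurable_lebesgue_integral) (auto simp: split_beta')
  then show ?thesis unfolding stft_def[abs_def] ip_def by simp
qed

lemma stft_conv_fourier:
  "stft f (x, \<xi>) = fourier (\<lambda>y. f y * complex_of_real (exp (- pi * (norm (y - x))\<^sup>2))) \<xi>"
  unfolding stft_def ip_def fourier_def window_def
  by (intro Bochner_Integration.integral_cong refl) (simp add: cis_cnj mult_ac)

lemma L2_mult_gaussian: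
  fixes f :: "'a::euclidean_space \<Rightarrow> complex"
  assumes f: "f \<in> L2" and a: "a > 0"
  shows "integrable lborel (\<lambda>y. f y * complex_of_real (exp (- a * (norm (y - x))\<^sup>2)))"
    and "(\<lambda>y. f y * complex_of_real (exp (- a * (norm (y - x))\<^sup>2))) \<in> L2"
proof -
  have [measurable]: "f \<in> borel_measurable borel" using f by auto
  have g: "(\<lambda>y::'a. complex_of_real (exp (- a * (norm (y - x))\<^sup>2))) \<in> L2"
    using integrable_translate[OF gaussian_integral(1)[of "2 * a"], of "-x"] a
    by (intro L2I) (auto simp: mult.assoc simp flip: exp_double)
  show "integrable lborel (\<lambda>y. f y * complex_of_real (exp (- a * (norm (y - x))\<^sup>2)))"
    by (rule L2_times_integrable[OF f g])
  show "(\<lambda>y. f y * complex_of_real (exp (- a * (norm (y - x))\<^sup>2))) \<in> L2"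
  proof (rule L2I)
    show "integrable lborel (\<lambda>y. (cmod (f y * complex_of_real (exp (- a * (norm (y - x))\<^sup>2))))\<^sup>2)"
    proof (rule Bochner_Integration.integrable_bound[OF L2_sq_integrable[OF f]])
      have "exp (- a * (norm (y - x))\<^sup>2) \<le> 1" for y using a by simp
      from power_le_one[OF exp_ge_zero this, of _ 2]
      show "AE y in lborel. norm ((cmod (f y * complex_of_real (exp (- a * (norm (y - x))\<^sup>2))))\<^sup>2) \<le> norm ((cmod (f y))\<^sup>2)"
        by (intro AE_I2) (simp add: norm_mult power_mult_distrib mult_right_le_one_le)
    qed measurable
  qed measurable
qed

lemma nn_integral_lborel_pair:
  fixes f :: "'a::euclidean_space \<times> 'b::euclidean_space \<Rightarrow> ennreal"
  assumes [measurable]: "f \<in> borel_measurable borel"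
  shows "(\<integral>\<^sup>+z. f z \<partial>lborel) = (\<integral>\<^sup>+x. \<integral>\<^sup>+y. f (x, y) \<partial>lborel \<partial>lborel)"
proof -
  have "f \<in> borel_measurable (lborel \<Otimes>\<^sub>M lborel)" unfolding lborel_prod by simp
  then have "(\<integral>\<^sup>+x. \<integral>\<^sup>+y. f (x, y) \<partial>lborel \<partial>lborel) = (\<integral>\<^sup>+z. f z \<partial>(lborel \<Otimes>\<^sub>M lborel))"
    by (rule lborel.nn_integral_fst)
  then show ?thesis unfolding lborel_prod by simp
qed

lemma nn_integral_swap:
  fixes f :: "'a::euclidean_space \<Rightarrow> 'b::euclidean_space \<Rightarrow> ennreal"
  assumes [measurable]: "(\<lambda>(x, y). f x y) \<in> borel_measurable borel"
  shows "(\<integral>\<^sup>+x. \<integral>\<^sup>+y. f x y \<partial>lborel \<partial>lborel) = (\<integral>\<^sup>+y. \<integral>\<^sup>+x. f x y \<partial>lborel \<partial>lborel)"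
proof -
  have "(\<lambda>(x, y). f x y) \<in> borel_measurable (lborel \<Otimes>\<^sub>M lborel)" unfolding lborel_prod by simp
  from lborel_pair.Fubini'[OF this] show ?thesis by simp
qed

lemma gaussian_translate_nn:
  fixes y :: "'a::euclidean_space"
  assumes "a > 0"
  shows "(\<integral>\<^sup>+x. ennreal (exp (- a * (norm (y - x))\<^sup>2)) \<partial>lborel) = ennreal (sqrt (pi / a) ^ DIM('a))"
  using nn_integral_reflect[of "\<lambda>x. ennreal (exp (- a * (norm x)\<^sup>2))" y] gaussian_integral(3)[OF assms, where 'a='a]
  by simp

text \<open>For a fixed position this is Plancherel in the frequency. Tonelli then integrates the
  squared window over the position, which gives the constant.\<close>

lemma stft_isometry_nn:
  fixes f :: "'a::euclidean_space \<Rightarrow> complex"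
  assumes f: "f \<in> L2"
  shows "(\<integral>\<^sup>+z. ennreal ((cmod (stft f z))\<^sup>2) \<partial>lborel) = ennreal (sqrt (1 / 2) ^ DIM('a) * (L2_norm f)\<^sup>2)"
proof -
  have [measurable]: "f \<in> borel_measurable borel" using f by auto
  have m: "(\<lambda>(x::'a, y). ennreal ((cmod (f y))\<^sup>2 * exp (- (2 * pi) * (norm (y - x))\<^sup>2))) \<in> borel_measurable borel"
    unfolding borel_prod[symmetric] by measurable
  have "(\<integral>\<^sup>+z. ennreal ((cmod (stft f z))\<^sup>2) \<partial>lborel) = (\<integral>\<^sup>+x. \<integral>\<^sup>+\<xi>. ennreal ((cmod (stft f (x, \<xi>)))\<^sup>2) \<partial>lborel \<partial>lborel)"
    by (rule nn_integral_lborel_pair) measurable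
  also have "\<dots> = (\<integral>\<^sup>+x. \<integral>\<^sup>+y. ennreal ((cmod (f y))\<^sup>2 * exp (- (2 * pi) * (norm (y - x))\<^sup>2)) \<partial>lborel \<partial>lborel)"
    unfolding stft_conv_fourier
    by (subst plancherel[OF L2_mult_gaussian[OF f]]) (simp_all add: norm_mult power_mult_distrib mult.assoc flip: exp_double)
  also have "\<dots> = (\<integral>\<^sup>+y. \<integral>\<^sup>+x. ennreal ((cmod (f y))\<^sup>2 * exp (- (2 * pi) * (norm (y - x))\<^sup>2)) \<partial>lborel \<partial>lborel)"
    by (rule nn_integral_swap[OF m])
  also have "\<dots> = (\<integral>\<^sup>+y. ennreal ((cmod (f y))\<^sup>2) * ennreal (sqrt (1 / 2) ^ DIM('a)) \<partial>lborel)"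
    using gaussian_translate_nn[of "2 * pi", where 'a='a] by (simp add: ennreal_mult nn_integral_cmult)
  also have "\<dots> = ennreal (sqrt (1 / 2) ^ DIM('a) * (L2_norm f)\<^sup>2)"
    using L2_norm_sq_nn[OF f] by (simp add: nn_integral_multc ennreal_mult mult.commute)
  finally show ?thesis .
qed

lemma stft_L2: "f \<in> L2 \<Longrightarrow> stft f \<in> L2"
  and L2_norm_stft: "f \<in> L2 \<Longrightarrow> (L2_norm (stft f))\<^sup>2 = sqrt (1 / 2) ^ DIM('a) * (L2_norm f)\<^sup>2"
  for f :: "'a::euclidean_space \<Rightarrow> complex"
proof -
  assume f: "f \<in> L2"
  have [measurable]: "f \<in> borel_measurable borel" using f by auto
  show 1: "stft f \<in> L2"
    using stft_isometry_nn[OF f] by (intro L2I integrableI_bounded) auto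
  show "(L2_norm (stft f))\<^sup>2 = sqrt (1 / 2) ^ DIM('a) * (L2_norm f)\<^sup>2"
    using L2_norm_sq_nn[OF 1] stft_isometry_nn[OF f] by simp
qed

lemma stft_add: "f \<in> L2 \<Longrightarrow> g \<in> L2 \<Longrightarrow> stft (\<lambda>x. f x + g x) z = stft f z + stft g z"
  by (simp add: stft_def ip_add_left window_L2)

lemma stft_diff: "f \<in> L2 \<Longrightarrow> g \<in> L2 \<Longrightarrow> stft (\<lambda>x. f x - g x) z = stft f z - stft g z"
  by (simp add: stft_def ip_diff_left window_L2)

lemma stft_cmult: "stft (\<lambda>x. c * f x) z = c * stft f z"
  by (simp add: stft_def ip_cmult_left)

text \<open>Polarisation: the norms of sums determine the real part of the inner product, and
  replacing \<open>g\<close> by \<i> times \<open>g\<close> turns the imaginary part into a real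
  part.\<close>

lemma stft_isometry:
  fixes f g :: "'a::euclidean_space \<Rightarrow> complex"
  assumes f: "f \<in> L2" and g: "g \<in> L2"
  shows "ip (stft f) (stft g) = complex_of_real (sqrt (1 / 2) ^ DIM('a)) * ip f g"
proof -
  have re: "Re (ip (stft f) (stft h)) = sqrt (1 / 2) ^ DIM('a) * Re (ip f h)" if h: "h \<in> L2" for h
  proof -
    have "(L2_norm (stft (\<lambda>x. f x + h x)))\<^sup>2 = (L2_norm (stft f))\<^sup>2 + 2 * Re (ip (stft f) (stft h)) + (L2_norm (stft h))\<^sup>2"
      using L2_norm_add_sq[OF stft_L2[OF f] stft_L2[OF h]] by (simp add: stft_add[OF f h, abs_def])
    then show ?thesis
      unfolding L2_norm_stft[OF f] L2_norm_stft[OF h] L2_norm_stft[OF L2_add[OF f h]] L2_norm_add_sq[OF f h]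
      by (simp add: algebra_simps)
  qed
  have "Im (ip (stft f) (stft g)) = sqrt (1 / 2) ^ DIM('a) * Im (ip f g)"
    using re[OF L2_cmult[OF g, of \<i>]] by (simp add: stft_cmult[abs_def] ip_cmult_right)
  with re[OF g] show ?thesis by (simp add: complex_eq_iff)
qed

section \<open>Wigner distribution and short-time Fourier transform\<close>

text \<open>The map has Jacobian of modulus 1. Instead of a determinant, Tonelli is applied to its
  factors: a translation of \<open>x\<close> by half of \<open>y\<close> for fixed \<open>y\<close>,
  then a reflection of \<open>y\<close> for fixed \<open>x\<close>.\<close>

lemma midpoint_distr:
  "distr (lborel :: ('a::euclidean_space \<times> 'a) measure) borel (\<lambda>z. (fst z + snd z /\<^sub>R 2, fst z - snd z /\<^sub>R 2)) = lborel"
    (is "distr _ _ ?T = _")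
proof (rule measure_eqI)
  have T [measurable]: "?T \<in> borel_measurable borel"
    by (rule borel_measurable_continuous_onI) (intro continuous_intros)
  fix A assume "A \<in> sets (distr (lborel :: ('a \<times> 'a) measure) borel ?T)"
  then have [measurable]: "A \<in> sets borel" by simp
  let ?i = "indicator A :: 'a \<times> 'a \<Rightarrow> ennreal"
  have m1: "(\<lambda>(x, y). ?i (x + y /\<^sub>R 2, x - y /\<^sub>R 2)) \<in> borel_measurable borel"
    using measurable_compose[OF T, of ?i borel] unfolding split_beta' by measurable
  have "(\<lambda>z::'a \<times> 'a. (fst z, fst z - snd z)) \<in> borel_measurable borel"
    by (rule borel_measurable_continuous_onI) (intro continuous_intros)
  from measurable_compose[OF this, of ?i borel]
  have m2: "(\<lambda>(x, y). ?i (x, x - y)) \<in> borel_measurable borel"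
    by (simp add: split_beta')
  have "(\<lambda>z::'a \<times> 'a. (snd z, snd z - fst z)) \<in> borel_measurable borel"
    by (rule borel_measurable_continuous_onI) (intro continuous_intros)
  from measurable_compose[OF this, of ?i borel]
  have m3: "(\<lambda>(y, x). ?i (x, x - y)) \<in> borel_measurable borel"
    by (simp add: split_beta')
  have m4: "(\<lambda>y. ?i (x, y)) \<in> borel_measurable borel" for x
    by (rule measurable_compose[of "\<lambda>y. (x, y)" borel borel]) 
       (auto intro!: borel_measurable_continuous_onI continuous_intros)
  have m5: "(\<lambda>x. ?i (x, x - y)) \<in> borel_measurable borel" for y
    by (rule measurable_compose[of "\<lambda>x. (x, x - y)" borel borel]) 
       (auto intro!: borel_measurable_continuous_onI continuous_intros)
  have "emeasure (distr lborel borel ?T) A = (\<integral>\<^sup>+z. ?i (?T z) \<partial>lborel)"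
    using nn_integral_distr[of ?T lborel borel ?i] T by (simp only: measurable_lborel2 nn_integral_indicator sets_distr borel_measurable_indicator) simp
  also have "\<dots> = (\<integral>\<^sup>+x. \<integral>\<^sup>+y. ?i (x + y /\<^sub>R 2, x - y /\<^sub>R 2) \<partial>lborel \<partial>lborel)"
    using nn_integral_lborel_pair[of "\<lambda>z. ?i (?T z)"] measurable_compose[OF T, of ?i borel] by (simp only: fst_conv snd_conv) simp
  also have "\<dots> = (\<integral>\<^sup>+y. \<integral>\<^sup>+x. ?i (x + y /\<^sub>R 2, x - y /\<^sub>R 2) \<partial>lborel \<partial>lborel)"
    by (rule nn_integral_swap[OF m1])
  also have "\<dots> = (\<integral>\<^sup>+y. \<integral>\<^sup>+x. ?i (x, x - y) \<partial>lborel \<partial>lborel)"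
  proof (rule nn_integral_cong)
    fix y :: 'a
    have "x + y /\<^sub>R 2 - y = x - y /\<^sub>R 2" for x
    proof -
      define h where "h = y /\<^sub>R 2"
      have y: "y = h + h" by (simp add: h_def flip: scaleR_add_left)
      show ?thesis unfolding h_def[symmetric] by (subst y) simp
    qed
    then show "(\<integral>\<^sup>+x. ?i (x + y /\<^sub>R 2, x - y /\<^sub>R 2) \<partial>lborel) = (\<integral>\<^sup>+x. ?i (x, x - y) \<partial>lborel)"
      using nn_integral_translate[OF m5[of y], of "y /\<^sub>R 2"] by (simp only:)
  qed
  also have "\<dots> = (\<integral>\<^sup>+x. \<integral>\<^sup>+y. ?i (x, x - y) \<partial>lborel \<partial>lborel)"
    by (rule nn_integral_swap[OF m3])
  also have "\<dots> = (\<integral>\<^sup>+x. \<integral>\<^sup>+y. ?i (x, y) \<partial>lborel \<partial>lborel)"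
    using nn_integral_reflect[OF m4] by simp
  also have "\<dots> = (\<integral>\<^sup>+z. ?i z \<partial>lborel)"
    by (subst nn_integral_lborel_pair) simp_all
  finally show "emeasure (distr lborel borel ?T) A = emeasure lborel A" by simp
qed simp

lemma nn_integral_midpoint:
  fixes H :: "'a::euclidean_space \<times> 'a \<Rightarrow> ennreal"
  assumes [measurable]: "H \<in> borel_measurable borel"
  shows "(\<integral>\<^sup>+x. \<integral>\<^sup>+y. H (x + y /\<^sub>R 2, x - y /\<^sub>R 2) \<partial>lborel \<partial>lborel) = (\<integral>\<^sup>+x. \<integral>\<^sup>+y. H (x, y) \<partial>lborel \<partial>lborel)"
proof -
  let ?T = "\<lambda>z::'a \<times> 'a. (fst z + snd z /\<^sub>R 2, fst z - snd z /\<^sub>R 2)"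
  have T [measurable]: "?T \<in> borel_measurable borel"
    by (rule borel_measurable_continuous_onI) (intro continuous_intros)
  have "(\<integral>\<^sup>+z. H z \<partial>lborel) = (\<integral>\<^sup>+z. H (?T z) \<partial>lborel)"
    using nn_integral_distr[of ?T lborel borel H] T unfolding midpoint_distr by simp
  moreover have "(\<integral>\<^sup>+z. H (?T z) \<partial>lborel) = (\<integral>\<^sup>+x. \<integral>\<^sup>+y. H (x + y /\<^sub>R 2, x - y /\<^sub>R 2) \<partial>lborel \<partial>lborel)"
    using nn_integral_lborel_pair[OF measurable_compose[OF T assms]] unfolding fst_conv snd_conv .
  ultimately show ?thesis using nn_integral_lborel_pair[OF assms] by simp
qed

lemma midpoint_integral:
  fixes H :: "'a::euclidean_space \<times> 'a \<Rightarrow> complex"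
  assumes H: "integrable lborel H"
  shows "integrable lborel (\<lambda>z. H (fst z + snd z /\<^sub>R 2, fst z - snd z /\<^sub>R 2))"
    and "(LINT z|lborel. H (fst z + snd z /\<^sub>R 2, fst z - snd z /\<^sub>R 2)) = (LINT z|lborel. H z)"
proof -
  let ?T = "\<lambda>z::'a \<times> 'a. (fst z + snd z /\<^sub>R 2, fst z - snd z /\<^sub>R 2)"
  have T: "?T \<in> lborel \<rightarrow>\<^sub>M borel" and [measurable]: "H \<in> borel_measurable borel"
    using H by (auto intro!: borel_measurable_continuous_onI continuous_intros)
  have "integrable (distr lborel borel ?T) H" unfolding midpoint_distr by (rule H)
  then show "integrable lborel (\<lambda>z. H (?T z))" by (rule integrable_distr[OF T])
  show "(LINT z|lborel. H (?T z)) = (LINT z|lborel. H z)"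
    using integral_distr[OF T, of H] unfolding midpoint_distr by simp
qed

lemma integral_lborel_pair:
  fixes H :: "'a::euclidean_space \<times> 'b::euclidean_space \<Rightarrow> complex"
  assumes "integrable lborel H"
  shows "(LINT z|lborel. H z) = (LINT x|lborel. LINT y|lborel. H (x, y))"
proof -
  have "integrable (lborel \<Otimes>\<^sub>M lborel) H" unfolding lborel_prod by (rule assms)
  from lborel_pair.integral_fst'[OF this] show ?thesis unfolding lborel_prod by simp
qed

section \<open>Integrability, bounds and measurability of the Wigner distribution\<close>

lemma wigner_conv_fourier: "wigner f (x, \<xi>) = fourier (\<lambda>y. f (x + y /\<^sub>R 2) * cnj (f (x - y /\<^sub>R 2))) \<xi>"
  by (simp add: wigner_def fourier_def inner_commute mult.assoc)

lemma L2_affine_half: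
  fixes f :: "'a::euclidean_space \<Rightarrow> complex"
  assumes f: "f \<in> L2" and c: "c = 1 / 2 \<or> c = - 1 / 2"
  shows "(\<lambda>y. f (x + c *\<^sub>R y)) \<in> L2" and "(L2_norm (\<lambda>y. f (x + c *\<^sub>R y)))\<^sup>2 = 2 ^ DIM('a) * (L2_norm f)\<^sup>2"
proof -
  have [measurable]: "f \<in> borel_measurable borel" using f by auto
  have c0: "c \<noteq> 0" "\<bar>c\<bar> = 1 / 2" using c by auto
  note t = integrable_translate[OF L2_sq_integrable[OF f], of x]
  show "(\<lambda>y. f (x + c *\<^sub>R y)) \<in> L2"
    using integrable_scale[OF t c0(1)] by (intro L2I) (auto simp: add.commute)
  have "(LINT y|lborel. (cmod (f y))\<^sup>2) = (1 / 2) ^ DIM('a) * (LINT y|lborel. (cmod (f (c *\<^sub>R y + x)))\<^sup>2)"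
    using integral_scale[OF t c0(1)] integral_translate[of "\<lambda>y. (cmod (f y))\<^sup>2" x] c0 by simp
  then show "(L2_norm (\<lambda>y. f (x + c *\<^sub>R y)))\<^sup>2 = 2 ^ DIM('a) * (L2_norm f)\<^sup>2"
    unfolding L2_norm_sq by (simp add: add.commute power_divide)
qed

text \<open>Cauchy-Schwarz for two copies of \<open>f\<close> dilated by a factor of modulus 1/2;
  the dilation accounts for the power of 2.\<close>

lemma wigner_integrand:
  fixes f :: "'a::euclidean_space \<Rightarrow> complex"
  assumes f: "f \<in> L2"
  shows "integrable lborel (\<lambda>y. f (x + y /\<^sub>R 2) * cnj (f (x - y /\<^sub>R 2)))"
    and "(LINT y|lborel. cmod (f (x + y /\<^sub>R 2) * cnj (f (x - y /\<^sub>R 2)))) \<le> 2 ^ DIM('a) * (L2_norm f)\<^sup>2"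
proof -
  have p: "(\<lambda>y. f (x + y /\<^sub>R 2)) \<in> L2" "(L2_norm (\<lambda>y. f (x + y /\<^sub>R 2)))\<^sup>2 = 2 ^ DIM('a) * (L2_norm f)\<^sup>2"
    using L2_affine_half[OF f, of "1/2" x] by (auto simp: inverse_eq_divide)
  have m: "(\<lambda>y. f (x - y /\<^sub>R 2)) \<in> L2" "(L2_norm (\<lambda>y. f (x - y /\<^sub>R 2)))\<^sup>2 = 2 ^ DIM('a) * (L2_norm f)\<^sup>2"
    using L2_affine_half[OF f, of "-1/2" x] by (auto simp: inverse_eq_divide)
  show "integrable lborel (\<lambda>y. f (x + y /\<^sub>R 2) * cnj (f (x - y /\<^sub>R 2)))"
    by (rule ip_integrable[OF p(1) m(1)])
  have "(L2_norm (\<lambda>y. f (x + y /\<^sub>R 2)))\<^sup>2 = (L2_norm (\<lambda>y. f (x - y /\<^sub>R 2)))\<^sup>2"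
    by (rule trans[OF p(2) m(2)[symmetric]])
  then have eq: "L2_norm (\<lambda>y. f (x + y /\<^sub>R 2)) = L2_norm (\<lambda>y. f (x - y /\<^sub>R 2))"
    by (rule power2_eq_imp_eq) (rule L2_norm_nonneg)+
  have "(LINT y|lborel. cmod (f (x + y /\<^sub>R 2) * cnj (f (x - y /\<^sub>R 2)))) = (LINT y|lborel. cmod (f (x + y /\<^sub>R 2)) * cmod (f (x - y /\<^sub>R 2)))"
    by (simp only: norm_mult complex_mod_cnj)
  also have "\<dots> \<le> L2_norm (\<lambda>y. f (x + y /\<^sub>R 2)) * L2_norm (\<lambda>y. f (x - y /\<^sub>R 2))"
    by (rule L2_Cauchy_Schwarz_abs[OF p(1) m(1)])
  also have "\<dots> = 2 ^ DIM('a) * (L2_norm f)\<^sup>2"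
    by (simp only: eq m(2)[symmetric] power2_eq_square[of "L2_norm (\<lambda>y. f (x - y /\<^sub>R 2))"])
  finally show "(LINT y|lborel. cmod (f (x + y /\<^sub>R 2) * cnj (f (x - y /\<^sub>R 2)))) \<le> 2 ^ DIM('a) * (L2_norm f)\<^sup>2" .
qed

lemma wigner_bound:
  fixes f :: "'a::euclidean_space \<Rightarrow> complex"
  assumes f: "f \<in> L2"
  shows "cmod (wigner f Y) \<le> 2 ^ DIM('a) * (L2_norm f)\<^sup>2"
  using wigner_conv_fourier[of f "fst Y" "snd Y"] 
    order_trans[OF fourier_bound wigner_integrand(2)[OF f, of "fst Y"], of "snd Y"] by simp

lemma wigner_measurable [measurable]:
  fixes f :: "'a::euclidean_space \<Rightarrow> complex"
  assumes [measurable]: "f \<in> borel_measurable borel"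
  shows "wigner f \<in> borel_measurable borel"
proof -
  have m1: "(\<lambda>p::('a \<times> 'a) \<times> 'a. fst (fst p) + snd p /\<^sub>R 2) \<in> borel_measurable borel"
    "(\<lambda>p::('a \<times> 'a) \<times> 'a. fst (fst p) - snd p /\<^sub>R 2) \<in> borel_measurable borel"
    "(\<lambda>p::('a \<times> 'a) \<times> 'a. cis (- 2 * pi * (snd (fst p) \<bullet> snd p))) \<in> borel_measurable borel"
    by (auto intro!: borel_measurable_continuous_onI continuous_intros)
  have "(\<lambda>p::('a \<times> 'a) \<times> 'a. cis (- 2 * pi * (snd (fst p) \<bullet> snd p)) * f (fst (fst p) + snd p /\<^sub>R 2) * cnj (f (fst (fst p) - snd p /\<^sub>R 2)))
      \<in> borel_measurable (lborel \<Otimes>\<^sub>M lborel)"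
    unfolding lborel_prod using m1 by measurable
  then have "(\<lambda>z. LINT y|lborel. cis (- 2 * pi * (snd z \<bullet> y)) * f (fst z + y /\<^sub>R 2) * cnj (f (fst z - y /\<^sub>R 2))) \<in> borel_measurable lborel"
    by (intro lborel.borel_measurable_lebesgue_integral) (auto simp: split_beta')
  then show ?thesis unfolding wigner_def by (simp add: split_beta')
qed


text \<open>A product of two transforms is written as one integral over pairs of points, the form to
  which the midpoint substitution applies.\<close>

lemma stft_product:
  fixes f :: "'a::euclidean_space \<Rightarrow> complex"
  assumes f: "f \<in> L2"
  defines "H \<equiv> \<lambda>z' z'' z. (f (fst z) * cnj (window z' (fst z))) * cnj (f (snd z) * cnj (window z'' (snd z)))"
  shows "integrable lborel (H z' z'')"
    and "(LINT z|lborel. H z' z'' z) = stft f z' * cnj (stft f z'')"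
proof -
  have i: "integrable lborel (\<lambda>y. f y * cnj (window z y))" for z
    by (rule ip_integrable[OF f window_L2])
  show 1: "integrable lborel (H z' z'')"
    using integrable_pair_mult[OF i[of z'] integrable_cnj[OF i[of z'']]]
    unfolding lborel_prod H_def by (simp add: split_beta')
  show "(LINT z|lborel. H z' z'' z) = stft f z' * cnj (stft f z'')"
    unfolding integral_lborel_pair[OF 1] unfolding H_def stft_def ip_def
    by (simp only: fst_conv snd_conv integral_mult_right_zero integral_mult_left_zero Bochner_Integration.integral_cnj)
qed

lemma fourier_modulated_gaussian:
  fixes y :: "'a::euclidean_space"
  shows "fourier (\<lambda>\<xi>. cis (2 * pi * (\<xi> \<bullet> b)) * complex_of_real (exp (- (2 * pi) * (norm (\<xi> - p))\<^sup>2))) y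
    = complex_of_real (sqrt (1 / 2) ^ DIM('a)) * (cis (- 2 * pi * (p \<bullet> (y - b))) * complex_of_real (exp (- (pi / 2) * (norm (y - b))\<^sup>2)))"
proof -
  let ?g = "\<lambda>\<xi>::'a. cis (- 2 * pi * ((\<xi> + p) \<bullet> (y - b))) * complex_of_real (exp (- (2 * pi) * (norm \<xi>)\<^sup>2))"
  have "fourier (\<lambda>\<xi>. cis (2 * pi * (\<xi> \<bullet> b)) * complex_of_real (exp (- (2 * pi) * (norm (\<xi> - p))\<^sup>2))) y
     = (LINT \<xi>|lborel. ?g (\<xi> + - p))"
    unfolding fourier_def mult.assoc[symmetric] cis_mult
    by (intro Bochner_Integration.integral_cong refl) (simp add: inner_diff_right algebra_simps)
  also have "\<dots> = (LINT \<xi>|lborel. ?g \<xi>)" by (rule integral_translate) measurable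
  also have "\<dots> = (LINT \<xi>|lborel. cis (- 2 * pi * (p \<bullet> (y - b))) * (cis (- 2 * pi * (\<xi> \<bullet> (y - b))) * complex_of_real (exp (- (2 * pi) * (norm \<xi>)\<^sup>2))))"
    unfolding mult.assoc[symmetric] cis_mult
    by (intro Bochner_Integration.integral_cong refl) (simp add: inner_add_left algebra_simps)
  also have "\<dots> = cis (- 2 * pi * (p \<bullet> (y - b))) * complex_of_real (sqrt (pi / (2 * pi)) ^ DIM('a) * exp (- (pi\<^sup>2 / (2 * pi) * (norm (y - b))\<^sup>2)))"
    using gaussian_fourier(2)[of "2 * pi" "y - b"] by simp
  also have "pi\<^sup>2 / (2 * pi) = pi / 2" by (simp add: power2_eq_square)
  finally show ?thesis by simp
qed

lemma wigner_gaussian_integrable: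
  fixes f :: "'a::euclidean_space \<Rightarrow> complex"
  assumes f: "f \<in> L2"
  shows "integrable lborel (\<lambda>Y. wigner f Y * complex_of_real (exp (- (2 * pi) * (norm (Y - p))\<^sup>2)))"
    and "(\<lambda>Y. wigner f Y * complex_of_real (exp (- (2 * pi) * (norm (Y - p))\<^sup>2))) \<in> L2"
proof -
  have [measurable]: "f \<in> borel_measurable borel" using f by auto
  have g: "integrable lborel (\<lambda>Y::'a \<times> 'a. exp (- a * (norm (Y - p))\<^sup>2))" if "a > 0" for a
    using integrable_translate[OF gaussian_integral(1)[OF that], of "- p"] by simp
  let ?B = "2 ^ DIM('a) * (L2_norm f)\<^sup>2"
  show "integrable lborel (\<lambda>Y. wigner f Y * complex_of_real (exp (- (2 * pi) * (norm (Y - p))\<^sup>2)))"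
  proof (rule Bochner_Integration.integrable_bound)
    show "integrable lborel (\<lambda>Y. ?B * exp (- (2 * pi) * (norm (Y - p))\<^sup>2))" using g[of "2 * pi"] by simp
    show "AE Y in lborel. norm (wigner f Y * complex_of_real (exp (- (2 * pi) * (norm (Y - p))\<^sup>2))) \<le> norm (?B * exp (- (2 * pi) * (norm (Y - p))\<^sup>2))"
      using wigner_bound[OF f] by (intro AE_I2) (simp add: norm_mult mult_right_mono)
  qed measurable
  show "(\<lambda>Y. wigner f Y * complex_of_real (exp (- (2 * pi) * (norm (Y - p))\<^sup>2))) \<in> L2"
  proof (intro L2I, measurable, rule Bochner_Integration.integrable_bound)
    show "integrable lborel (\<lambda>Y. ?B\<^sup>2 * exp (- (4 * pi) * (norm (Y - p))\<^sup>2))" using g[of "4 * pi"] by simp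
    show "AE Y in lborel. norm ((cmod (wigner f Y * complex_of_real (exp (- (2 * pi) * (norm (Y - p))\<^sup>2))))\<^sup>2) \<le> norm (?B\<^sup>2 * exp (- (4 * pi) * (norm (Y - p))\<^sup>2))"
    proof (rule AE_I2)
      fix Y
      have "(exp (- (2 * pi) * (norm (Y - p))\<^sup>2))\<^sup>2 = exp (- (4 * pi) * (norm (Y - p))\<^sup>2)"
        by (simp flip: exp_double)
      then show "norm ((cmod (wigner f Y * complex_of_real (exp (- (2 * pi) * (norm (Y - p))\<^sup>2))))\<^sup>2) \<le> norm (?B\<^sup>2 * exp (- (4 * pi) * (norm (Y - p))\<^sup>2))"
        using power_mono[OF wigner_bound[OF f, of Y], of 2] by (simp add: norm_mult power_mult_distrib mult_right_mono)
    qed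
  qed measurable
qed

text \<open>For fixed \<open>x\<close> the frequency integral of the Wigner distribution against the
  Gaussian is a Fourier multiplication formula, so the Gaussian factor is transformed instead and
  becomes a Gaussian in \<open>y\<close>. Read at the points \<open>x + y / 2\<close> and
  \<open>x - y / 2\<close>, the resulting Gaussian in \<open>(x, y)\<close> is a product of two
  windows.\<close>

lemma fourier_wigner_gaussian:
  fixes f :: "'a::euclidean_space \<Rightarrow> complex" and p q :: "'a \<times> 'a"
  assumes f: "f \<in> L2"
  shows "fourier (\<lambda>Y. wigner f Y * complex_of_real (exp (- (2 * pi) * (norm (Y - p))\<^sup>2))) (snd q, - fst q)
    = complex_of_real (sqrt (1 / 2) ^ DIM('a)) * cis (2 * pi * (snd p \<bullet> fst q)) * (stft f (p + q /\<^sub>R 2) * cnj (stft f (p - q /\<^sub>R 2)))"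
proof -
  obtain p1 p2 q1 q2 where pq: "p = (p1, p2)" "q = (q1, q2)" by (metis surj_pair)
  have [measurable]: "f \<in> borel_measurable borel" using f by auto
  let ?s = "complex_of_real (sqrt (1 / 2) ^ DIM('a))"
  let ?H = "\<lambda>z. (f (fst z) * cnj (window (p + q /\<^sub>R 2) (fst z))) * cnj (f (snd z) * cnj (window (p - q /\<^sub>R 2) (snd z)))"
  let ?F = "\<lambda>Y. wigner f Y * complex_of_real (exp (- (2 * pi) * (norm (Y - p))\<^sup>2))"
  let ?h = "\<lambda>x y. f (x + y /\<^sub>R 2) * cnj (f (x - y /\<^sub>R 2))"
  let ?g = "\<lambda>\<xi>. cis (2 * pi * (\<xi> \<bullet> q1)) * complex_of_real (exp (- (2 * pi) * (norm (\<xi> - p2))\<^sup>2))"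
  have gi: "integrable lborel ?g"
    using integrable_translate[OF gaussian_integral(1)[of "2 * pi"], of "- p2"] 
    by (intro integrable_cis_mult integrable_of_real) auto
  note mi = midpoint_integral[OF stft_product(1)[OF f, of "p + q /\<^sub>R 2" "p - q /\<^sub>R 2"]]
  have iF: "integrable lborel (\<lambda>Y. cis (- 2 * pi * (Y \<bullet> (snd q, - fst q))) * ?F Y)"
    by (rule integrable_cis_mult[OF wigner_gaussian_integrable(1)[OF f]]) measurable
  have pt: "cis (- 2 * pi * (x \<bullet> q2)) * complex_of_real (exp (- (2 * pi) * (norm (x - p1))\<^sup>2)) * (?h x y * fourier ?g y)
     = ?s * cis (2 * pi * (p2 \<bullet> q1)) * ?H (x + y /\<^sub>R 2, x - y /\<^sub>R 2)" for x y
  proof -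
    define A where "A = x - p1"
    define B where "B = (y - q1) /\<^sub>R 2"
    \<comment> \<open>The parallelogram law is what splits the joint Gaussian into one window per
      point; it also fixes the width of the Gaussian localisation that fits the chosen
      window.\<close>
    have par: "(norm (A + B))\<^sup>2 + (norm (A - B))\<^sup>2 = 2 * (norm A)\<^sup>2 + 2 * (norm B)\<^sup>2"
      unfolding power2_norm_eq_inner by (simp add: inner_add_left inner_add_right inner_diff_left inner_diff_right)
    have nB: "2 * (norm B)\<^sup>2 = (norm (y - q1))\<^sup>2 / 2" by (simp add: B_def power_mult_distrib power_divide)
    have pm: "x + y /\<^sub>R 2 - (p1 + q1 /\<^sub>R 2) = A + B" "x - y /\<^sub>R 2 - (p1 - q1 /\<^sub>R 2) = A - B"
      by (auto simp: A_def B_def scaleR_diff_right)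
    have n: "(norm (x + y /\<^sub>R 2 - (p1 + q1 /\<^sub>R 2)))\<^sup>2 + (norm (x - y /\<^sub>R 2 - (p1 - q1 /\<^sub>R 2)))\<^sup>2
        = 2 * (norm (x - p1))\<^sup>2 + (norm (y - q1))\<^sup>2 / 2"
      using par nB unfolding pm A_def[symmetric] by linarith
    have "- pi * n1 + - pi * n2 = - (2 * pi) * a + - (pi / 2) * c" if "n1 + n2 = 2 * a + c / 2" for n1 n2 a c :: real
    proof -
      have "- pi * n1 + - pi * n2 = - pi * (n1 + n2)" by (simp add: algebra_simps)
      also have "\<dots> = - (2 * pi) * a + - (pi / 2) * c" unfolding that by (simp add: algebra_simps)
      finally show ?thesis .
    qed
    note E = this[OF n]
    have t: "- 2 * pi * (x \<bullet> q2) + - 2 * pi * (p2 \<bullet> (y - q1)) = 2 * pi * (p2 \<bullet> q1)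
        + (- (2 * pi * ((x + y /\<^sub>R 2) \<bullet> (p2 + q2 /\<^sub>R 2))) + 2 * pi * ((x - y /\<^sub>R 2) \<bullet> (p2 - q2 /\<^sub>R 2)))"
      by (simp add: inner_add_left inner_add_right inner_diff_left inner_diff_right inner_commute[of p2 y] inner_commute[of p2 q1])
         (simp add: field_simps)
    have "cis (- 2 * pi * (x \<bullet> q2)) * complex_of_real (exp (- (2 * pi) * (norm (x - p1))\<^sup>2)) * (?h x y * fourier ?g y)
      = ?s * ?h x y * complex_of_real (exp (- (2 * pi) * (norm (x - p1))\<^sup>2 + - (pi / 2) * (norm (y - q1))\<^sup>2)) *
         cis (- 2 * pi * (x \<bullet> q2) + - 2 * pi * (p2 \<bullet> (y - q1)))"
      unfolding fourier_modulated_gaussian exp_add cis_mult[symmetric] of_real_mult by (simp only: mult_ac)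
    also have "\<dots> = ?s * cis (2 * pi * (p2 \<bullet> q1)) * ?H (x + y /\<^sub>R 2, x - y /\<^sub>R 2)"
      unfolding t unfolding E[symmetric] exp_add cis_mult[symmetric] of_real_mult pq window_def
      by (simp only: fst_conv snd_conv complex_cnj_mult complex_cnj_cnj cis_cnj complex_cnj_complex_of_real plus_prod_def minus_prod_def scaleR_prod_def minus_minus mult_ac)
    finally show ?thesis .
  qed
  have "fourier ?F (snd q, - fst q) = (LINT x|lborel. LINT \<xi>|lborel. cis (- 2 * pi * ((x, \<xi>) \<bullet> (snd q, - fst q))) * ?F (x, \<xi>))"
    unfolding fourier_def by (rule integral_lborel_pair[OF iF])
  also have "\<dots> = (LINT x|lborel. LINT y|lborel. ?s * cis (2 * pi * (p2 \<bullet> q1)) * ?H (x + y /\<^sub>R 2, x - y /\<^sub>R 2))"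
  proof (rule Bochner_Integration.integral_cong[OF refl])
    fix x :: 'a
    let ?c = "cis (- 2 * pi * (x \<bullet> q2)) * complex_of_real (exp (- (2 * pi) * (norm (x - p1))\<^sup>2))"
    have "(LINT \<xi>|lborel. cis (- 2 * pi * ((x, \<xi>) \<bullet> (snd q, - fst q))) * ?F (x, \<xi>))
        = (LINT \<xi>|lborel. ?c * (fourier (?h x) \<xi> * ?g \<xi>))"
    proof (rule Bochner_Integration.integral_cong[OF refl])
      fix \<xi>
      have 1: "- 2 * pi * ((x, \<xi>) \<bullet> (snd q, - fst q)) = - 2 * pi * (x \<bullet> q2) + 2 * pi * (\<xi> \<bullet> q1)"
        by (simp add: pq algebra_simps)
      have 2: "- (2 * pi) * (norm ((x, \<xi>) - p))\<^sup>2 = - (2 * pi) * (norm (x - p1))\<^sup>2 + - (2 * pi) * (norm (\<xi> - p2))\<^sup>2"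
        by (simp add: pq norm_Pair algebra_simps)
      show "cis (- 2 * pi * ((x, \<xi>) \<bullet> (snd q, - fst q))) * ?F (x, \<xi>) = ?c * (fourier (?h x) \<xi> * ?g \<xi>)"
        unfolding 1 2 wigner_conv_fourier exp_add cis_mult[symmetric] of_real_mult by (simp only: mult_ac)
    qed
    also have "\<dots> = ?c * (LINT y|lborel. ?h x y * fourier ?g y)"
      unfolding fourier_multiplication_formula[OF wigner_integrand(1)[OF f] gi] by simp
    also have "\<dots> = (LINT y|lborel. ?s * cis (2 * pi * (p2 \<bullet> q1)) * ?H (x + y /\<^sub>R 2, x - y /\<^sub>R 2))"
      unfolding pt[symmetric] by (rule integral_mult_right_zero[symmetric])
    finally show "(LINT \<xi>|lborel. cis (- 2 * pi * ((x, \<xi>) \<bullet> (snd q, - fst q))) * ?F (x, \<xi>))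
        = (LINT y|lborel. ?s * cis (2 * pi * (p2 \<bullet> q1)) * ?H (x + y /\<^sub>R 2, x - y /\<^sub>R 2))" .
  qed
  also have "\<dots> = ?s * cis (2 * pi * (p2 \<bullet> q1)) * (LINT x|lborel. LINT y|lborel. ?H (x + y /\<^sub>R 2, x - y /\<^sub>R 2))"
    by (simp only: integral_mult_right_zero)
  also have "(LINT x|lborel. LINT y|lborel. ?H (x + y /\<^sub>R 2, x - y /\<^sub>R 2)) = stft f (p + q /\<^sub>R 2) * cnj (stft f (p - q /\<^sub>R 2))"
    using integral_lborel_pair[OF mi(1), unfolded fst_conv snd_conv] mi(2)[unfolded fst_conv snd_conv]
      stft_product(2)[OF f, of "p + q /\<^sub>R 2" "p - q /\<^sub>R 2"]
    unfolding fst_conv snd_conv by (simp only:)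
  finally show ?thesis by (simp add: pq)
qed

text \<open>For a fixed midpoint \<open>p\<close>, the products of short-time transforms at \<open>p + q / 2\<close> and \<open>p - q / 2\<close> are, up to
  a phase and a symplectic rotation of \<open>q\<close>, the Fourier transform of a Gaussian localisation of the
  Wigner distribution at \<open>p\<close>.\<close>

theorem stft_wigner:
  fixes f :: "'a::euclidean_space \<Rightarrow> complex" and p :: "'a \<times> 'a"
  assumes f: "f \<in> L2"
  shows "ennreal ((1 / 2) ^ DIM('a)) * (\<integral>\<^sup>+q. ennreal ((cmod (stft f (p + q /\<^sub>R 2)))\<^sup>2 * (cmod (stft f (p - q /\<^sub>R 2)))\<^sup>2) \<partial>lborel)
    = (\<integral>\<^sup>+Y. ennreal ((cmod (wigner f Y))\<^sup>2 * exp (- (4 * pi) * (norm (Y - p))\<^sup>2)) \<partial>lborel)"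
proof -
  have [measurable]: "f \<in> borel_measurable borel" using f by auto
  let ?F = "\<lambda>Y. wigner f Y * complex_of_real (exp (- (2 * pi) * (norm (Y - p))\<^sup>2))"
  let ?S = "\<lambda>q. ennreal ((cmod (fourier ?F (snd q, - fst q)))\<^sup>2)"
  let ?G = "\<lambda>\<eta>. ennreal ((cmod (fourier ?F \<eta>))\<^sup>2)"
  have Fm: "?F \<in> borel_measurable borel" by measurable
  then have G: "?G \<in> borel_measurable borel" by measurable
  have m: "(\<lambda>q::'a \<times> 'a. (snd q, - fst q)) \<in> borel_measurable borel" "(\<lambda>y::'a. (x, y)) \<in> borel_measurable borel"
    "(\<lambda>q::'a \<times> 'a. (fst q, - snd q)) \<in> borel_measurable borel" "(\<lambda>y::'a. (p + (q::'a \<times> 'a) /\<^sub>R 2)) \<in> borel_measurable borel" for x :: 'a and q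
    by (auto intro!: borel_measurable_continuous_onI continuous_intros)
  have "ennreal ((1 / 2) ^ DIM('a)) * (\<integral>\<^sup>+q. ennreal ((cmod (stft f (p + q /\<^sub>R 2)))\<^sup>2 * (cmod (stft f (p - q /\<^sub>R 2)))\<^sup>2) \<partial>lborel)
     = (\<integral>\<^sup>+q. ennreal ((1 / 2) ^ DIM('a)) * ennreal ((cmod (stft f (p + q /\<^sub>R 2)))\<^sup>2 * (cmod (stft f (p - q /\<^sub>R 2)))\<^sup>2) \<partial>lborel)"
  proof (rule nn_integral_cmult[symmetric])
    have "(\<lambda>q. p + q /\<^sub>R 2) \<in> borel_measurable borel" "(\<lambda>q. p - q /\<^sub>R 2) \<in> borel_measurable borel"
      by (auto intro!: borel_measurable_continuous_onI continuous_intros)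
    then show "(\<lambda>q. ennreal ((cmod (stft f (p + q /\<^sub>R 2)))\<^sup>2 * (cmod (stft f (p - q /\<^sub>R 2)))\<^sup>2)) \<in> borel_measurable lborel"
      by measurable
  qed
  also have "\<dots> = (\<integral>\<^sup>+q. ?S q \<partial>lborel)"
  proof (rule nn_integral_cong)
    fix q :: "'a \<times> 'a"
    have "(sqrt (1 / 2) ^ DIM('a))\<^sup>2 = (sqrt (1 / 2) * sqrt (1 / 2)) ^ DIM('a)"
      by (simp only: power2_eq_square power_mult_distrib)
    then have "(sqrt (1 / 2) ^ DIM('a))\<^sup>2 = (1 / 2) ^ DIM('a)" by simp
    then have "(cmod (fourier ?F (snd q, - fst q)))\<^sup>2
        = (1 / 2) ^ DIM('a) * ((cmod (stft f (p + q /\<^sub>R 2)))\<^sup>2 * (cmod (stft f (p - q /\<^sub>R 2)))\<^sup>2)"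
      unfolding fourier_wigner_gaussian[OF f]
      by (simp only: norm_mult norm_of_real norm_cis mult_1_right power_mult_distrib power2_abs complex_mod_cnj)
    then show "ennreal ((1 / 2) ^ DIM('a)) * ennreal ((cmod (stft f (p + q /\<^sub>R 2)))\<^sup>2 * (cmod (stft f (p - q /\<^sub>R 2)))\<^sup>2) = ?S q"
      by (simp only: ennreal_mult zero_le_power2 zero_le_power zero_le_mult_iff) (simp add: ennreal_mult)
  qed
  also have "\<dots> = (\<integral>\<^sup>+x. \<integral>\<^sup>+y. ?G (y, - x) \<partial>lborel \<partial>lborel)"
    using nn_integral_lborel_pair[OF measurable_compose[OF m(1) G]] unfolding fst_conv snd_conv .
  also have "\<dots> = (\<integral>\<^sup>+y. \<integral>\<^sup>+x. ?G (y, - x) \<partial>lborel \<partial>lborel)"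
    by (rule nn_integral_swap) (use measurable_compose[OF m(1) G] in \<open>simp add: split_beta'\<close>)
  also have "\<dots> = (\<integral>\<^sup>+y. \<integral>\<^sup>+x. ?G (y, x) \<partial>lborel \<partial>lborel)"
    using nn_integral_reflect[OF measurable_compose[OF m(2) G], where c = 0] unfolding diff_0 by simp
  also have "\<dots> = (\<integral>\<^sup>+\<eta>. ?G \<eta> \<partial>lborel)"
    by (rule nn_integral_lborel_pair[OF G, symmetric])
  also have "\<dots> = (\<integral>\<^sup>+Y. ennreal ((cmod (?F Y))\<^sup>2) \<partial>lborel)"
    by (rule plancherel[OF wigner_gaussian_integrable[OF f]])
  also have "\<dots> = (\<integral>\<^sup>+Y. ennreal ((cmod (wigner f Y))\<^sup>2 * exp (- (4 * pi) * (norm (Y - p))\<^sup>2)) \<partial>lborel)"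
    by (simp add: norm_mult power_mult_distrib mult.assoc flip: exp_double)
  finally show ?thesis .
qed

section \<open>Cones and weights\<close>

lemma japanese_bracket_sq: "(japanese_bracket X)\<^sup>2 = 1 + (norm X)\<^sup>2"
  by (simp add: japanese_bracket_def)

lemma japanese_bracket_ge1: "japanese_bracket X \<ge> 1"
  by (simp add: japanese_bracket_def)

lemma japanese_bracket_pos: "japanese_bracket X > 0"
  using japanese_bracket_ge1[of X] by linarith

lemma japanese_bracket_minus: "japanese_bracket (X - Y) = japanese_bracket (Y - X)"
  by (simp add: japanese_bracket_def norm_minus_commute)

lemma japanese_bracket_powr: "japanese_bracket X powr (2 * s) = (1 + (norm X)\<^sup>2) powr s"
  unfolding japanese_bracket_sq[symmetric] powr_powr[symmetric]
  using japanese_bracket_pos[of X] by (simp add: powr_numeral)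

lemma japanese_bracket_measurable [measurable]: "japanese_bracket \<in> borel_measurable borel"
  unfolding japanese_bracket_def[abs_def] by (rule borel_measurable_continuous_onI) (intro continuous_intros)

lemma peetre:
  fixes m p :: "'a::real_normed_vector"
  assumes "s \<ge> 0"
  shows "japanese_bracket m powr (2 * s) \<le> 2 powr s * japanese_bracket p powr (2 * s) * japanese_bracket (m - p) powr (2 * s)"
proof -
  have "norm m \<le> norm p + norm (m - p)" using norm_triangle_ineq[of p "m - p"] by simp
  then have "(norm m)\<^sup>2 \<le> (norm p + norm (m - p))\<^sup>2" by (intro power_mono) auto
  also have "\<dots> \<le> 2 * (norm p)\<^sup>2 + 2 * (norm (m - p))\<^sup>2"
    using sum_squares_bound[of "norm p" "norm (m - p)"] by (simp add: power2_sum)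
  finally have n: "(norm m)\<^sup>2 \<le> 2 * (norm p)\<^sup>2 + 2 * (norm (m - p))\<^sup>2" .
  have "1 + (norm m)\<^sup>2 \<le> 2 * (1 + (norm p)\<^sup>2) * (1 + (norm (m - p))\<^sup>2)"
  proof -
    have e: "2 * (1 + a) * (1 + b) = 2 + 2 * a + 2 * b + 2 * (a * b)" for a b :: real by (simp add: algebra_simps)
    have "(norm p)\<^sup>2 * (norm (m - p))\<^sup>2 \<ge> 0" by simp
    then show ?thesis unfolding e using n by linarith
  qed
  then have "(1 + (norm m)\<^sup>2) powr s \<le> (2 * (1 + (norm p)\<^sup>2) * (1 + (norm (m - p))\<^sup>2)) powr s"
    using assms by (intro powr_mono2) auto
  also have "\<dots> = 2 powr s * (1 + (norm p)\<^sup>2) powr s * (1 + (norm (m - p))\<^sup>2) powr s"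
    by (simp add: powr_mult del: distrib_left_numeral)
  finally show ?thesis unfolding japanese_bracket_powr .
qed

text \<open>A point of the smaller cone keeps a distance proportional to its norm from the complement of the
  larger one, so off the larger cone the difference \<open>m - p\<close> alone controls the weight at \<open>m\<close>.\<close>

lemma cone_weight:
  fixes \<Gamma> :: "'a::euclidean_space set"
  assumes \<Gamma>: "open \<Gamma>" "punctured_cone \<Gamma>" "X \<in> \<Gamma>"
  obtains \<Gamma>' where "open \<Gamma>'" "punctured_cone \<Gamma>'" "X \<in> \<Gamma>'"
    "\<And>s. s \<ge> 0 \<Longrightarrow> \<exists>C\<ge>0. \<forall>m p. indicator \<Gamma>' m * japanese_bracket m powr (2 * s)
       \<le> C * (indicator \<Gamma> p * japanese_bracket p powr (2 * s) + 1) * japanese_bracket (m - p) powr (2 * s)"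
proof -
  have X0: "X \<noteq> 0" using \<Gamma> by (auto simp: punctured_cone_def)
  have cone: "t *\<^sub>R Y \<in> \<Gamma>" if "Y \<in> \<Gamma>" "t > 0" for t Y using \<Gamma> that by (auto simp: punctured_cone_def)
  define e where "e = sgn X"
  have "e \<in> \<Gamma>" using cone[OF \<Gamma>(3), of "inverse (norm X)"] X0 by (simp add: e_def sgn_div_norm)
  then obtain r0 where r0: "r0 > 0" "ball e r0 \<subseteq> \<Gamma>" using \<Gamma>(1) open_contains_ball by blast
  \<comment> \<open>Directions of the new cone lie within \<open>r\<close> of \<open>e\<close> while
    the complement of the old cone stays at distance \<open>2 * r\<close> from \<open>e\<close>,
    leaving a gap of \<open>r\<close>. The bound by 1 is used when \<open>r\<close> is pulled inside
    the bracket.\<close>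
  define r where "r = min 1 (r0 / 2)"
  have r: "r > 0" "r \<le> 1" "2 * r \<le> r0" using r0 by (auto simp: r_def)
  define \<Gamma>' where "\<Gamma>' = {m. m \<noteq> 0 \<and> norm (sgn m - e) < r}"
  have "open \<Gamma>'"
  proof -
    have "open (- {0} \<inter> (\<lambda>m. norm (sgn m - e)) -` {..<r})"
      by (rule continuous_open_preimage) (auto intro!: continuous_intros continuous_on_sgn)
    moreover have "\<Gamma>' = - {0} \<inter> (\<lambda>m. norm (sgn m - e)) -` {..<r}" by (auto simp: \<Gamma>'_def)
    ultimately show ?thesis by simp
  qed
  moreover have "punctured_cone \<Gamma>'"
    by (auto simp: punctured_cone_def \<Gamma>'_def sgn_scaleR)
  moreover have "X \<in> \<Gamma>'" using X0 r by (simp add: \<Gamma>'_def e_def)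
  moreover have "\<exists>C\<ge>0. \<forall>m p. indicator \<Gamma>' m * japanese_bracket m powr (2 * s)
       \<le> C * (indicator \<Gamma> p * japanese_bracket p powr (2 * s) + 1) * japanese_bracket (m - p) powr (2 * s)" if s: "s \<ge> 0" for s
  proof (intro exI conjI allI)
    \<comment> \<open>One constant for both cases: the first summand comes from Peetre's inequality
      when \<open>p\<close> lies in the old cone, the second from the gap when it does not.\<close>
    show "2 powr s + r powr (- 2 * s) \<ge> 0" by simp
    fix m p :: 'a
    let ?J = "\<lambda>x::'a. japanese_bracket x powr (2 * s)"
    let ?C = "2 powr s + r powr (- 2 * s)"
    have C0: "0 \<le> ?C" by simp
    consider "m \<notin> \<Gamma>'" | "m \<in> \<Gamma>'" "p \<in> \<Gamma>" | "m \<in> \<Gamma>'" "p \<notin> \<Gamma>" by blast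
    then show "indicator \<Gamma>' m * ?J m \<le> ?C * (indicator \<Gamma> p * ?J p + 1) * ?J (m - p)"
    proof cases
      case 1
      then show ?thesis using C0 by simp
    next
      case 2
      have "?J m \<le> 2 powr s * ?J p * ?J (m - p)" by (rule peetre[OF s])
      also have "\<dots> \<le> ?C * (?J p + 1) * ?J (m - p)"
        by (intro mult_right_mono mult_mono) auto
      finally show ?thesis using 2 by simp
    next
      case 3
      then have m: "m \<noteq> 0" "norm (sgn m - e) < r" by (auto simp: \<Gamma>'_def)
      \<comment> \<open>Scaling by the norm of \<open>m\<close> brings the comparison to the unit
        sphere, where the gap between the two cones is the fixed number \<open>r\<close>.\<close>
      have "p /\<^sub>R norm m \<notin> \<Gamma>"
        using cone[of "p /\<^sub>R norm m" "norm m"] m 3 by auto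
      then have "p /\<^sub>R norm m \<notin> ball e r0" using r0 by blast
      then have "2 * r \<le> norm (p /\<^sub>R norm m - e)"
        using r by (simp add: dist_norm norm_minus_commute)
      moreover have "norm (p /\<^sub>R norm m - e) \<le> norm (p /\<^sub>R norm m - sgn m) + norm (sgn m - e)"
        using norm_triangle_ineq[of "p /\<^sub>R norm m - sgn m" "sgn m - e"] by simp
      ultimately have "r \<le> norm (p /\<^sub>R norm m - sgn m)" using m by linarith
      also have "p /\<^sub>R norm m - sgn m = (p - m) /\<^sub>R norm m" by (simp add: sgn_div_norm scaleR_diff_right)
      finally have "r \<le> norm (m - p) / norm m"
        unfolding norm_scaleR by (simp add: norm_minus_commute divide_inverse mult.commute)
      then have "r * norm m \<le> norm (m - p)" using m by (simp add: pos_le_divide_eq)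
      then have "(r * norm m)\<^sup>2 \<le> (norm (m - p))\<^sup>2" using r by (intro power_mono) auto
      moreover have "r\<^sup>2 \<le> 1" using r by (simp add: power_le_one)
      ultimately have "r\<^sup>2 * (1 + (norm m)\<^sup>2) \<le> 1 + (norm (m - p))\<^sup>2"
        by (simp add: power_mult_distrib algebra_simps)
      then have "(r\<^sup>2 * (1 + (norm m)\<^sup>2)) powr s \<le> (1 + (norm (m - p))\<^sup>2) powr s"
        using s by (intro powr_mono2) auto
      then have "r powr (2 * s) * ?J m \<le> ?J (m - p)"
        unfolding japanese_bracket_powr using r by (simp add: powr_mult powr_powr[symmetric] powr_numeral)
      then have "r powr (- 2 * s) * (r powr (2 * s) * ?J m) \<le> r powr (- 2 * s) * ?J (m - p)"
        by (intro mult_left_mono) auto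
      also have "r powr (- 2 * s) * (r powr (2 * s) * ?J m) = ?J m"
        using r by (simp add: mult.assoc[symmetric] flip: powr_add)
      also have "r powr (- 2 * s) * ?J (m - p) \<le> ?C * ?J (m - p)"
        by (intro mult_right_mono) auto
      finally show ?thesis using 3 by simp
    qed
  qed
  ultimately show ?thesis by (rule that)
qed

text \<open>Raise 1 + t \<le> a (1 + t/a) \<le> a exp(t/a) to the power \<open>s\<close>. Taking
  \<open>a\<close> at least 1 gives the first inequality, taking it at least \<open>s\<close> keeps
  the final exponent below \<open>t\<close>.\<close>

lemma gaussian_weight_bound:
  fixes x :: "'a::real_normed_vector"
  assumes s: "s \<ge> 0"
  shows "japanese_bracket x powr (2 * s) \<le> max 1 s powr s * exp ((norm x)\<^sup>2)"
proof -
  define a where "a = max 1 s"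
  have a: "a \<ge> 1" "s \<le> a" by (auto simp: a_def)
  let ?t = "(norm x)\<^sup>2"
  have "1 + ?t \<le> a * (1 + ?t / a)" using a by (simp add: field_simps)
  also have "\<dots> \<le> a * exp (?t / a)" using a by (intro mult_left_mono exp_ge_add_one_self) auto
  finally have "(1 + ?t) powr s \<le> (a * exp (?t / a)) powr s" using s by (intro powr_mono2) auto
  also have "\<dots> = a powr s * exp (?t * (s / a))"
    using a by (simp add: powr_mult exp_powr_real)
  also have "\<dots> \<le> a powr s * exp ?t"
    using a s using mult_left_mono[of s a ?t] by (intro mult_left_mono) (auto simp: divide_le_eq)
  finally show ?thesis unfolding japanese_bracket_powr a_def .
qed

text \<open>One unit of the Gaussian rate pays for the polynomial weight, so \<open>a\<close> has to
  exceed 1.\<close>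

lemma gaussian_weight_integral:
  assumes s: "s \<ge> 0" and a: "a > 1"
  shows "(\<integral>\<^sup>+x. ennreal (japanese_bracket (x::'a::euclidean_space) powr (2 * s) * exp (- a * (norm x)\<^sup>2)) \<partial>lborel) < \<infinity>"
proof -
  have "(\<integral>\<^sup>+x. ennreal (japanese_bracket (x::'a) powr (2 * s) * exp (- a * (norm x)\<^sup>2)) \<partial>lborel)
     \<le> (\<integral>\<^sup>+x. ennreal (max 1 s powr s) * ennreal (exp (- (a - 1) * (norm (x::'a))\<^sup>2)) \<partial>lborel)"
  proof (rule nn_integral_mono)
    fix x :: 'a
    have "japanese_bracket x powr (2 * s) * exp (- a * (norm x)\<^sup>2) \<le> (max 1 s powr s * exp ((norm x)\<^sup>2)) * exp (- a * (norm x)\<^sup>2)"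
      by (rule mult_right_mono[OF gaussian_weight_bound[OF s]]) simp
    also have "\<dots> = max 1 s powr s * exp (- (a - 1) * (norm x)\<^sup>2)"
      by (simp add: mult.assoc algebra_simps flip: exp_add)
    finally show "ennreal (japanese_bracket x powr (2 * s) * exp (- a * (norm x)\<^sup>2)) \<le> ennreal (max 1 s powr s) * ennreal (exp (- (a - 1) * (norm x)\<^sup>2))"
      by (simp add: ennreal_leI flip: ennreal_mult)
  qed
  also have "\<dots> < \<infinity>"
    using gaussian_integral(3)[of "a - 1", where 'a='a] a by (simp add: nn_integral_cmult ennreal_mult_less_top)
  finally show ?thesis .
qed

text \<open>Distributing one factor 1/(1 + |x|^2) to each coordinate bounds the integrand by a
  product of one-variable functions. This costs more decay than the sharp exponent, which is
  harmless since the kernels decay to every order.\<close>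

lemma japanese_bracket_integral:
  assumes M: "M \<ge> real DIM('a)"
  shows "(\<integral>\<^sup>+x. ennreal (japanese_bracket (x::'a::euclidean_space) powr (- 2 * M)) \<partial>lborel) < \<infinity>"
proof -
  have 1: "integrable lborel (\<lambda>x::real. inverse (1 + x\<^sup>2))"
    using integrable_inverse_1_plus_square by (simp add: set_integrable_def)
  have "(\<integral>\<^sup>+x. ennreal (japanese_bracket (x::'a) powr (- 2 * M)) \<partial>lborel)
    \<le> (\<integral>\<^sup>+x. ennreal (\<Prod>b\<in>Basis. inverse (1 + ((x::'a) \<bullet> b)\<^sup>2)) \<partial>lborel)"
  proof (intro nn_integral_mono ennreal_leI)
    fix x :: 'a
    have "japanese_bracket x powr (- 2 * M) = (1 + (norm x)\<^sup>2) powr (- M)"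
      using japanese_bracket_powr[of x "- M"] by simp
    also have "\<dots> \<le> (1 + (norm x)\<^sup>2) powr (- real DIM('a))" using M by (intro powr_mono) auto
    also have "\<dots> = (\<Prod>b\<in>(Basis::'a set). inverse (1 + (norm x)\<^sup>2))"
      by (simp add: powr_minus powr_realpow add_pos_nonneg power_inverse)
    also have "\<dots> \<le> (\<Prod>b\<in>(Basis::'a set). inverse (1 + (x \<bullet> b)\<^sup>2))"
    proof (intro prod_mono conjI le_imp_inverse_le)
      fix b :: 'a assume "b \<in> Basis"
      then have "\<bar>x \<bullet> b\<bar> \<le> norm x" by (rule Basis_le_norm)
      then have "\<bar>x \<bullet> b\<bar>\<^sup>2 \<le> (norm x)\<^sup>2" by (intro power_mono) auto
      then show "1 + (x \<bullet> b)\<^sup>2 \<le> 1 + (norm x)\<^sup>2" by simp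
    qed (auto simp: add_pos_nonneg)
    finally show "japanese_bracket x powr (- 2 * M) \<le> (\<Prod>b\<in>Basis. inverse (1 + (x \<bullet> b)\<^sup>2))" .
  qed
  also have "\<dots> < \<infinity>"
  proof -
    have i: "integrable lborel (\<lambda>x::'a. \<Prod>b\<in>Basis. inverse (1 + (x \<bullet> b)\<^sup>2))"
      using lborel_product_integral(1)[where f = "\<lambda>(_::'a) x. inverse (1 + x\<^sup>2) :: real"] 1 by simp
    then show ?thesis by (subst nn_integral_eq_integral) (auto intro!: prod_nonneg)
  qed
  finally show ?thesis .
qed

section \<open>Bounded functionals on square-integrable functions\<close>

text \<open>The minimising sequence of \<open>u \<mapsto> (L2_norm u)\<^sup>2 - 2 * Re (l u)\<close> represents \<open>l\<close> up to an error
  that is uniform on the unit ball, so completeness of \<^const>\<open>L2\<close> is not needed.\<close>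

lemma approximate_Riesz:
  fixes l :: "('a::euclidean_space \<Rightarrow> complex) \<Rightarrow> complex"
  assumes add: "\<And>f g. f \<in> L2 \<Longrightarrow> g \<in> L2 \<Longrightarrow> l (\<lambda>x. f x + g x) = l f + l g"
    and scale: "\<And>c f. f \<in> L2 \<Longrightarrow> l (\<lambda>x. c * f x) = c * l f"
    and bound: "\<And>f. f \<in> L2 \<Longrightarrow> cmod (l f) \<le> M * L2_norm f"
    and e: "e > 0"
  shows "\<exists>u\<in>L2. \<forall>v\<in>L2. cmod (ip v u - l v) \<le> e * L2_norm v"
proof -
  define J where "J u = (L2_norm u)\<^sup>2 - 2 * Re (l u)" for u
  have z: "(\<lambda>x::'a. 0::complex) \<in> L2" by (auto simp: L2_def)
  \<comment> \<open>Completing the square in the norm of \<open>u\<close>.\<close>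
  have lower: "J u \<ge> - M\<^sup>2" if "u \<in> L2" for u
  proof -
    have "Re (l u) \<le> M * L2_norm u"
      using bound[OF that] complex_Re_le_cmod[of "l u"] by linarith
    moreover have "0 \<le> (L2_norm u - M)\<^sup>2" by simp
    then have "0 \<le> (L2_norm u)\<^sup>2 - 2 * (M * L2_norm u) + M\<^sup>2" by (simp add: power2_diff algebra_simps)
    ultimately show ?thesis unfolding J_def by linarith
  qed
  \<comment> \<open>Real and imaginary parts of the error each receive half.\<close>
  define \<epsilon> where "\<epsilon> = e / 2"
  have \<epsilon>: "\<epsilon> > 0" using e by (simp add: \<epsilon>_def)
  define m where "m = Inf (J ` L2)"
  have bdd: "bdd_below (J ` L2)" using lower by (intro bdd_belowI2)
  have "J ` L2 \<noteq> {}" using z by auto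
  then have "\<exists>y\<in>J ` L2. y < m + \<epsilon>\<^sup>2" using \<epsilon> bdd unfolding m_def by (subst cInf_less_iff[symmetric]) auto
  then obtain u where u: "u \<in> L2" "J u < m + \<epsilon>\<^sup>2" by auto
  have mle: "m \<le> J w" if "w \<in> L2" for w unfolding m_def using that bdd by (intro cInf_lower) auto
  have re: "\<bar>Re (ip v u - l v)\<bar> \<le> \<epsilon> * L2_norm v" if v: "v \<in> L2" for v
  proof -
    define b where "b = Re (ip v u - l v)"
    define V where "V = L2_norm v"
    have V0: "V \<ge> 0" by (simp add: V_def)
    \<comment> \<open>Along the line through \<open>u\<close> in direction \<open>v\<close> the
      functional is a quadratic polynomial that cannot drop below its infimum, while its value at
      \<open>u\<close> exceeds the infimum by less than the square of \<epsilon>. Its slope at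
      \<open>u\<close> is therefore small.\<close>
    have key: "0 \<le> \<epsilon>\<^sup>2 + 2 * t * b + t\<^sup>2 * V\<^sup>2" for t :: real
    proof -
      let ?w = "\<lambda>x. u x + complex_of_real t * v x"
      have tv: "(\<lambda>x. complex_of_real t * v x) \<in> L2" by (rule L2_cmult[OF v])
      have "J ?w = (L2_norm u)\<^sup>2 + 2 * (t * Re (ip u v)) + t\<^sup>2 * V\<^sup>2 - 2 * (Re (l u) + t * Re (l v))"
        unfolding J_def L2_norm_add_sq[OF u(1) tv] add[OF u(1) tv] scale[OF v] ip_cmult_right L2_norm_cmult V_def
        by (simp add: power_mult_distrib)
      also have "Re (ip u v) = Re (ip v u)" by (subst ip_commute) simp
      finally have "J ?w = J u + 2 * t * b + t\<^sup>2 * V\<^sup>2" unfolding J_def b_def by (simp add: algebra_simps)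
      then show ?thesis using mle[OF L2_add[OF u(1) tv]] u(2) by linarith
    qed
    have "\<bar>b\<bar> \<le> \<epsilon> * V"
    proof (cases "V = 0")
      case True
      have "b = 0"
      proof (rule ccontr)
        assume "b \<noteq> 0"
        then show False using key[of "- \<epsilon>\<^sup>2 / b"] True \<epsilon> by simp
      qed
      then show ?thesis using True by simp
    next
      case False
      then have V: "V > 0" using V0 by simp
      have "0 \<le> \<epsilon>\<^sup>2 - b\<^sup>2 / V\<^sup>2"
        using key[of "- b / V\<^sup>2"] V by (simp add: power2_eq_square field_simps)
      then have "b\<^sup>2 \<le> (\<epsilon> * V)\<^sup>2" using V by (simp add: field_simps power_mult_distrib)
      then show ?thesis using \<epsilon> V by (intro power2_le_imp_le[of "\<bar>b\<bar>"]) auto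
    qed
    then show ?thesis by (simp add: b_def V_def)
  qed
  have "cmod (ip v u - l v) \<le> e * L2_norm v" if v: "v \<in> L2" for v
  proof -
    \<comment> \<open>Complex linearity turns the bound on real parts, applied to \<i> times
      \<open>v\<close>, into a bound on imaginary parts.\<close>
    have "Re (ip (\<lambda>x. \<i> * v x) u - l (\<lambda>x. \<i> * v x)) = - Im (ip v u - l v)"
      by (simp add: ip_cmult_left scale[OF v])
    then have "\<bar>Im (ip v u - l v)\<bar> \<le> \<epsilon> * L2_norm v"
      using re[OF L2_cmult[OF v, of \<i>]] by (simp add: L2_norm_cmult)
    then show ?thesis using re[OF v] cmod_le[of "ip v u - l v"] unfolding \<epsilon>_def by simp
  qed
  then show ?thesis using u(1) by blast
qed

lemma ennreal_power2_le_D: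
  assumes "x\<^sup>2 \<le> (ennreal r)\<^sup>2" "r \<ge> 0"
  shows "x \<le> ennreal r"
proof (cases x)
  case (real t)
  then have "t\<^sup>2 \<le> r\<^sup>2" using assms by (simp add: ennreal_power)
  then have "t \<le> r" using assms(2) by (rule power2_le_imp_le)
  then show ?thesis using real by (simp add: ennreal_leI)
next
  case top
  then show ?thesis using assms(1) unfolding ennreal_power[OF assms(2)] by (simp add: power2_eq_square top_unique)
qed

text \<open>A weak form of the inversion formula: formally \<open>l f\<close> is the integral of
  \<open>stft f z * l (window z)\<close> divided by the isometry constant. It makes a functional
  known only through its values on windows controllable on all of \<open>L2\<close>. The isometry is
  applied to approximate representers \<open>u n\<close>.\<close>

lemma L2_functional_stft_bound:
  fixes l :: "('a::euclidean_space \<Rightarrow> complex) \<Rightarrow> complex"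
  assumes add: "\<And>f g. f \<in> L2 \<Longrightarrow> g \<in> L2 \<Longrightarrow> l (\<lambda>x. f x + g x) = l f + l g"
    and scale: "\<And>c f. f \<in> L2 \<Longrightarrow> l (\<lambda>x. c * f x) = c * l f"
    and bound: "\<And>f. f \<in> L2 \<Longrightarrow> cmod (l f) \<le> M * L2_norm f"
    and f: "f \<in> L2" and h: "\<And>z. cmod (l (window z)) \<le> h z" and [measurable]: "h \<in> borel_measurable borel"
  shows "ennreal (sqrt (1 / 2) ^ DIM('a) * cmod (l f)) \<le> (\<integral>\<^sup>+z. ennreal (cmod (stft f z) * h z) \<partial>lborel)"
proof -
  let ?\<kappa> = "sqrt (1 / 2) ^ DIM('a)"
  have [measurable]: "f \<in> borel_measurable borel" using f by auto
  define \<epsilon> where "\<epsilon> n = 1 / real (Suc n)" for n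
  have \<epsilon>0: "\<epsilon> n > 0" for n by (simp add: \<epsilon>_def)
  have \<epsilon>l: "\<epsilon> \<longlonglongrightarrow> 0" unfolding \<epsilon>_def using LIMSEQ_inverse_real_of_nat by (simp add: inverse_eq_divide)
  have "\<exists>u. \<forall>n. u n \<in> L2 \<and> (\<forall>v\<in>L2. cmod (ip v (u n) - l v) \<le> \<epsilon> n * L2_norm v)"
    using approximate_Riesz[of l M, OF add scale bound \<epsilon>0] by (intro choice) blast
  then obtain u where u: "\<And>n. u n \<in> L2" "\<And>n v. v \<in> L2 \<Longrightarrow> cmod (ip v (u n) - l v) \<le> \<epsilon> n * L2_norm v"
    by blast
  have um [measurable]: "u n \<in> borel_measurable borel" for n using u(1)[of n] by auto
  \<comment> \<open>The transform that an exact representer would have; the transforms of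
    \<open>u n\<close> converge to it at every point since windows have norm at most 1.\<close>
  define k where "k z = cnj (l (window z))" for z
  have conv: "(\<lambda>n. stft (u n) z) \<longlonglongrightarrow> k z" for z
  proof -
    have "cmod (stft (u n) z - k z) \<le> \<epsilon> n" for n
    proof -
      have "stft (u n) z - k z = cnj (ip (window z) (u n) - l (window z))"
        unfolding stft_def k_def complex_cnj_diff ip_commute[of "u n"] by simp
      then have "cmod (stft (u n) z - k z) \<le> \<epsilon> n * L2_norm (window z)"
        using u(2)[OF window_L2, of z n] by (simp only: complex_mod_cnj)
      also have "\<dots> \<le> \<epsilon> n" using L2_norm_window_le[of z] \<epsilon>0[of n] by (simp add: mult_left_le)
      finally show ?thesis .
    qed
    then have "(\<lambda>n. stft (u n) z - k z) \<longlonglongrightarrow> 0" by (rule Lim_null_comparison[OF always_eventually \<epsilon>l, rule_format])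
    then show ?thesis by (rule LIM_zero_cancel)
  qed
  have [measurable]: "k \<in> borel_measurable borel"
    by (rule borel_measurable_LIMSEQ_metric[OF _ conv]) measurable
  \<comment> \<open>Both representation errors are tested on the difference of the two representers
    itself.\<close>
  have cauchy: "L2_norm (\<lambda>x. u n x - u m x) \<le> \<epsilon> n + \<epsilon> m" for n m
  proof -
    let ?d = "\<lambda>x. u n x - u m x"
    have d: "?d \<in> L2" by (intro L2_diff u)
    have "complex_of_real ((L2_norm ?d)\<^sup>2) = (ip ?d (u n) - l ?d) - (ip ?d (u m) - l ?d)"
      unfolding ip_self[symmetric] ip_diff_right[OF u(1) u(1) d] by simp
    then have "(L2_norm ?d)\<^sup>2 = cmod ((ip ?d (u n) - l ?d) - (ip ?d (u m) - l ?d))"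
      by (metis norm_of_real abs_power2)
    also have "\<dots> \<le> \<epsilon> n * L2_norm ?d + \<epsilon> m * L2_norm ?d"
      using norm_triangle_ineq4[of "ip ?d (u n) - l ?d" "ip ?d (u m) - l ?d"] u(2)[OF d, of n] u(2)[OF d, of m] by linarith
    finally have "L2_norm ?d * L2_norm ?d \<le> (\<epsilon> n + \<epsilon> m) * L2_norm ?d" by (simp add: power2_eq_square algebra_simps)
    then show ?thesis
      using \<epsilon>0[of n] \<epsilon>0[of m] L2_norm_nonneg[of ?d] by (cases "L2_norm ?d = 0") auto
  qed
  \<comment> \<open>Letting \<open>m\<close> tend to infinity in the Cauchy estimate, with the
    isometry, upgrades pointwise convergence of the transforms to convergence in the norm of
    \<open>L2\<close>.\<close>
  have fatou: "(\<integral>\<^sup>+z. ennreal ((cmod (stft (u n) z - k z))\<^sup>2) \<partial>lborel) \<le> ennreal (4 * (\<epsilon> n)\<^sup>2)" for n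
  proof -
    have "(\<integral>\<^sup>+z. ennreal ((cmod (stft (u n) z - k z))\<^sup>2) \<partial>lborel)
       = (\<integral>\<^sup>+z. liminf (\<lambda>m. ennreal ((cmod (stft (u n) z - stft (u m) z))\<^sup>2)) \<partial>lborel)"
      by (intro nn_integral_cong lim_imp_Liminf[symmetric] tendsto_ennrealI tendsto_power tendsto_norm tendsto_diff tendsto_const conv) simp
    also have "\<dots> \<le> liminf (\<lambda>m. \<integral>\<^sup>+z. ennreal ((cmod (stft (u n) z - stft (u m) z))\<^sup>2) \<partial>lborel)"
      by (rule nn_integral_liminf) measurable
    also have "\<dots> \<le> ennreal (4 * (\<epsilon> n)\<^sup>2)"
    proof (rule Liminf_le)
      show "eventually (\<lambda>m. (\<integral>\<^sup>+z. ennreal ((cmod (stft (u n) z - stft (u m) z))\<^sup>2) \<partial>lborel) \<le> ennreal (4 * (\<epsilon> n)\<^sup>2)) sequentially"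
        unfolding eventually_sequentially
      proof (intro exI allI impI)
        fix m assume "m \<ge> n"
        then have mn: "\<epsilon> m \<le> \<epsilon> n" by (simp add: \<epsilon>_def frac_le)
        have d: "(\<lambda>x. u n x - u m x) \<in> L2" by (intro L2_diff u)
        have "(L2_norm (\<lambda>x. u n x - u m x))\<^sup>2 \<le> (\<epsilon> n + \<epsilon> m)\<^sup>2" by (intro power_mono cauchy) simp
        also have "\<dots> \<le> (2 * \<epsilon> n)\<^sup>2" using mn \<epsilon>0[of n] \<epsilon>0[of m] by (intro power_mono) auto
        finally have "?\<kappa> * (L2_norm (\<lambda>x. u n x - u m x))\<^sup>2 \<le> 1 * (2 * \<epsilon> n)\<^sup>2"
          by (intro mult_mono) (auto simp: power_le_one)
        then show "(\<integral>\<^sup>+z. ennreal ((cmod (stft (u n) z - stft (u m) z))\<^sup>2) \<partial>lborel) \<le> ennreal (4 * (\<epsilon> n)\<^sup>2)"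
          using stft_isometry_nn[OF d] unfolding stft_diff[OF u(1) u(1)] by (simp add: ennreal_leI power_mult_distrib)
      qed
    qed simp
    finally show ?thesis .
  qed
  have Vf: "(\<integral>\<^sup>+z. ennreal ((cmod (stft f z))\<^sup>2) \<partial>lborel) \<le> ennreal ((L2_norm f)\<^sup>2)"
    unfolding stft_isometry_nn[OF f] by (intro ennreal_leI) (simp add: mult_left_le_one_le power_le_one)
  define I where "I = (\<integral>\<^sup>+z. ennreal (cmod (stft f z) * h z) \<partial>lborel)"
  have h0: "h z \<ge> 0" for z using h[of z] norm_ge_zero[of "l (window z)"] by linarith
  \<comment> \<open>One part of the error comes from replacing \<open>l f\<close> by
    \<open>ip f (u n)\<close>, two parts from replacing \<open>stft (u n)\<close> by
    \<open>k\<close> under the integral.\<close>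
  have est: "ennreal (?\<kappa> * cmod (l f)) \<le> I + ennreal (3 * \<epsilon> n * L2_norm f)" for n
  proof -
    have 1: "?\<kappa> * cmod (l f) \<le> ?\<kappa> * cmod (ip f (u n)) + \<epsilon> n * L2_norm f"
    proof -
      have "cmod (l f) \<le> cmod (ip f (u n)) + \<epsilon> n * L2_norm f"
        using u(2)[OF f, of n] norm_triangle_ineq4[of "ip f (u n)" "ip f (u n) - l f"] by simp
      then have "?\<kappa> * cmod (l f) \<le> ?\<kappa> * (cmod (ip f (u n)) + \<epsilon> n * L2_norm f)" by (intro mult_left_mono) auto
      also have "\<dots> \<le> ?\<kappa> * cmod (ip f (u n)) + \<epsilon> n * L2_norm f"
        using \<epsilon>0[of n] by (simp add: distrib_left mult_left_le_one_le power_le_one)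
      finally show ?thesis .
    qed
    have "?\<kappa> * cmod (ip f (u n)) = cmod (ip (stft f) (stft (u n)))"
      unfolding stft_isometry[OF f u(1)] by (simp add: norm_mult norm_power)
    also have "\<dots> \<le> (LINT z|lborel. cmod (stft f z) * cmod (stft (u n) z))"
      unfolding ip_def by (rule order_trans[OF integral_norm_bound]) (simp add: norm_mult)
    finally have "ennreal (?\<kappa> * cmod (ip f (u n))) \<le> ennreal (LINT z|lborel. cmod (stft f z) * cmod (stft (u n) z))"
      by (rule ennreal_leI)
    also have "\<dots> = (\<integral>\<^sup>+z. ennreal (cmod (stft f z) * cmod (stft (u n) z)) \<partial>lborel)"
      using integrable_norm[OF L2_times_integrable[OF stft_L2[OF f] stft_L2[OF u(1)[of n]]]]
      by (intro nn_integral_eq_integral[symmetric]) (auto simp: norm_mult)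
    also have "\<dots> \<le> (\<integral>\<^sup>+z. ennreal (cmod (stft f z) * h z) + ennreal \<bar>cmod (stft f z) * cmod (stft (u n) z - k z)\<bar> \<partial>lborel)"
    proof (rule nn_integral_mono)
      fix z
      have "cmod (stft (u n) z) \<le> h z + cmod (stft (u n) z - k z)"
        using norm_triangle_ineq[of "k z" "stft (u n) z - k z"] h[of z] by (simp add: k_def)
      then have "cmod (stft f z) * cmod (stft (u n) z) \<le> cmod (stft f z) * h z + cmod (stft f z) * cmod (stft (u n) z - k z)"
        unfolding distrib_left[symmetric] by (intro mult_left_mono) auto
      then have "ennreal (cmod (stft f z) * cmod (stft (u n) z)) \<le> ennreal (cmod (stft f z) * h z + cmod (stft f z) * cmod (stft (u n) z - k z))"
        by (rule ennreal_leI)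
      also have "\<dots> = ennreal (cmod (stft f z) * h z) + ennreal (cmod (stft f z) * cmod (stft (u n) z - k z))"
        using h0[of z] by (intro ennreal_plus) auto
      finally show "ennreal (cmod (stft f z) * cmod (stft (u n) z)) \<le> ennreal (cmod (stft f z) * h z) + ennreal \<bar>cmod (stft f z) * cmod (stft (u n) z - k z)\<bar>"
        by simp
    qed
    also have "\<dots> = I + (\<integral>\<^sup>+z. ennreal \<bar>cmod (stft f z) * cmod (stft (u n) z - k z)\<bar> \<partial>lborel)"
      unfolding I_def by (rule nn_integral_add) measurable
    also have "\<dots> \<le> I + ennreal (2 * \<epsilon> n * L2_norm f)"
    proof (rule add_left_mono)
      let ?E = "\<integral>\<^sup>+z. ennreal \<bar>cmod (stft f z) * cmod (stft (u n) z - k z)\<bar> \<partial>lborel"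
      have "?E\<^sup>2 \<le> (\<integral>\<^sup>+z. ennreal ((cmod (stft f z))\<^sup>2) \<partial>lborel) * (\<integral>\<^sup>+z. ennreal ((cmod (stft (u n) z - k z))\<^sup>2) \<partial>lborel)"
        by (rule Cauchy_Schwarz_nn_integral_sq) measurable
      also have "\<dots> \<le> ennreal ((L2_norm f)\<^sup>2) * ennreal (4 * (\<epsilon> n)\<^sup>2)" by (intro mult_mono Vf fatou) auto
      also have "\<dots> = (ennreal (2 * \<epsilon> n * L2_norm f))\<^sup>2"
        using \<epsilon>0[of n] by (simp add: ennreal_power less_imp_le power_mult_distrib mult_ac flip: ennreal_mult)
      finally show "?E \<le> ennreal (2 * \<epsilon> n * L2_norm f)"
        by (rule ennreal_power2_le_D) (use \<epsilon>0[of n] in auto)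
    qed
    finally have 2: "ennreal (?\<kappa> * cmod (ip f (u n))) \<le> I + ennreal (2 * \<epsilon> n * L2_norm f)" .
    have "ennreal (?\<kappa> * cmod (l f)) \<le> ennreal (?\<kappa> * cmod (ip f (u n)) + \<epsilon> n * L2_norm f)"
      using 1 by (rule ennreal_leI)
    also have "\<dots> = ennreal (?\<kappa> * cmod (ip f (u n))) + ennreal (\<epsilon> n * L2_norm f)"
      using \<epsilon>0[of n] by (intro ennreal_plus) auto
    also have "\<dots> \<le> I + ennreal (2 * \<epsilon> n * L2_norm f) + ennreal (\<epsilon> n * L2_norm f)"
      by (rule add_right_mono[OF 2])
    also have "\<dots> = I + ennreal (3 * \<epsilon> n * L2_norm f)"
      using \<epsilon>0[of n] by (simp add: add.assoc less_imp_le flip: ennreal_plus)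
    finally show ?thesis .
  qed
  have "(\<lambda>n. I + ennreal (3 * \<epsilon> n * L2_norm f)) \<longlonglongrightarrow> I + ennreal (3 * 0 * L2_norm f)"
    by (intro tendsto_add tendsto_const tendsto_ennrealI tendsto_mult \<epsilon>l)
  then have "ennreal (?\<kappa> * cmod (l f)) \<le> I + ennreal (3 * 0 * L2_norm f)"
    by (rule LIMSEQ_le_const) (use est in blast)
  then show ?thesis by (simp add: I_def)
qed

section \<open>Midpoint energies\<close>

lemma measurable_fst_borel [measurable (raw)]:
  fixes f :: "'c \<Rightarrow> 'a::{second_countable_topology} \<times> 'b::{second_countable_topology}"
  assumes "f \<in> M \<rightarrow>\<^sub>M borel" shows "(\<lambda>x. fst (f x)) \<in> M \<rightarrow>\<^sub>M borel"
  by (rule measurable_compose[OF assms borel_measurable_continuous_onI]) (intro continuous_intros)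

lemma measurable_snd_borel [measurable (raw)]:
  fixes f :: "'c \<Rightarrow> 'a::{second_countable_topology} \<times> 'b::{second_countable_topology}"
  assumes "f \<in> M \<rightarrow>\<^sub>M borel" shows "(\<lambda>x. snd (f x)) \<in> M \<rightarrow>\<^sub>M borel"
  by (rule measurable_compose[OF assms borel_measurable_continuous_onI]) (intro continuous_intros)

lemma nn_integral_pair_product:
  fixes f :: "'a::euclidean_space \<Rightarrow> ennreal" and g :: "'b::euclidean_space \<Rightarrow> ennreal"
  assumes [measurable]: "f \<in> borel_measurable borel" "g \<in> borel_measurable borel"
  shows "(\<integral>\<^sup>+Z. f (fst Z) * g (snd Z) \<partial>lborel) = (\<integral>\<^sup>+x. f x \<partial>lborel) * (\<integral>\<^sup>+y. g y \<partial>lborel)"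
  by (subst nn_integral_lborel_pair) (simp_all add: nn_integral_cmult nn_integral_multc)

text \<open>The weighted energy of \<open>v \<otimes> v\<close>, the weight being evaluated at midpoints since that is where
  the Wigner distribution places the interference of two phase space points.\<close>

definition midpoint_energy :: "('b::euclidean_space \<Rightarrow> ennreal) \<Rightarrow> ('b \<Rightarrow> ennreal) \<Rightarrow> ennreal"
  where "midpoint_energy \<Omega> v = (\<integral>\<^sup>+Z. \<Omega> ((fst Z + snd Z) /\<^sub>R 2) * (v (fst Z) * v (snd Z)) \<partial>lborel)"

lemma midpoint_energy_mono:
  assumes "\<And>p. \<Omega> p \<le> c * \<Omega>' p" and [measurable]: "\<Omega>' \<in> borel_measurable borel" "v \<in> borel_measurable borel"
  shows "midpoint_energy \<Omega> v \<le> c * midpoint_energy \<Omega>' v"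
proof -
  have m: "(\<lambda>Z. \<Omega>' ((fst Z + snd Z) /\<^sub>R 2)) \<in> borel_measurable borel"
    by measurable
  have "midpoint_energy \<Omega> v \<le> (\<integral>\<^sup>+Z. c * (\<Omega>' ((fst Z + snd Z) /\<^sub>R 2) * (v (fst Z) * v (snd Z))) \<partial>lborel)"
    unfolding midpoint_energy_def mult.assoc[symmetric] by (intro nn_integral_mono mult_right_mono assms) auto
  also have "\<dots> = c * midpoint_energy \<Omega>' v"
    unfolding midpoint_energy_def using m by (intro nn_integral_cmult) measurable
  finally show ?thesis .
qed

lemma midpoint_energy_add:
  assumes [measurable]: "\<Omega> \<in> borel_measurable borel" "\<Omega>' \<in> borel_measurable borel" "v \<in> borel_measurable borel"
  shows "midpoint_energy (\<lambda>p. \<Omega> p + \<Omega>' p) v = midpoint_energy \<Omega> v + midpoint_energy \<Omega>' v"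
  unfolding midpoint_energy_def distrib_right
  by (rule nn_integral_add) measurable

lemma midpoint_energy_one:
  assumes [measurable]: "v \<in> borel_measurable borel"
  shows "midpoint_energy (\<lambda>_. 1) v = (\<integral>\<^sup>+z. v z \<partial>lborel)\<^sup>2"
  unfolding midpoint_energy_def power2_eq_square by (simp add: nn_integral_pair_product)

text \<open>In the coordinates \<open>p + q / 2\<close>, \<open>p - q / 2\<close> the weight depends
  on \<open>p\<close> alone, and the remaining integral over \<open>q\<close> is the one that
  \<open>stft_wigner\<close> evaluates.\<close>

lemma midpoint_energy_stft:
  fixes f :: "'a::euclidean_space \<Rightarrow> complex"
  assumes f: "f \<in> L2" and [measurable]: "\<Omega> \<in> borel_measurable borel"
  shows "ennreal ((1 / 2) ^ DIM('a)) * midpoint_energy \<Omega> (\<lambda>z. ennreal ((cmod (stft f z))\<^sup>2))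
    = (\<integral>\<^sup>+p. \<Omega> p * (\<integral>\<^sup>+Y. ennreal ((cmod (wigner f Y))\<^sup>2 * exp (- (4 * pi) * (norm (Y - p))\<^sup>2)) \<partial>lborel) \<partial>lborel)"
proof -
  have [measurable]: "f \<in> borel_measurable borel" using f by auto
  let ?v = "\<lambda>z. ennreal ((cmod (stft f z))\<^sup>2)"
  let ?H = "\<lambda>Z. \<Omega> ((fst Z + snd Z) /\<^sub>R 2) * (?v (fst Z) * ?v (snd Z))"
  have H: "?H \<in> borel_measurable borel" by measurable
  have mid: "(p + q /\<^sub>R 2 + (p - q /\<^sub>R 2)) /\<^sub>R 2 = p" for p q :: "'a \<times> 'a"
    by (simp add: scaleR_2[symmetric] del: scaleR_2)
  have mq: "(\<lambda>q. p + q /\<^sub>R 2) \<in> borel_measurable borel" "(\<lambda>q. p - q /\<^sub>R 2) \<in> borel_measurable borel" for p :: "'a \<times> 'a"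
    by (auto intro!: borel_measurable_continuous_onI continuous_intros)
  have vm: "(\<lambda>q. ennreal ((cmod (stft f (p + q /\<^sub>R 2)))\<^sup>2 * (cmod (stft f (p - q /\<^sub>R 2)))\<^sup>2)) \<in> borel_measurable lborel" for p
    using mq[of p] by measurable
  have jm: "(\<lambda>Z. ennreal ((cmod (stft f (fst Z + snd Z /\<^sub>R 2)))\<^sup>2 * (cmod (stft f (fst Z - snd Z /\<^sub>R 2)))\<^sup>2)) \<in> borel_measurable (lborel \<Otimes>\<^sub>M lborel)"
  proof -
    have "(\<lambda>Z::('a\<times>'a)\<times>('a\<times>'a). fst Z + snd Z /\<^sub>R 2) \<in> borel_measurable borel" "(\<lambda>Z::('a\<times>'a)\<times>('a\<times>'a). fst Z - snd Z /\<^sub>R 2) \<in> borel_measurable borel"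
      by (auto intro!: borel_measurable_continuous_onI continuous_intros)
    then show ?thesis unfolding lborel_prod by measurable
  qed
  have im: "(\<lambda>p. \<integral>\<^sup>+q. ennreal ((cmod (stft f (p + q /\<^sub>R 2)))\<^sup>2 * (cmod (stft f (p - q /\<^sub>R 2)))\<^sup>2) \<partial>lborel) \<in> borel_measurable lborel"
    using lborel.borel_measurable_nn_integral_fst[OF jm] by simp
  have "midpoint_energy \<Omega> ?v = (\<integral>\<^sup>+x. \<integral>\<^sup>+y. ?H (x, y) \<partial>lborel \<partial>lborel)"
    unfolding midpoint_energy_def by (rule nn_integral_lborel_pair[OF H])
  also have "\<dots> = (\<integral>\<^sup>+p. \<integral>\<^sup>+q. ?H (p + q /\<^sub>R 2, p - q /\<^sub>R 2) \<partial>lborel \<partial>lborel)"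
    by (rule nn_integral_midpoint[OF H, symmetric])
  also have "\<dots> = (\<integral>\<^sup>+p. \<integral>\<^sup>+q. \<Omega> p * ennreal ((cmod (stft f (p + q /\<^sub>R 2)))\<^sup>2 * (cmod (stft f (p - q /\<^sub>R 2)))\<^sup>2) \<partial>lborel \<partial>lborel)"
    unfolding fst_conv snd_conv mid by (simp only: ennreal_mult zero_le_power2)
  also have "\<dots> = (\<integral>\<^sup>+p. \<Omega> p * (\<integral>\<^sup>+q. ennreal ((cmod (stft f (p + q /\<^sub>R 2)))\<^sup>2 * (cmod (stft f (p - q /\<^sub>R 2)))\<^sup>2) \<partial>lborel) \<partial>lborel)"
    by (intro nn_integral_cong nn_integral_cmult vm)
  finally have "ennreal ((1 / 2) ^ DIM('a)) * midpoint_energy \<Omega> ?v =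
     (\<integral>\<^sup>+p. ennreal ((1 / 2) ^ DIM('a)) * (\<Omega> p * (\<integral>\<^sup>+q. ennreal ((cmod (stft f (p + q /\<^sub>R 2)))\<^sup>2 * (cmod (stft f (p - q /\<^sub>R 2)))\<^sup>2) \<partial>lborel)) \<partial>lborel)"
    using im by (simp only:) (rule nn_integral_cmult[symmetric], measurable)
  then show ?thesis unfolding mult.left_commute[of "ennreal _"] stft_wigner[OF f] .
qed

text \<open>The two parts exchange \<open>u\<close> and its smoothing in opposite directions. The
  last hypothesis lets the weight migrate between the two points of a double integral at the price
  of a worse kernel; Tonelli then integrates that kernel out in the first part and restores it in
  the second.\<close>

lemma gaussian_smoothing:
  fixes u :: "'b::euclidean_space \<Rightarrow> ennreal"
  assumes [measurable]: "u \<in> borel_measurable borel" "\<Theta> \<in> borel_measurable borel" "\<Omega> \<in> borel_measurable borel" "g \<in> borel_measurable borel" "h \<in> borel_measurable borel"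
    and even: "\<And>x. g (- x) = g x" 
    and le: "\<And>m p. \<Theta> m * g (p - m) \<le> C * \<Omega> p * h (p - m)"
  shows "(\<integral>\<^sup>+p. \<Theta> p * (\<integral>\<^sup>+Y. u Y * g (Y - p) \<partial>lborel) \<partial>lborel) \<le> C * (\<integral>\<^sup>+x. h x \<partial>lborel) * (\<integral>\<^sup>+Y. \<Omega> Y * u Y \<partial>lborel)"
    and "(\<integral>\<^sup>+x. g x \<partial>lborel) * (\<integral>\<^sup>+Y. \<Theta> Y * u Y \<partial>lborel) \<le> C * (\<integral>\<^sup>+p. \<Omega> p * (\<integral>\<^sup>+Y. u Y * h (p - Y) \<partial>lborel) \<partial>lborel)"
proof -
  have md: "(\<lambda>Z::'b \<times> 'b. fst Z - snd Z) \<in> borel_measurable borel" "(\<lambda>Z::'b \<times> 'b. snd Z - fst Z) \<in> borel_measurable borel"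
    by (auto intro!: borel_measurable_continuous_onI continuous_intros)
  have int_h: "(\<integral>\<^sup>+p. h (Y - p) \<partial>lborel) = (\<integral>\<^sup>+x. h x \<partial>lborel)" for Y by (rule nn_integral_reflect) simp
  have int_g: "(\<integral>\<^sup>+p. g (p - Y) \<partial>lborel) = (\<integral>\<^sup>+x. g x \<partial>lborel)" for Y
    using nn_integral_translate[of g "- Y"] by simp
  have "(\<integral>\<^sup>+p. \<Theta> p * (\<integral>\<^sup>+Y. u Y * g (Y - p) \<partial>lborel) \<partial>lborel) = (\<integral>\<^sup>+p. \<integral>\<^sup>+Y. \<Theta> p * (u Y * g (Y - p)) \<partial>lborel \<partial>lborel)"
    by (intro nn_integral_cong nn_integral_cmult[symmetric]) measurable
  also have "\<dots> \<le> (\<integral>\<^sup>+p. \<integral>\<^sup>+Y. C * (\<Omega> Y * u Y * h (Y - p)) \<partial>lborel \<partial>lborel)"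
  proof (intro nn_integral_mono)
    fix p Y
    show "\<Theta> p * (u Y * g (Y - p)) \<le> C * (\<Omega> Y * u Y * h (Y - p))"
      using mult_right_mono[OF le[of p Y], of "u Y"] by (simp add: mult_ac)
  qed
  also have "\<dots> = (\<integral>\<^sup>+Y. \<integral>\<^sup>+p. C * (\<Omega> Y * u Y * h (Y - p)) \<partial>lborel \<partial>lborel)"
    using md by (intro nn_integral_swap) (simp only: split_beta', measurable)
  also have "\<dots> = (\<integral>\<^sup>+Y. C * ((\<Omega> Y * u Y) * (\<integral>\<^sup>+p. h (Y - p) \<partial>lborel)) \<partial>lborel)"
    by (intro nn_integral_cong) (simp add: nn_integral_cmult)
  also have "\<dots> = C * ((\<integral>\<^sup>+Y. \<Omega> Y * u Y \<partial>lborel) * (\<integral>\<^sup>+x. h x \<partial>lborel))"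
    unfolding int_h by (simp add: nn_integral_cmult nn_integral_multc)
  finally show "(\<integral>\<^sup>+p. \<Theta> p * (\<integral>\<^sup>+Y. u Y * g (Y - p) \<partial>lborel) \<partial>lborel) \<le> C * (\<integral>\<^sup>+x. h x \<partial>lborel) * (\<integral>\<^sup>+Y. \<Omega> Y * u Y \<partial>lborel)"
    by (simp add: mult_ac)
  have "(\<integral>\<^sup>+x. g x \<partial>lborel) * (\<integral>\<^sup>+Y. \<Theta> Y * u Y \<partial>lborel) = (\<integral>\<^sup>+Y. (\<Theta> Y * u Y) * (\<integral>\<^sup>+p. g (p - Y) \<partial>lborel) \<partial>lborel)"
    unfolding int_g by (simp add: nn_integral_cmult mult.commute)
  also have "\<dots> = (\<integral>\<^sup>+Y. \<integral>\<^sup>+p. (\<Theta> Y * u Y) * g (p - Y) \<partial>lborel \<partial>lborel)"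
    by (intro nn_integral_cong nn_integral_cmult[symmetric]) measurable
  also have "\<dots> \<le> (\<integral>\<^sup>+Y. \<integral>\<^sup>+p. C * (\<Omega> p * (u Y * h (p - Y))) \<partial>lborel \<partial>lborel)"
  proof (intro nn_integral_mono)
    fix p Y
    show "\<Theta> Y * u Y * g (p - Y) \<le> C * (\<Omega> p * (u Y * h (p - Y)))"
      using mult_right_mono[OF le[of Y p], of "u Y"] by (simp add: mult_ac)
  qed
  also have "\<dots> = (\<integral>\<^sup>+p. \<integral>\<^sup>+Y. C * (\<Omega> p * (u Y * h (p - Y))) \<partial>lborel \<partial>lborel)"
    using md by (intro nn_integral_swap) (simp only: split_beta', measurable)
  also have "\<dots> = (\<integral>\<^sup>+p. C * (\<Omega> p * (\<integral>\<^sup>+Y. u Y * h (p - Y) \<partial>lborel)) \<partial>lborel)"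
    by (intro nn_integral_cong) (simp add: nn_integral_cmult)
  also have "\<dots> = C * (\<integral>\<^sup>+p. \<Omega> p * (\<integral>\<^sup>+Y. u Y * h (p - Y) \<partial>lborel) \<partial>lborel)"
  proof (rule nn_integral_cmult)
    have "(\<lambda>Z. u (snd Z) * h (fst Z - snd Z)) \<in> borel_measurable (lborel \<Otimes>\<^sub>M lborel)"
      unfolding lborel_prod using md by measurable
    from lborel.borel_measurable_nn_integral_fst[OF this]
    have "(\<lambda>p. \<integral>\<^sup>+Y. u Y * h (p - Y) \<partial>lborel) \<in> borel_measurable lborel" by simp
    then show "(\<lambda>p. \<Omega> p * (\<integral>\<^sup>+Y. u Y * h (p - Y) \<partial>lborel)) \<in> borel_measurable lborel" by measurable
  qed
  finally show "(\<integral>\<^sup>+x. g x \<partial>lborel) * (\<integral>\<^sup>+Y. \<Theta> Y * u Y \<partial>lborel) \<le> C * (\<integral>\<^sup>+p. \<Omega> p * (\<integral>\<^sup>+Y. u Y * h (p - Y) \<partial>lborel) \<partial>lborel)" .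
qed

text \<open>The square of the mean of two norms is at most the sum of their squares. The product on
  the right lets each factor of a tensor kernel absorb its own share of the weight.\<close>

lemma japanese_bracket_midpoint:
  fixes a b :: "'a::real_inner"
  assumes "s \<ge> 0"
  shows "japanese_bracket ((a + b) /\<^sub>R 2) powr (2 * s) \<le> japanese_bracket a powr (2 * s) * japanese_bracket b powr (2 * s)"
proof -
  have "norm ((a + b) /\<^sub>R 2) \<le> (norm a + norm b) / 2"
    using norm_triangle_ineq[of a b] by simp
  then have "(norm ((a + b) /\<^sub>R 2))\<^sup>2 \<le> ((norm a + norm b) / 2)\<^sup>2" by (intro power_mono) auto
  also have "\<dots> \<le> (norm a)\<^sup>2 + (norm b)\<^sup>2"
  proof -
    have gen: "(X + Y + 2 * P) / 4 \<le> X + Y" if "2 * P \<le> X + Y" "0 \<le> X" "0 \<le> Y" for X Y P :: real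
      using that by simp
    have "((norm a + norm b) / 2)\<^sup>2 = ((norm a)\<^sup>2 + (norm b)\<^sup>2 + 2 * (norm a * norm b)) / 4"
      by (simp add: power2_sum power_divide)
    also have "\<dots> \<le> (norm a)\<^sup>2 + (norm b)\<^sup>2"
      by (rule gen) (use sum_squares_bound[of "norm a" "norm b"] in \<open>auto simp: mult.assoc\<close>)
    finally show ?thesis .
  qed
  finally have n: "(norm ((a + b) /\<^sub>R 2))\<^sup>2 \<le> (norm a)\<^sup>2 + (norm b)\<^sup>2" .
  have e: "(1 + x) * (1 + y) = 1 + x + y + x * y" for x y :: real by (simp add: algebra_simps)
  have "(norm a)\<^sup>2 * (norm b)\<^sup>2 \<ge> 0" by simp
  then have "1 + (norm ((a + b) /\<^sub>R 2))\<^sup>2 \<le> (1 + (norm a)\<^sup>2) * (1 + (norm b)\<^sup>2)"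
    unfolding e using n by linarith
  then have "(1 + (norm ((a + b) /\<^sub>R 2))\<^sup>2) powr s \<le> ((1 + (norm a)\<^sup>2) * (1 + (norm b)\<^sup>2)) powr s"
    using assms by (intro powr_mono2) auto
  then show ?thesis unfolding japanese_bracket_powr by (simp add: powr_mult)
qed

text \<open>The heart of the transport: a linear map commutes with taking midpoints, so a kernel
  bound for single points yields a bound for weighted pairs. In the exponent, \<open>s\<close> pays
  for moving the weight and \<open>DIM('b)\<close> for integrating what is left of the
  kernel.\<close>

lemma midpoint_energy_kernel:
  fixes v v' :: "'b::euclidean_space \<Rightarrow> ennreal" and S :: "'b \<Rightarrow> 'b" and s :: real
  assumes [measurable]: "v \<in> borel_measurable borel" "\<Omega> \<in> borel_measurable borel" "\<Theta> \<in> borel_measurable borel"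
    and S: "linear S" and s: "s \<ge> 0"
    and v': "\<And>w. v' w \<le> C * (\<integral>\<^sup>+z. ennreal (japanese_bracket (w - S z) powr (- 2 * (s + DIM('b)))) * v z \<partial>lborel)"
    and le: "\<And>m p. \<Theta> m \<le> D * \<Omega> p * ennreal (japanese_bracket (m - p) powr (2 * s))"
  shows "midpoint_energy \<Theta> v' \<le> C * C * D * (\<integral>\<^sup>+x. ennreal (japanese_bracket (x::'b) powr (- 2 * real DIM('b))) \<partial>lborel)\<^sup>2 * midpoint_energy (\<lambda>p. \<Omega> (S p)) v"
proof -
  let ?k = "\<lambda>x::'b. ennreal (japanese_bracket x powr (- 2 * (s + DIM('b))))"
  let ?l = "\<lambda>x::'b. ennreal (japanese_bracket x powr (- 2 * real DIM('b)))"
  let ?m = "\<lambda>Z::'b \<times> 'b. (fst Z + snd Z) /\<^sub>R 2"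
  let ?V = "\<lambda>Z. v (fst Z) * v (snd Z)"
  let ?L = "\<lambda>W Z. ?l (fst W - S (fst Z)) * ?l (snd W - S (snd Z))"
  have [measurable]: "S \<in> borel_measurable borel"
    using S by (intro borel_measurable_continuous_onI linear_continuous_on) (simp add: linear_conv_bounded_linear)
  have pt: "\<Theta> (?m W) * (?k (fst W - S (fst Z)) * ?k (snd W - S (snd Z))) \<le> D * (\<Omega> (S (?m Z)) * ?L W Z)" for W Z
  proof -
    let ?a = "fst W - S (fst Z)" and ?b = "snd W - S (snd Z)"
    \<comment> \<open>The displacement of the midpoints is the mean of the two individual
      displacements; here linearity of \<open>S\<close> enters.\<close>
    have d: "?m W - S (?m Z) = (?a + ?b) /\<^sub>R 2"
      by (simp add: linear_add[OF S] linear_cmul[OF S] scaleR_add_right scaleR_diff_right)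
    have kl: "japanese_bracket x powr (2 * s) * japanese_bracket x powr (- 2 * (s + DIM('b))) = japanese_bracket x powr (- 2 * real DIM('b))" for x :: 'b
      by (simp flip: powr_add add: algebra_simps)
    have "\<Theta> (?m W) \<le> D * \<Omega> (S (?m Z)) * ennreal (japanese_bracket ((?a + ?b) /\<^sub>R 2) powr (2 * s))"
      using le[of "?m W" "S (?m Z)"] unfolding d .
    also have "\<dots> \<le> D * \<Omega> (S (?m Z)) * ennreal (japanese_bracket ?a powr (2 * s) * japanese_bracket ?b powr (2 * s))"
      by (intro mult_left_mono ennreal_leI japanese_bracket_midpoint s) auto
    finally have "\<Theta> (?m W) * (?k ?a * ?k ?b) \<le> D * \<Omega> (S (?m Z)) * ennreal (japanese_bracket ?a powr (2 * s) * japanese_bracket ?b powr (2 * s)) * (?k ?a * ?k ?b)"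
      by (rule mult_right_mono) auto
    also have "\<dots> = D * (\<Omega> (S (?m Z)) * (ennreal (japanese_bracket ?a powr (2 * s) * japanese_bracket ?a powr (- 2 * (s + DIM('b)))) * ennreal (japanese_bracket ?b powr (2 * s) * japanese_bracket ?b powr (- 2 * (s + DIM('b))))))"
      by (simp only: ennreal_mult powr_ge_zero mult_ac)
    finally show ?thesis unfolding kl .
  qed
  have vv: "v' (fst W) * v' (snd W) \<le> C * C * (\<integral>\<^sup>+Z. (?k (fst W - S (fst Z)) * ?k (snd W - S (snd Z))) * ?V Z \<partial>lborel)" for W
  proof -
    have "v' (fst W) * v' (snd W) \<le> (C * (\<integral>\<^sup>+z. ?k (fst W - S z) * v z \<partial>lborel)) * (C * (\<integral>\<^sup>+z. ?k (snd W - S z) * v z \<partial>lborel))"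
      by (intro mult_mono v') auto
    also have "\<dots> = C * C * (\<integral>\<^sup>+Z. (?k (fst W - S (fst Z)) * v (fst Z)) * (?k (snd W - S (snd Z)) * v (snd Z)) \<partial>lborel)"
      by (subst nn_integral_pair_product) (simp_all add: mult_ac)
    finally show ?thesis by (simp add: mult_ac)
  qed
  have mW: "(\<lambda>Z. ?k (fst W - S (fst Z)) * ?k (snd W - S (snd Z)) * ?V Z) \<in> borel_measurable lborel" for W by measurable
  have "midpoint_energy \<Theta> v' \<le> (\<integral>\<^sup>+W. \<Theta> (?m W) * (C * C * (\<integral>\<^sup>+Z. (?k (fst W - S (fst Z)) * ?k (snd W - S (snd Z))) * ?V Z \<partial>lborel)) \<partial>lborel)"
    unfolding midpoint_energy_def by (intro nn_integral_mono mult_left_mono vv) auto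
  also have "\<dots> = (\<integral>\<^sup>+W. \<integral>\<^sup>+Z. C * C * (\<Theta> (?m W) * ((?k (fst W - S (fst Z)) * ?k (snd W - S (snd Z))) * ?V Z)) \<partial>lborel \<partial>lborel)"
    by (intro nn_integral_cong) (subst nn_integral_cmult, measurable, subst nn_integral_cmult, measurable, simp only: mult_ac)
  also have "\<dots> \<le> (\<integral>\<^sup>+W. \<integral>\<^sup>+Z. C * C * D * (\<Omega> (S (?m Z)) * ?V Z * ?L W Z) \<partial>lborel \<partial>lborel)"
  proof (intro nn_integral_mono)
    fix W Z :: "'b \<times> 'b"
    show "C * C * (\<Theta> (?m W) * ((?k (fst W - S (fst Z)) * ?k (snd W - S (snd Z))) * ?V Z)) \<le> C * C * D * (\<Omega> (S (?m Z)) * ?V Z * ?L W Z)"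
      using mult_left_mono[OF mult_right_mono[OF pt[of W Z], of "?V Z"], of "C * C"] by (simp add: mult_ac)
  qed
  also have "\<dots> = (\<integral>\<^sup>+Z. \<integral>\<^sup>+W. C * C * D * (\<Omega> (S (?m Z)) * ?V Z * ?L W Z) \<partial>lborel \<partial>lborel)"
    by (rule nn_integral_swap) (simp only: split_beta', measurable)
  also have "\<dots> = (\<integral>\<^sup>+Z. C * C * D * (\<Omega> (S (?m Z)) * ?V Z * (\<integral>\<^sup>+W. ?L W Z \<partial>lborel)) \<partial>lborel)"
    by (intro nn_integral_cong) (simp add: nn_integral_cmult)
  also have "\<dots> = (\<integral>\<^sup>+Z. C * C * D * (\<Omega> (S (?m Z)) * ?V Z * (\<integral>\<^sup>+x. ?l x \<partial>lborel)\<^sup>2) \<partial>lborel)"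
  proof (intro nn_integral_cong)
    fix Z :: "'b \<times> 'b"
    have "(\<integral>\<^sup>+W. ?L W Z \<partial>lborel) = (\<integral>\<^sup>+x. ?l (x - S (fst Z)) \<partial>lborel) * (\<integral>\<^sup>+x. ?l (x - S (snd Z)) \<partial>lborel)"
      by (rule nn_integral_pair_product) measurable
    also have "\<dots> = (\<integral>\<^sup>+x. ?l x \<partial>lborel)\<^sup>2"
      using nn_integral_translate[of ?l "- S (fst Z)"] nn_integral_translate[of ?l "- S (snd Z)"] by (simp add: power2_eq_square)
    finally show "C * C * D * (\<Omega> (S (?m Z)) * ?V Z * (\<integral>\<^sup>+W. ?L W Z \<partial>lborel)) = C * C * D * (\<Omega> (S (?m Z)) * ?V Z * (\<integral>\<^sup>+x. ?l x \<partial>lborel)\<^sup>2)"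
      by simp
  qed
  also have "\<dots> = C * C * D * (midpoint_energy (\<lambda>p. \<Omega> (S p)) v * (\<integral>\<^sup>+x. ?l x \<partial>lborel)\<^sup>2)"
    unfolding midpoint_energy_def by (subst nn_integral_cmult, measurable) (subst nn_integral_multc, measurable)
  finally show ?thesis by (simp only: mult_ac)
qed

section \<open>Transport of the Wigner wave front set\<close>

definition cutoff_weight :: "'b::euclidean_space set \<Rightarrow> real \<Rightarrow> 'b \<Rightarrow> ennreal"
  where "cutoff_weight \<Gamma> s x = ennreal (indicator \<Gamma> x * japanese_bracket x powr (2 * s))"

lemma cutoff_weight_measurable [measurable]:
  assumes "open \<Gamma>" shows "cutoff_weight \<Gamma> s \<in> borel_measurable borel"
proof -
  have [measurable]: "\<Gamma> \<in> sets borel" using assms by simp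
  show ?thesis unfolding cutoff_weight_def[abs_def] by measurable
qed

lemma cutoff_weight_cone:
  fixes \<Gamma> :: "'a::euclidean_space set"
  assumes "open \<Gamma>" "punctured_cone \<Gamma>" "X \<in> \<Gamma>"
  obtains \<Gamma>' where "open \<Gamma>'" "punctured_cone \<Gamma>'" "X \<in> \<Gamma>'"
    "\<And>s. s \<ge> 0 \<Longrightarrow> \<exists>C<\<infinity>. \<forall>m p. cutoff_weight \<Gamma>' s m
       \<le> C * (cutoff_weight \<Gamma> s p + 1) * ennreal (japanese_bracket (m - p) powr (2 * s))"
proof -
  obtain \<Gamma>' where G: "open \<Gamma>'" "punctured_cone \<Gamma>'" "X \<in> \<Gamma>'"
    "\<And>s. s \<ge> 0 \<Longrightarrow> \<exists>C\<ge>0. \<forall>m p. indicator \<Gamma>' m * japanese_bracket m powr (2 * s)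
       \<le> C * (indicator \<Gamma> p * japanese_bracket p powr (2 * s) + 1) * japanese_bracket (m - p) powr (2 * s)"
    using cone_weight[OF assms] by blast
  have "\<exists>C<\<infinity>. \<forall>m p. cutoff_weight \<Gamma>' s m \<le> C * (cutoff_weight \<Gamma> s p + 1) * ennreal (japanese_bracket (m - p) powr (2 * s))"
    if s: "s \<ge> 0" for s
  proof -
    obtain C where C: "C \<ge> 0" "\<And>m p. indicator \<Gamma>' m * japanese_bracket m powr (2 * s)
       \<le> C * (indicator \<Gamma> p * japanese_bracket p powr (2 * s) + 1) * japanese_bracket (m - p) powr (2 * s)"
      using G(4)[OF s] by blast
    have "cutoff_weight \<Gamma>' s m \<le> ennreal C * (cutoff_weight \<Gamma> s p + 1) * ennreal (japanese_bracket (m - p) powr (2 * s))" for m p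
    proof -
      have "cutoff_weight \<Gamma>' s m \<le> ennreal (C * (indicator \<Gamma> p * japanese_bracket p powr (2 * s) + 1) * japanese_bracket (m - p) powr (2 * s))"
        unfolding cutoff_weight_def by (rule ennreal_leI[OF C(2)])
      also have "\<dots> = ennreal C * ennreal (indicator \<Gamma> p * japanese_bracket p powr (2 * s) + 1) * ennreal (japanese_bracket (m - p) powr (2 * s))"
        using C(1) by (simp add: ennreal_mult)
      also have "ennreal (indicator \<Gamma> p * japanese_bracket p powr (2 * s) + 1) = cutoff_weight \<Gamma> s p + 1"
        unfolding cutoff_weight_def by (subst ennreal_plus) auto
      finally show ?thesis .
    qed
    then show ?thesis by (intro exI[of _ "ennreal C"]) auto
  qed
  with G show ?thesis using that by blast
qed

lemma cutoff_weight_set_integral: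
  "(\<integral>\<^sup>+X\<in>\<Gamma>. ennreal (japanese_bracket X powr (2 * s) * (cmod (F X))\<^sup>2) \<partial>lborel)
    = (\<integral>\<^sup>+X. cutoff_weight \<Gamma> s X * ennreal ((cmod (F X))\<^sup>2) \<partial>lborel)"
  by (intro nn_integral_cong) (auto simp: cutoff_weight_def indicator_def ennreal_mult)

text \<open>The rate 4 pi is that of the squared Gaussian localisation in
  \<open>stft_wigner\<close>. Negative \<open>s\<close> is also used, to cancel a weight.\<close>

abbreviation wgauss :: "real \<Rightarrow> 'b::euclidean_space \<Rightarrow> ennreal"
  where "wgauss s x \<equiv> ennreal (japanese_bracket x powr (2 * s) * exp (- (4 * pi) * (norm x)\<^sup>2))"

text \<open>Needed to divide: finiteness of a product passes to the other factor only if this one is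
  not 0.\<close>

lemma wgauss_pos: "(\<integral>\<^sup>+x. wgauss s (x::'b::euclidean_space) \<partial>lborel) > 0"
proof (rule ccontr)
  assume "\<not> (\<integral>\<^sup>+x. wgauss s (x::'b) \<partial>lborel) > 0"
  then have "(\<integral>\<^sup>+x. wgauss s (x::'b) \<partial>lborel) = 0" by simp
  then have "AE x in lborel. wgauss s (x::'b) = 0"
    by (subst (asm) nn_integral_0_iff_AE) auto
  then have "AE x in (lborel::'b measure). False"
  proof eventually_elim
    case (elim x)
    then show False using japanese_bracket_pos[of x] by (simp add: ennreal_eq_0_iff mult_le_0_iff not_le)
  qed
  then have "emeasure (lborel :: 'b measure) UNIV = 0" by (simp add: AE_iff_null_sets null_sets_def ae_filter_eq_bot_iff)
  then show False by simp
qed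

lemma wgauss_finite:
  assumes "s \<ge> 0" shows "(\<integral>\<^sup>+x. wgauss s (x::'b::euclidean_space) \<partial>lborel) < \<infinity>"
  using pi_gt3 by (intro gaussian_weight_integral assms) simp

lemma midpoint_energy_stft_wgauss:
  fixes f :: "'a::euclidean_space \<Rightarrow> complex"
  assumes f: "f \<in> L2" and [measurable]: "\<Omega> \<in> borel_measurable borel"
  shows "ennreal ((1 / 2) ^ DIM('a)) * midpoint_energy \<Omega> (\<lambda>z. ennreal ((cmod (stft f z))\<^sup>2))
    = (\<integral>\<^sup>+p. \<Omega> p * (\<integral>\<^sup>+Y. ennreal ((cmod (wigner f Y))\<^sup>2) * wgauss 0 (Y - p) \<partial>lborel) \<partial>lborel)"
proof -
  have "japanese_bracket x powr (2 * 0) = 1" for x :: "'a \<times> 'a" using japanese_bracket_pos[of x] by simp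
  then show ?thesis unfolding midpoint_energy_stft[OF assms] by (simp add: ennreal_mult)
qed

lemma midpoint_energy_stft_one_finite:
  "f \<in> L2 \<Longrightarrow> midpoint_energy (\<lambda>_. 1) (\<lambda>z. ennreal ((cmod (stft f z))\<^sup>2)) < \<infinity>"
proof -
  assume f: "f \<in> L2"
  then have [measurable]: "f \<in> borel_measurable borel" by auto
  show ?thesis by (subst midpoint_energy_one) (auto simp: stft_isometry_nn[OF f] ennreal_power)
qed

lemma wgauss_shift: "wgauss s (Y - p) = wgauss s (p - Y)"
  by (simp add: japanese_bracket_minus[of Y p] norm_minus_commute[of Y p])

lemma half_power_cancel:
  assumes "ennreal ((1 / 2) ^ n) * E < \<infinity>" shows "E < \<infinity>"
proof -
  have "\<not> (1 / 2 :: real) ^ n \<le> 0" by (simp add: not_le)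
  then show ?thesis using assms by (auto simp: ennreal_mult_less_top ennreal_eq_0_iff)
qed

text \<open>Smoothing with the constant weight 1 preserves the integral up to a positive factor, and
  the unweighted midpoint energy is the square of the integral of |V f|^2.\<close>

lemma wigner_square_integrable:
  fixes f :: "'a::euclidean_space \<Rightarrow> complex"
  assumes f: "f \<in> L2"
  shows "(\<integral>\<^sup>+Y. ennreal ((cmod (wigner f Y))\<^sup>2) \<partial>lborel) < \<infinity>"
proof -
  have [measurable]: "f \<in> borel_measurable borel" using f by auto
  let ?u = "\<lambda>Y. ennreal ((cmod (wigner f Y))\<^sup>2)"
  have "(\<integral>\<^sup>+x. wgauss 0 (x::'a \<times> 'a) \<partial>lborel) * (\<integral>\<^sup>+Y. 1 * ?u Y \<partial>lborel)
     \<le> 1 * (\<integral>\<^sup>+p. 1 * (\<integral>\<^sup>+Y. ?u Y * wgauss 0 (p - Y) \<partial>lborel) \<partial>lborel)"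
    by (rule gaussian_smoothing(2)) (measurable, auto simp: japanese_bracket_def)
  also have "\<dots> = ennreal ((1 / 2) ^ DIM('a)) * midpoint_energy (\<lambda>_. 1) (\<lambda>z. ennreal ((cmod (stft f z))\<^sup>2))"
    unfolding midpoint_energy_stft_wgauss[OF f borel_measurable_const] mult_1
    by (intro nn_integral_cong arg_cong2[where f = "(*)"] refl wgauss_shift)
  also have "\<dots> < \<infinity>" using midpoint_energy_stft_one_finite[OF f] by (simp add: ennreal_mult_less_top)
  finally show ?thesis using wgauss_pos[of 0, where 'b="'a \<times> 'a"] by (auto simp: ennreal_mult_less_top)
qed

text \<open>Smoothing spreads the Wigner distribution by Gaussian tails. The hypothesis on
  \<open>C\<close> lets the weight travel along them, and its constant term meets the square
  integrability of the Wigner distribution.\<close>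

lemma wigner_to_midpoint_energy:
  fixes f :: "'a::euclidean_space \<Rightarrow> complex"
  assumes f: "f \<in> L2" and s: "s \<ge> 0" and o: "open \<Gamma>" "open \<Gamma>'"
    and fin: "(\<integral>\<^sup>+X. cutoff_weight \<Gamma> s X * ennreal ((cmod (wigner f X))\<^sup>2) \<partial>lborel) < \<infinity>"
    and C: "C < \<infinity>" "\<And>m p. cutoff_weight \<Gamma>' s m \<le> C * (cutoff_weight \<Gamma> s p + 1) * ennreal (japanese_bracket (m - p) powr (2 * s))"
  shows "midpoint_energy (\<lambda>p. cutoff_weight \<Gamma>' s p + 1) (\<lambda>z. ennreal ((cmod (stft f z))\<^sup>2)) < \<infinity>"
proof -
  have [measurable]: "f \<in> borel_measurable borel" using f by auto
  note [measurable] = cutoff_weight_measurable[OF o(1)] cutoff_weight_measurable[OF o(2)]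
  let ?u = "\<lambda>Y. ennreal ((cmod (wigner f Y))\<^sup>2)"
  have "ennreal ((1 / 2) ^ DIM('a)) * midpoint_energy (cutoff_weight \<Gamma>' s) (\<lambda>z. ennreal ((cmod (stft f z))\<^sup>2))
     \<le> C * (\<integral>\<^sup>+x. wgauss s (x::'a \<times> 'a) \<partial>lborel) * (\<integral>\<^sup>+Y. (cutoff_weight \<Gamma> s Y + 1) * ?u Y \<partial>lborel)"
    unfolding midpoint_energy_stft_wgauss[OF f cutoff_weight_measurable[OF o(2)]]
  proof (rule gaussian_smoothing(1))
    fix m p :: "'a \<times> 'a"
    have "cutoff_weight \<Gamma>' s m * wgauss 0 (p - m) \<le> C * (cutoff_weight \<Gamma> s p + 1) * ennreal (japanese_bracket (m - p) powr (2 * s)) * wgauss 0 (p - m)"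
      by (rule mult_right_mono[OF C(2)]) simp
    also have "\<dots> = C * (cutoff_weight \<Gamma> s p + 1) * wgauss s (p - m)"
      using japanese_bracket_pos[of "p - m"] by (simp add: mult.assoc japanese_bracket_minus[of m p] ennreal_mult)
    finally show "cutoff_weight \<Gamma>' s m * wgauss 0 (p - m) \<le> C * (cutoff_weight \<Gamma> s p + 1) * wgauss s (p - m)" .
  qed (measurable, auto simp: japanese_bracket_def)
  also have "(\<integral>\<^sup>+Y. (cutoff_weight \<Gamma> s Y + 1) * ?u Y \<partial>lborel) = (\<integral>\<^sup>+Y. cutoff_weight \<Gamma> s Y * ?u Y \<partial>lborel) + (\<integral>\<^sup>+Y. ?u Y \<partial>lborel)"
    unfolding distrib_right mult_1 by (rule nn_integral_add) measurable
  also have "C * (\<integral>\<^sup>+x. wgauss s (x::'a \<times> 'a) \<partial>lborel) * \<dots> < \<infinity>"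
    using fin wigner_square_integrable[OF f] wgauss_finite[OF s, where 'b="'a \<times> 'a"] C(1) by (simp add: ennreal_mult_less_top)
  finally have "midpoint_energy (cutoff_weight \<Gamma>' s) (\<lambda>z. ennreal ((cmod (stft f z))\<^sup>2)) < \<infinity>"
    by (rule half_power_cancel)
  then show ?thesis
    using midpoint_energy_stft_one_finite[OF f] by (subst midpoint_energy_add) (auto simp: less_top)
qed

text \<open>The kernel \<open>wgauss (- s)\<close> on the left is chosen so that the factor gained
  by moving the weight turns it into exactly the Gaussian \<open>wgauss 0\<close> occurring in the
  midpoint energy.\<close>

lemma midpoint_energy_to_wigner:
  fixes f :: "'a::euclidean_space \<Rightarrow> complex"
  assumes f: "f \<in> L2" and s: "s \<ge> 0" and o: "open \<Gamma>" "open \<Gamma>'"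
    and fin: "midpoint_energy (\<lambda>p. cutoff_weight \<Gamma> s p + 1) (\<lambda>z. ennreal ((cmod (stft f z))\<^sup>2)) < \<infinity>"
    and C: "C < \<infinity>" "\<And>m p. cutoff_weight \<Gamma>' s m \<le> C * (cutoff_weight \<Gamma> s p + 1) * ennreal (japanese_bracket (m - p) powr (2 * s))"
  shows "(\<integral>\<^sup>+X. cutoff_weight \<Gamma>' s X * ennreal ((cmod (wigner f X))\<^sup>2) \<partial>lborel) < \<infinity>"
proof -
  have [measurable]: "f \<in> borel_measurable borel" using f by auto
  note [measurable] = cutoff_weight_measurable[OF o(1)] cutoff_weight_measurable[OF o(2)]
  let ?u = "\<lambda>Y. ennreal ((cmod (wigner f Y))\<^sup>2)"
  have "(\<integral>\<^sup>+x. wgauss (- s) (x::'a \<times> 'a) \<partial>lborel) * (\<integral>\<^sup>+Y. cutoff_weight \<Gamma>' s Y * ?u Y \<partial>lborel)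
     \<le> C * (\<integral>\<^sup>+p. (cutoff_weight \<Gamma> s p + 1) * (\<integral>\<^sup>+Y. ?u Y * wgauss 0 (p - Y) \<partial>lborel) \<partial>lborel)"
  proof (rule gaussian_smoothing(2))
    fix m p :: "'a \<times> 'a"
    have "cutoff_weight \<Gamma>' s m * wgauss (- s) (p - m) \<le> C * (cutoff_weight \<Gamma> s p + 1) * ennreal (japanese_bracket (m - p) powr (2 * s)) * wgauss (- s) (p - m)"
      by (rule mult_right_mono[OF C(2)]) simp
    also have "\<dots> = C * (cutoff_weight \<Gamma> s p + 1) * ennreal (japanese_bracket (p - m) powr (2 * s) * (japanese_bracket (p - m) powr (2 * - s) * exp (- (4 * pi) * (norm (p - m))\<^sup>2)))"
      by (simp add: mult.assoc japanese_bracket_minus[of m p] ennreal_mult)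
    also have "\<dots> = C * (cutoff_weight \<Gamma> s p + 1) * wgauss 0 (p - m)"
      by (simp add: mult.assoc[symmetric] flip: powr_add)
    finally show "cutoff_weight \<Gamma>' s m * wgauss (- s) (p - m) \<le> C * (cutoff_weight \<Gamma> s p + 1) * wgauss 0 (p - m)" .
  qed (measurable, auto simp: japanese_bracket_def)
  also have "(\<integral>\<^sup>+p. (cutoff_weight \<Gamma> s p + 1) * (\<integral>\<^sup>+Y. ?u Y * wgauss 0 (p - Y) \<partial>lborel) \<partial>lborel)
     = ennreal ((1 / 2) ^ DIM('a)) * midpoint_energy (\<lambda>p. cutoff_weight \<Gamma> s p + 1) (\<lambda>z. ennreal ((cmod (stft f z))\<^sup>2))"
    by (subst midpoint_energy_stft_wgauss[OF f], measurable)
      (intro nn_integral_cong arg_cong2[where f = "(*)"] refl wgauss_shift)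
  also have "C * \<dots> < \<infinity>" using fin C(1) by (simp add: ennreal_mult_less_top)
  finally show ?thesis using wgauss_pos[of "- s", where 'b="'a \<times> 'a"] by (auto simp: ennreal_mult_less_top)
qed

lemma cutoff_weight_linear_image:
  fixes S :: "'b::euclidean_space \<Rightarrow> 'b"
  assumes S: "linear S" "inj S" and s: "s \<ge> 0"
  obtains c where "c < \<infinity>" "\<And>p. cutoff_weight (S ` \<Gamma>) s (S p) + 1 \<le> c * (cutoff_weight \<Gamma> s p + 1)"
proof -
  obtain B0 where B0: "\<And>x. norm (S x) \<le> B0 * norm x" using linear_bounded[OF S(1)] by blast
  \<comment> \<open>A bound of at least 1 lets the summand 1 of the bracket be absorbed as
    well.\<close>
  define B where "B = max 1 B0"
  have B: "B \<ge> 1" "norm (S x) \<le> B * norm x" for x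
    using B0[of x] mult_right_mono[of B0 B "norm x"] by (auto simp: B_def)
  let ?c = "(B\<^sup>2) powr s"
  have c1: "?c \<ge> 1" using B s by (intro ge_one_powr_ge_zero) (auto simp: one_le_power)
  have "japanese_bracket (S p) powr (2 * s) \<le> ?c * japanese_bracket p powr (2 * s)" for p
  proof -
    have "(norm (S p))\<^sup>2 \<le> (B * norm p)\<^sup>2" using B by (intro power_mono) auto
    moreover have "1 \<le> B\<^sup>2" using B by (simp add: one_le_power)
    ultimately have "1 + (norm (S p))\<^sup>2 \<le> B\<^sup>2 * (1 + (norm p)\<^sup>2)" by (simp add: power_mult_distrib distrib_left)
    then have "(1 + (norm (S p))\<^sup>2) powr s \<le> (B\<^sup>2 * (1 + (norm p)\<^sup>2)) powr s" using s by (intro powr_mono2) auto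
    then show ?thesis unfolding japanese_bracket_powr by (simp add: powr_mult)
  qed
  moreover have "indicator (S ` \<Gamma>) (S p) = (indicator \<Gamma> p :: real)" for p
    using S(2) by (auto simp: indicator_def inj_def)
  ultimately have 1: "cutoff_weight (S ` \<Gamma>) s (S p) \<le> ennreal ?c * cutoff_weight \<Gamma> s p" for p
    unfolding cutoff_weight_def by (subst ennreal_mult[symmetric]) (auto intro!: ennreal_leI simp: mult.left_commute mult_left_mono)
  have "cutoff_weight (S ` \<Gamma>) s (S p) + 1 \<le> ennreal ?c * (cutoff_weight \<Gamma> s p + 1)" for p
    unfolding distrib_left mult_1_right using 1[of p] c1 by (intro add_mono) (auto simp: ennreal_1[symmetric] simp del: ennreal_1 intro!: ennreal_leI)
  then show ?thesis using that[of "ennreal ?c"] by simp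
qed


text \<open>By contraposition along a preimage \<open>Y\<close> of \<open>X\<close>: decay of the
  Wigner distribution of \<open>f\<close> near the ray of \<open>Y\<close> becomes weighted midpoint
  energy of \<open>f\<close>, then of \<open>g\<close> by the kernel bound, then decay of the Wigner
  distribution of \<open>g\<close> near the ray of \<open>X\<close>. The cones are chosen before
  \<open>s\<close>, as the wave front set requires one cone for all weights.\<close>

theorem WF_wigner_transport:
  fixes f g :: "'a::euclidean_space \<Rightarrow> complex" and S :: "'a \<times> 'a \<Rightarrow> 'a \<times> 'a"
  assumes f: "f \<in> L2" and g: "g \<in> L2" and S: "linear S" "inj S"
    and kernel: "\<And>N::real. N \<ge> 0 \<Longrightarrow> \<exists>C<\<infinity>. \<forall>w. ennreal ((cmod (stft g w))\<^sup>2)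
       \<le> C * (\<integral>\<^sup>+z. ennreal (japanese_bracket (w - S z) powr (- 2 * N)) * ennreal ((cmod (stft f z))\<^sup>2) \<partial>lborel)"
  shows "WF_wigner g \<subseteq> S ` WF_wigner f"
proof
  fix X assume X: "X \<in> WF_wigner g"
  have [measurable]: "f \<in> borel_measurable borel" using f by auto
  have "surj S" by (rule linear_inj_imp_surj[OF S])
  then obtain Y where Y: "X = S Y" by (rule surjE)
  have "X \<noteq> 0" using X by (simp add: WF_wigner_def)
  then have "Y \<noteq> 0" using Y linear_0[OF S(1)] by auto
  have "Y \<in> WF_wigner f"
  proof (rule ccontr)
    assume "Y \<notin> WF_wigner f"
    then obtain \<Gamma> where \<Gamma>: "open \<Gamma>" "punctured_cone \<Gamma>" "Y \<in> \<Gamma>"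
      "\<And>s. s \<ge> 0 \<Longrightarrow> (\<integral>\<^sup>+X. cutoff_weight \<Gamma> s X * ennreal ((cmod (wigner f X))\<^sup>2) \<partial>lborel) < \<infinity>"
      using \<open>Y \<noteq> 0\<close> unfolding WF_wigner_def cutoff_weight_set_integral by blast
    obtain \<Gamma>1 where \<Gamma>1: "open \<Gamma>1" "punctured_cone \<Gamma>1" "Y \<in> \<Gamma>1"
      "\<And>s. s \<ge> 0 \<Longrightarrow> \<exists>C<\<infinity>. \<forall>m p. cutoff_weight \<Gamma>1 s m \<le> C * (cutoff_weight \<Gamma> s p + 1) * ennreal (japanese_bracket (m - p) powr (2 * s))"
      using cutoff_weight_cone[OF \<Gamma>(1-3)] by blast
    have S1: "open (S ` \<Gamma>1)" "punctured_cone (S ` \<Gamma>1)" "X \<in> S ` \<Gamma>1"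
    proof -
      show "open (S ` \<Gamma>1)" by (rule open_surjective_linear_image[OF \<Gamma>1(1) S(1) \<open>surj S\<close>])
      show "X \<in> S ` \<Gamma>1" using Y \<Gamma>1(3) by blast
      have inj0: "Z = 0" if "S Z = 0" for Z using S that linear_injective_0 by blast
      show "punctured_cone (S ` \<Gamma>1)" unfolding punctured_cone_def
      proof (intro conjI ballI allI impI notI)
        assume "0 \<in> S ` \<Gamma>1"
        then obtain Z where Z: "0 = S Z" "Z \<in> \<Gamma>1" by (rule imageE)
        from inj0[OF Z(1)[symmetric]] Z(2) \<Gamma>1(2) show False by (simp add: punctured_cone_def)
      next
        fix W and t :: real assume "W \<in> S ` \<Gamma>1" "t > 0"
        from this(1) obtain Z where Z: "W = S Z" "Z \<in> \<Gamma>1" by (rule imageE)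
        have "t *\<^sub>R Z \<in> \<Gamma>1" using \<Gamma>1(2) Z(2) \<open>t > 0\<close> unfolding punctured_cone_def by blast
        then show "t *\<^sub>R W \<in> S ` \<Gamma>1" unfolding Z(1) linear_cmul[OF S(1), symmetric] by (rule imageI)
      qed
    qed
    \<comment> \<open>This cone accommodates the kernel, the next one the Gaussian smoothing on the
      way back to the Wigner distribution.\<close>
    obtain \<Gamma>2 where \<Gamma>2: "open \<Gamma>2" "punctured_cone \<Gamma>2" "X \<in> \<Gamma>2"
      "\<And>s. s \<ge> 0 \<Longrightarrow> \<exists>C<\<infinity>. \<forall>m p. cutoff_weight \<Gamma>2 s m \<le> C * (cutoff_weight (S ` \<Gamma>1) s p + 1) * ennreal (japanese_bracket (m - p) powr (2 * s))"
      using cutoff_weight_cone[OF S1] by blast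
    obtain \<Gamma>3 where \<Gamma>3: "open \<Gamma>3" "punctured_cone \<Gamma>3" "X \<in> \<Gamma>3"
      "\<And>s. s \<ge> 0 \<Longrightarrow> \<exists>C<\<infinity>. \<forall>m p. cutoff_weight \<Gamma>3 s m \<le> C * (cutoff_weight \<Gamma>2 s p + 1) * ennreal (japanese_bracket (m - p) powr (2 * s))"
      using cutoff_weight_cone[OF \<Gamma>2(1-3)] by blast
    have "(\<integral>\<^sup>+X. cutoff_weight \<Gamma>3 s X * ennreal ((cmod (wigner g X))\<^sup>2) \<partial>lborel) < \<infinity>" if s: "s \<ge> 0" for s
    proof -
      let ?vf = "\<lambda>z. ennreal ((cmod (stft f z))\<^sup>2)" and ?vg = "\<lambda>z. ennreal ((cmod (stft g z))\<^sup>2)"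
      obtain C1 where C1: "C1 < \<infinity>" "\<And>m p. cutoff_weight \<Gamma>1 s m \<le> C1 * (cutoff_weight \<Gamma> s p + 1) * ennreal (japanese_bracket (m - p) powr (2 * s))"
        using \<Gamma>1(4)[OF s] by blast
      obtain C2 where C2: "C2 < \<infinity>" "\<And>m p. cutoff_weight \<Gamma>2 s m \<le> C2 * (cutoff_weight (S ` \<Gamma>1) s p + 1) * ennreal (japanese_bracket (m - p) powr (2 * s))"
        using \<Gamma>2(4)[OF s] by blast
      obtain C3 where C3: "C3 < \<infinity>" "\<And>m p. cutoff_weight \<Gamma>3 s m \<le> C3 * (cutoff_weight \<Gamma>2 s p + 1) * ennreal (japanese_bracket (m - p) powr (2 * s))"
        using \<Gamma>3(4)[OF s] by blast
      obtain c where c: "c < \<infinity>" "\<And>p. cutoff_weight (S ` \<Gamma>1) s (S p) + 1 \<le> c * (cutoff_weight \<Gamma>1 s p + 1)"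
        using cutoff_weight_linear_image[OF S s] by blast
      \<comment> \<open>The decay order asked of the kernel: \<open>s\<close> for the weight and the
        dimension of phase space for integrability.\<close>
      have "s + real DIM('a \<times> 'a) \<ge> 0" using s by simp
      from kernel[OF this] obtain K where K: "K < \<infinity>" "\<And>w. ?vg w \<le> K * (\<integral>\<^sup>+z. ennreal (japanese_bracket (w - S z) powr (- 2 * (s + real DIM('a \<times> 'a)))) * ?vf z \<partial>lborel)"
        by blast
      note [measurable] = cutoff_weight_measurable[OF \<Gamma>1(1)] cutoff_weight_measurable[OF \<Gamma>2(1)] cutoff_weight_measurable[OF S1(1)]
      have e1: "midpoint_energy (\<lambda>p. cutoff_weight \<Gamma>1 s p + 1) ?vf < \<infinity>"
        by (rule wigner_to_midpoint_energy[OF f s \<Gamma>(1) \<Gamma>1(1) \<Gamma>(4)[OF s] C1])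
      have "midpoint_energy (cutoff_weight \<Gamma>2 s) ?vg
         \<le> K * K * C2 * (\<integral>\<^sup>+x. ennreal (japanese_bracket (x::'a \<times> 'a) powr (- 2 * real DIM('a \<times> 'a))) \<partial>lborel)\<^sup>2 * midpoint_energy (\<lambda>p. cutoff_weight (S ` \<Gamma>1) s (S p) + 1) ?vf"
        by (rule midpoint_energy_kernel[OF _ _ _ S(1) s K(2) C2(2)]) measurable
      also have "\<dots> \<le> K * K * C2 * (\<integral>\<^sup>+x. ennreal (japanese_bracket (x::'a \<times> 'a) powr (- 2 * real DIM('a \<times> 'a))) \<partial>lborel)\<^sup>2 * (c * midpoint_energy (\<lambda>p. cutoff_weight \<Gamma>1 s p + 1) ?vf)"
      proof (intro mult_left_mono midpoint_energy_mono)
        show "(\<lambda>p. cutoff_weight \<Gamma>1 s p + 1) \<in> borel_measurable borel"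
          using cutoff_weight_measurable[OF \<Gamma>1(1), of s] by (intro borel_measurable_add) auto
        show "?vf \<in> borel_measurable borel" by measurable
      qed (use c in auto)
      also have "\<dots> < \<infinity>"
        using e1 K(1) C2(1) c(1) japanese_bracket_integral[of "real DIM('a \<times> 'a)", where 'a="'a \<times> 'a"]
        by (simp add: ennreal_mult_less_top power2_eq_square del: DIM_prod)
      finally have "midpoint_energy (\<lambda>p. cutoff_weight \<Gamma>2 s p + 1) ?vg < \<infinity>"
        using midpoint_energy_stft_one_finite[OF g] L2_measurable[OF g] by (subst midpoint_energy_add) (auto simp: less_top)
      then show ?thesis
        by (rule midpoint_energy_to_wigner[OF g s \<Gamma>2(1) \<Gamma>3(1) _ C3])
    qed
    then have "X \<notin> WF_wigner g"
      using \<Gamma>3(1-3) unfolding WF_wigner_def cutoff_weight_set_integral by blast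
    then show False using X by simp
  qed
  then show "X \<in> S ` WF_wigner f" using Y by blast
qed

section \<open>Gaussian windows are Schwartz functions\<close>

text \<open>Complex polynomials in the coordinates. The inductive form gives closure under
  differentiation and polynomial growth by rule induction, and every derivative of a Gaussian is
  such a polynomial times the Gaussian.\<close>

inductive_set cpoly :: "('a::euclidean_space \<Rightarrow> complex) set" where
  const: "(\<lambda>_. c) \<in> cpoly"
| coord: "b \<in> Basis \<Longrightarrow> (\<lambda>x. complex_of_real (x \<bullet> b)) \<in> cpoly"
| add: "p \<in> cpoly \<Longrightarrow> q \<in> cpoly \<Longrightarrow> (\<lambda>x. p x + q x) \<in> cpoly"
| mult: "p \<in> cpoly \<Longrightarrow> q \<in> cpoly \<Longrightarrow> (\<lambda>x. p x * q x) \<in> cpoly"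

lemma cpoly_derivative:
  assumes "q \<in> cpoly"
  shows "\<exists>D. (\<forall>x. (q has_derivative D x) (at x)) \<and> (\<forall>v. (\<lambda>x. D x v) \<in> cpoly)"
  using assms
proof induction
  case (const c)
  show ?case by (rule exI[of _ "\<lambda>_ _. 0"]) (auto intro: cpoly.const)
next
  case (coord b)
  have "((\<lambda>x. complex_of_real (x \<bullet> b)) has_derivative (\<lambda>v. complex_of_real (v \<bullet> b))) (at x)" for x
    by (auto intro!: derivative_eq_intros)
  then show ?case by (intro exI[of _ "\<lambda>x v. complex_of_real (v \<bullet> b)"]) (auto intro: cpoly.const)
next
  case (add p q)
  then obtain D E where "\<And>x. (p has_derivative D x) (at x)" "\<And>v. (\<lambda>x. D x v) \<in> cpoly"
    "\<And>x. (q has_derivative E x) (at x)" "\<And>v. (\<lambda>x. E x v) \<in> cpoly" by blast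
  then show ?case by (intro exI[of _ "\<lambda>x v. D x v + E x v"]) (auto intro: has_derivative_add cpoly.add)
next
  case (mult p q)
  then obtain D E where "\<And>x. (p has_derivative D x) (at x)" "\<And>v. (\<lambda>x. D x v) \<in> cpoly"
    "\<And>x. (q has_derivative E x) (at x)" "\<And>v. (\<lambda>x. E x v) \<in> cpoly" by blast
  with mult(1,2) show ?case
    by (intro exI[of _ "\<lambda>x v. p x * E x v + D x v * q x"]) (auto intro!: has_derivative_mult cpoly.add cpoly.mult)
qed

lemma japanese_bracket_ge_norm: "norm x \<le> japanese_bracket x"
  unfolding japanese_bracket_def by (rule real_le_rsqrt) simp

lemma cpoly_growth:
  assumes "q \<in> cpoly"
  shows "\<exists>C\<ge>0. \<exists>m::nat. \<forall>x. cmod (q x) \<le> C * japanese_bracket x ^ m"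
  using assms
proof induction
  case (const c)
  show ?case by (rule exI[of _ "cmod c"], simp, rule exI[of _ 0]) simp
next
  case (coord b)
  have "cmod (complex_of_real (x \<bullet> b)) \<le> 1 * japanese_bracket x ^ 1" for x
    using Basis_le_norm[OF coord, of x] japanese_bracket_ge_norm[of x] by simp
  then have "\<forall>x. cmod (complex_of_real (x \<bullet> b)) \<le> 1 * japanese_bracket x ^ 1" by blast
  then show ?case using zero_le_one by blast
next
  case (add p q)
  then obtain C m D n where h: "C \<ge> 0" "\<And>x. cmod (p x) \<le> C * japanese_bracket x ^ m" 
    "D \<ge> 0" "\<And>x. cmod (q x) \<le> D * japanese_bracket x ^ n" by blast
  have "cmod (p x + q x) \<le> (C + D) * japanese_bracket x ^ max m n" for x
  proof -
    have "japanese_bracket x ^ m \<le> japanese_bracket x ^ max m n" "japanese_bracket x ^ n \<le> japanese_bracket x ^ max m n"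
      using japanese_bracket_ge1[of x] by (auto intro: power_increasing)
    then have "cmod (p x) \<le> C * japanese_bracket x ^ max m n" "cmod (q x) \<le> D * japanese_bracket x ^ max m n"
      using h by (meson mult_left_mono order_trans)+
    then show ?thesis using norm_triangle_ineq[of "p x" "q x"] by (simp add: distrib_right)
  qed
  then show ?case using h by (intro exI[of _ "C + D"]) auto
next
  case (mult p q)
  then obtain C m D n where h: "C \<ge> 0" "\<And>x. cmod (p x) \<le> C * japanese_bracket x ^ m" 
    "D \<ge> 0" "\<And>x. cmod (q x) \<le> D * japanese_bracket x ^ n" by blast
  have "cmod (p x * q x) \<le> (C * D) * japanese_bracket x ^ (m + n)" for x
  proof -
    have "cmod (p x * q x) \<le> (C * japanese_bracket x ^ m) * (D * japanese_bracket x ^ n)"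
      unfolding norm_mult using h japanese_bracket_ge1[of x] by (intro mult_mono) auto
    then show ?thesis by (simp add: power_add mult_ac)
  qed
  then show ?case using h by (intro exI[of _ "C * D"]) auto
qed

lemma japanese_bracket_power_exp:
  "\<exists>c\<ge>0. \<forall>x::'a::real_normed_vector. japanese_bracket x ^ m \<le> c * exp ((norm x)\<^sup>2)"
proof -
  have "japanese_bracket x ^ m \<le> max 1 (real m / 2) powr (real m / 2) * exp ((norm x)\<^sup>2)" for x :: 'a
    using gaussian_weight_bound[of "real m / 2" x] japanese_bracket_pos[of x] by (simp add: powr_realpow)
  then show ?thesis by (intro exI[of _ "max 1 (real m / 2) powr (real m / 2)"]) auto
qed

text \<open>A single crude majorant for all polynomials; it is still beaten by the Gaussians in use,
  whose rate is at least 2.\<close>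

lemma cpoly_exp_growth:
  assumes "q \<in> cpoly"
  shows "\<exists>c\<ge>0. \<forall>x. norm x ^ k * cmod (q x) \<le> c * exp ((norm x)\<^sup>2)"
proof -
  obtain C m where h: "C \<ge> 0" "\<And>x. cmod (q x) \<le> C * japanese_bracket x ^ m" using cpoly_growth[OF assms] by blast
  obtain c where c: "c \<ge> 0" "\<And>x::'a. japanese_bracket x ^ (k + m) \<le> c * exp ((norm x)\<^sup>2)"
    using japanese_bracket_power_exp[of "k + m", where 'a='a] by blast
  have "norm x ^ k * cmod (q x) \<le> (C * c) * exp ((norm x)\<^sup>2)" for x
  proof -
    have "norm x ^ k * cmod (q x) \<le> japanese_bracket x ^ k * (C * japanese_bracket x ^ m)"
      using h japanese_bracket_ge_norm[of x] japanese_bracket_ge1[of x] by (intro mult_mono power_mono) auto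
    also have "\<dots> = C * japanese_bracket x ^ (k + m)" by (simp add: power_add mult_ac)
    also have "\<dots> \<le> C * (c * exp ((norm x)\<^sup>2))" by (rule mult_left_mono[OF c(2) h(1)])
    finally show ?thesis by (simp add: mult_ac)
  qed
  then show ?thesis using h(1) c(1) by (intro exI[of _ "C * c"]) auto
qed

lemma has_derivative_cexp:
  fixes \<phi> :: "'a::real_normed_vector \<Rightarrow> complex"
  assumes "(\<phi> has_derivative D) (at y)"
  shows "((\<lambda>y. exp (\<phi> y)) has_derivative (\<lambda>v. exp (\<phi> y) * D v)) (at y)"
  using has_derivative_compose[OF assms has_field_derivative_imp_has_derivative[OF DERIV_exp]] .

lemma window_has_derivative:
  "(window z has_derivative (\<lambda>v. window z y * (complex_of_real (- 2 * pi * ((y - fst z) \<bullet> v)) + \<i> * complex_of_real (2 * pi * (v \<bullet> snd z))))) (at y)"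
proof -
  have w: "window z = (\<lambda>y. exp (complex_of_real (- pi * ((y - fst z) \<bullet> (y - fst z))) + \<i> * complex_of_real (2 * pi * (y \<bullet> snd z))))"
    unfolding window_def exp_add cis_conv_exp by (simp only: exp_of_real power2_norm_eq_inner)
  have a1: "((\<lambda>y. - pi * ((y - fst z) \<bullet> (y - fst z))) has_derivative (\<lambda>v. - 2 * pi * ((y - fst z) \<bullet> v))) (at y)"
    by (auto intro!: derivative_eq_intros simp: inner_commute[of _ "y - fst z"] mult.commute)
  have a2: "((\<lambda>y. 2 * pi * (y \<bullet> snd z)) has_derivative (\<lambda>v. 2 * pi * (v \<bullet> snd z))) (at y)"
    by (auto intro!: derivative_eq_intros)
  show ?thesis unfolding w
    by (rule has_derivative_cexp[OF has_derivative_add[OF has_derivative_of_real[OF a1] has_derivative_mult_right[OF has_derivative_of_real[OF a2]]]])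
qed

lemma window_factor_cpoly:
  assumes "b \<in> Basis"
  shows "(\<lambda>y. complex_of_real (- 2 * pi * ((y - fst z) \<bullet> b)) + \<i> * complex_of_real (2 * pi * (b \<bullet> snd z))) \<in> cpoly"
proof -
  have "(\<lambda>y. complex_of_real (- 2 * pi) * complex_of_real (y \<bullet> b) + (complex_of_real (2 * pi * (fst z \<bullet> b)) + \<i> * complex_of_real (2 * pi * (b \<bullet> snd z)))) \<in> cpoly"
    using assms by (intro cpoly.intros)
  then show ?thesis by (simp add: inner_diff_left algebra_simps)
qed

lemma iter_partial_cpoly_window:
  assumes "bs \<in> lists Basis"
  shows "\<exists>q\<in>cpoly. iter_partial bs (window z) = (\<lambda>y. q y * window z y)"
  using assms
proof (induction bs)
  case Nil
  show ?case using cpoly.const[of 1] by force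
next
  case (Cons b bs)
  then obtain q where q: "q \<in> cpoly" "iter_partial bs (window z) = (\<lambda>y. q y * window z y)" by auto
  have b: "b \<in> Basis" using Cons by auto
  obtain D where D: "\<And>x. (q has_derivative D x) (at x)" "\<And>v. (\<lambda>x. D x v) \<in> cpoly"
    using cpoly_derivative[OF q(1)] by blast
  let ?L = "\<lambda>y v. complex_of_real (- 2 * pi * ((y - fst z) \<bullet> v)) + \<i> * complex_of_real (2 * pi * (v \<bullet> snd z))"
  have "((\<lambda>y. q y * window z y) has_derivative (\<lambda>v. q y * (window z y * ?L y v) + D y v * window z y)) (at y)" for y
    by (rule has_derivative_mult[OF D(1) window_has_derivative])
  from frechet_derivative_at[OF this]
  have fd: "frechet_derivative (\<lambda>y. q y * window z y) (at y) b = q y * (window z y * ?L y b) + D y b * window z y" for y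
    by (rule fun_cong[OF sym])
  have alg: "c * (w * l) + d * w = (c * l + d) * w" for c w l d :: complex by (simp add: algebra_simps)
  have eq: "iter_partial (b # bs) (window z) = (\<lambda>y. (q y * ?L y b + D y b) * window z y)"
    unfolding iter_partial.simps q(2) fd alg ..
  have mem: "(\<lambda>y. q y * ?L y b + D y b) \<in> cpoly"
    by (intro cpoly.add cpoly.mult q(1) D(2) window_factor_cpoly b)
  show ?case using eq mem by (intro bexI[of _ "\<lambda>y. q y * ?L y b + D y b"])
qed

text \<open>This is the entry point to the operator, whose integral formula is prescribed on
  Schwartz functions only.\<close>

lemma window_schwartz: "window z \<in> schwartz"
proof -
  have d: "(\<lambda>y. q y * window z y) differentiable (at x)" if "q \<in> cpoly" for q x
  proof -
    obtain D where "\<And>x. (q has_derivative D x) (at x)" using cpoly_derivative[OF \<open>q \<in> cpoly\<close>] by blast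
    from has_derivative_mult[OF this window_has_derivative] show ?thesis by (rule differentiableI)
  qed
  have "smooth (window z)" unfolding smooth_def
  proof (intro ballI allI)
    fix bs x assume "bs \<in> lists (Basis :: 'a set)"
    then obtain q where "q \<in> cpoly" "iter_partial bs (window z) = (\<lambda>y. q y * window z y)"
      using iter_partial_cpoly_window by blast
    then show "iter_partial bs (window z) differentiable (at x)" using d by simp
  qed
  moreover have "bounded (range (\<lambda>x. norm x ^ k *\<^sub>R iter_partial bs (window z) x))" if bs: "bs \<in> lists Basis" for bs k
  proof -
    obtain q where q: "q \<in> cpoly" "iter_partial bs (window z) = (\<lambda>y. q y * window z y)"
      using iter_partial_cpoly_window[OF bs] by blast
    obtain c where c: "c \<ge> 0" "\<And>x. norm x ^ k * cmod (q x) \<le> c * exp ((norm x)\<^sup>2)"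
      using cpoly_exp_growth[OF q(1)] by blast
    have "norm (norm x ^ k *\<^sub>R iter_partial bs (window z) x) \<le> c * exp (2 * (norm (fst z))\<^sup>2)" for x
    proof -
      have "norm x \<le> norm (x - fst z) + norm (fst z)" using norm_triangle_ineq[of "x - fst z" "fst z"] by simp
      then have "(norm x)\<^sup>2 \<le> (norm (x - fst z) + norm (fst z))\<^sup>2" by (intro power_mono) auto
      also have "\<dots> \<le> 2 * (norm (x - fst z))\<^sup>2 + 2 * (norm (fst z))\<^sup>2"
        using sum_squares_bound[of "norm (x - fst z)" "norm (fst z)"] by (simp add: power2_sum)
      \<comment> \<open>Since pi exceeds 2, the growth left after recentring at \<open>fst z\<close>
        is absorbed by the window.\<close>
      also have "2 * (norm (x - fst z))\<^sup>2 \<le> pi * (norm (x - fst z))\<^sup>2" using pi_gt3 by (intro mult_right_mono) auto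
      finally have e: "(norm x)\<^sup>2 + - pi * (norm (x - fst z))\<^sup>2 \<le> 2 * (norm (fst z))\<^sup>2" by simp
      have "norm (norm x ^ k *\<^sub>R iter_partial bs (window z) x) = norm x ^ k * cmod (q x) * exp (- pi * (norm (x - fst z))\<^sup>2)"
        by (simp add: q(2) norm_mult cmod_window)
      also have "\<dots> \<le> c * exp ((norm x)\<^sup>2) * exp (- pi * (norm (x - fst z))\<^sup>2)"
        by (rule mult_right_mono[OF c(2)]) simp
      also have "\<dots> = c * exp ((norm x)\<^sup>2 + - pi * (norm (x - fst z))\<^sup>2)" by (simp only: exp_add mult.assoc)
      also have "\<dots> \<le> c * exp (2 * (norm (fst z))\<^sup>2)" using e c(1) by (intro mult_left_mono) auto
      finally show ?thesis .
    qed
    then show ?thesis by (intro boundedI) auto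
  qed
  ultimately show ?thesis by (simp add: schwartz_def)
qed

section \<open>Oscillatory integrals\<close>

text \<open>Supplies one integrable majorant for a Gaussian along all unit directions and steps of
  length at most 1, at the cost of half the rate.\<close>

lemma gaussian_segment_bound:
  fixes u e :: "'a::real_normed_vector"
  assumes "norm e = 1" "\<bar>s\<bar> \<le> 1"
  shows "exp (- (norm (u + s *\<^sub>R e))\<^sup>2) \<le> exp 1 * exp (- (1/2) * (norm u)\<^sup>2)"
proof -
  have "norm u \<le> norm (u + s *\<^sub>R e) + norm (s *\<^sub>R e)"
    using norm_triangle_ineq4[of "u + s *\<^sub>R e" "s *\<^sub>R e"] by simp
  also have "norm (s *\<^sub>R e) \<le> 1" using assms by simp
  finally have "norm u \<le> norm (u + s *\<^sub>R e) + 1" by simp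
  then have "(norm u)\<^sup>2 \<le> (norm (u + s *\<^sub>R e) + 1)\<^sup>2" by (intro power_mono) auto
  also have "\<dots> \<le> 2 * (norm (u + s *\<^sub>R e))\<^sup>2 + 2"
    using sum_squares_bound[of "norm (u + s *\<^sub>R e)" 1] by (simp add: power2_sum)
  finally have "- (norm (u + s *\<^sub>R e))\<^sup>2 \<le> 1 + - (1/2) * (norm u)\<^sup>2" by simp
  then show ?thesis unfolding exp_add[symmetric] by simp
qed

text \<open>Difference quotients have integral 0 by translation invariance. They converge to the
  derivative, and the mean value inequality along the segment dominates them by a Gaussian.\<close>

lemma integral_directional_derivative:
  fixes \<psi> :: "'a::euclidean_space \<Rightarrow> complex"
  assumes der: "\<And>u. (\<psi> has_derivative D u) (at u)" and int: "integrable lborel \<psi>"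
    and bnd: "\<And>u. cmod (D u e) \<le> C * exp (- (norm u)\<^sup>2)" and e: "norm e = 1"
  shows "integrable lborel (\<lambda>u. D u e)" and "(LINT u|lborel. D u e) = 0"
proof -
  have [measurable]: "\<psi> \<in> borel_measurable borel" using int by auto
  define t where "t n = 1 / real (Suc n)" for n
  have t: "t n > 0" "t n \<le> 1" for n by (auto simp: t_def)
  have tl: "t \<longlonglongrightarrow> 0" unfolding t_def using LIMSEQ_inverse_real_of_nat by (simp add: inverse_eq_divide)
  have C0: "C \<ge> 0" using order_trans[OF norm_ge_zero bnd[of 0]] by simp
  define q where "q n u = (\<psi> (u + t n *\<^sub>R e) - \<psi> u) /\<^sub>R t n" for n u
  have line: "((\<lambda>s. \<psi> (u + s *\<^sub>R e)) has_derivative (\<lambda>h. D (u + s *\<^sub>R e) (h *\<^sub>R e))) (at s within A)" for u s A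
  proof -
    have "((\<lambda>s. u + s *\<^sub>R e) has_derivative (\<lambda>h. h *\<^sub>R e)) (at s within A)"
      by (auto intro!: derivative_eq_intros)
    from has_derivative_compose[OF this der] show ?thesis .
  qed
  have Dlin: "D u (h *\<^sub>R e) = h *\<^sub>R D u e" for u h
    using linear_cmul[OF has_derivative_linear[OF der]] .
  have lim: "(\<lambda>n. q n u) \<longlonglongrightarrow> D u e" for u
  proof -
    have "((\<lambda>s. \<psi> (u + s *\<^sub>R e)) has_vector_derivative D u e) (at 0)"
      using line[of u 0 UNIV] unfolding has_vector_derivative_def Dlin by simp
    then have l: "((\<lambda>h. cmod (\<psi> (u + h *\<^sub>R e) - \<psi> u - h *\<^sub>R D u e) / \<bar>h\<bar>) \<longlongrightarrow> 0) (at 0)"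
      unfolding has_vector_derivative_def has_derivative_at by simp
    have "((\<lambda>h. cmod ((\<psi> (u + h *\<^sub>R e) - \<psi> u) /\<^sub>R h - D u e)) \<longlongrightarrow> 0) (at 0)"
    proof (rule Lim_transform_eventually[OF l])
      have "cmod (Z - h *\<^sub>R D u e) / \<bar>h\<bar> = cmod (Z /\<^sub>R h - D u e)" if "h \<noteq> 0" for h :: real and Z
      proof -
        have "Z /\<^sub>R h - D u e = (Z - h *\<^sub>R D u e) /\<^sub>R h" using that by (simp add: scaleR_diff_right)
        then show ?thesis using that by (simp add: divide_inverse mult.commute)
      qed
      then show "eventually (\<lambda>h. cmod (\<psi> (u + h *\<^sub>R e) - \<psi> u - h *\<^sub>R D u e) / \<bar>h\<bar> = cmod ((\<psi> (u + h *\<^sub>R e) - \<psi> u) /\<^sub>R h - D u e)) (at 0)"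
        by (simp add: eventually_at_filter)
    qed
    then have "((\<lambda>h. (\<psi> (u + h *\<^sub>R e) - \<psi> u) /\<^sub>R h - D u e) \<longlongrightarrow> 0) (at 0)"
      by (rule tendsto_norm_zero_cancel)
    then have "((\<lambda>h. (\<psi> (u + h *\<^sub>R e) - \<psi> u) /\<^sub>R h) \<longlongrightarrow> D u e) (at 0)"
      by (rule LIM_zero_cancel)
    then show ?thesis unfolding q_def
      by (rule filterlim_compose) (use tl t in \<open>auto simp: filterlim_at less_imp_neq[symmetric]\<close>)
  qed
  have dom: "cmod (q n u) \<le> C * exp 1 * exp (- (1/2) * (norm u)\<^sup>2)" for n u
  proof -
    have "cmod (\<psi> (u + t n *\<^sub>R e) - \<psi> (u + 0 *\<^sub>R e)) \<le> (C * exp 1 * exp (- (1/2) * (norm u)\<^sup>2)) * norm (t n - 0)"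
    proof (rule differentiable_bound[of "{0..1}"])
      fix s :: real assume s: "s \<in> {0..1}"
      show "((\<lambda>s. \<psi> (u + s *\<^sub>R e)) has_derivative (\<lambda>h. D (u + s *\<^sub>R e) (h *\<^sub>R e))) (at s within {0..1})" by (rule line)
      have "cmod (D (u + s *\<^sub>R e) e) \<le> C * exp (- (norm (u + s *\<^sub>R e))\<^sup>2)" by (rule bnd)
      also have "\<dots> \<le> C * (exp 1 * exp (- (1/2) * (norm u)\<^sup>2))"
        using s e C0 by (intro mult_left_mono gaussian_segment_bound) auto
      finally have b: "cmod (D (u + s *\<^sub>R e) e) \<le> C * exp 1 * exp (- (1/2) * (norm u)\<^sup>2)" by (simp add: mult_ac)
      show "onorm (\<lambda>h. D (u + s *\<^sub>R e) (h *\<^sub>R e)) \<le> C * exp 1 * exp (- (1/2) * (norm u)\<^sup>2)"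
        unfolding Dlin
      proof (rule onorm_bound)
        fix h show "norm (h *\<^sub>R D (u + s *\<^sub>R e) e) \<le> C * exp 1 * exp (- (1/2) * (norm u)\<^sup>2) * norm h"
          using mult_right_mono[OF b, of "\<bar>h\<bar>"] unfolding norm_scaleR real_norm_def by (simp only: mult.commute)
      qed (use C0 in simp)
    qed (use t in \<open>auto simp: less_imp_le\<close>)
    then have "cmod (\<psi> (u + t n *\<^sub>R e) - \<psi> u) \<le> (C * exp 1 * exp (- (1/2) * (norm u)\<^sup>2)) * t n"
      using t(1)[of n] by simp
    then show ?thesis using t(1)[of n] unfolding q_def norm_scaleR
      by (simp add: field_simps)
  qed
  have gi: "integrable lborel (\<lambda>u::'a. C * exp 1 * exp (- (1/2) * (norm u)\<^sup>2))"
    using gaussian_integral(1)[of "1/2", where 'a='a] by (intro integrable_mult_right) simp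
  have qm: "q n \<in> borel_measurable lborel" for n unfolding q_def[abs_def] by measurable
  have Dm: "(\<lambda>u. D u e) \<in> borel_measurable lborel"
    by (rule borel_measurable_LIMSEQ_metric[OF qm lim])
  have lims: "AE u in lborel. (\<lambda>n. q n u) \<longlonglongrightarrow> D u e" by (rule AE_I2[OF lim])
  have doms: "AE u in lborel. cmod (q n u) \<le> C * exp 1 * exp (- (1/2) * (norm u)\<^sup>2)" for n by (rule AE_I2[OF dom])
  show "integrable lborel (\<lambda>u. D u e)"
    by (rule integrable_dominated_convergence[OF Dm qm gi lims doms])
  have "(\<lambda>n. LINT u|lborel. q n u) \<longlonglongrightarrow> (LINT u|lborel. D u e)"
    by (rule integral_dominated_convergence[OF Dm qm gi lims doms])
  moreover have "(LINT u|lborel. q n u) = 0" for n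
    unfolding q_def using int integrable_translate[OF int, of "t n *\<^sub>R e"] integral_translate[of \<psi> "t n *\<^sub>R e"] by simp
  ultimately show "(LINT u|lborel. D u e) = 0" using LIMSEQ_unique[OF _ tendsto_const] by fastforce
qed

section \<open>Stability properties of the symbol class\<close>

lemma iter_partial_append: "iter_partial bs (iter_partial [e] a) = iter_partial (bs @ [e]) a"
  by (induction bs) auto

text \<open>The last entry of the list is differentiated first, so deriving a derivative of
  \<open>a\<close> means appending a direction, and the conditions on \<open>a\<close> already cover
  the longer list.\<close>

lemma symbol_S00_derivative:
  assumes "a \<in> symbol_S00" "e \<in> Basis"
  shows "iter_partial [e] a \<in> symbol_S00"
  using assms unfolding symbol_S00_def smooth_def mem_Collect_eq iter_partial_append by simp

lemma symbol_S00_has_derivative: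
  assumes "a \<in> symbol_S00"
  shows "(a has_derivative frechet_derivative a (at u)) (at u)"
proof -
  have "iter_partial [] a differentiable (at u)" using assms unfolding symbol_S00_def smooth_def by blast
  then show ?thesis by (simp add: frechet_derivative_works)
qed

lemma symbol_S00_bounded:
  assumes "a \<in> symbol_S00"
  obtains M where "M \<ge> 0" "\<And>u. cmod (a u) \<le> M"
proof -
  have "bounded (range (iter_partial [] a))" using assms unfolding symbol_S00_def by blast
  then obtain M where M: "\<And>u. cmod (a u) \<le> M" by (auto simp: bounded_iff)
  have "M \<ge> 0" by (rule order_trans[OF norm_ge_zero M])
  then show ?thesis using M that by blast
qed

text \<open>\<open>L\<close> is the logarithmic derivative of \<open>G\<close>. Polynomial
  \<open>L\<close> keeps the class of polynomials times \<open>G\<close> stable under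
  differentiation, and the rate 2 in the bound leaves rate 1 after a polynomial has been
  absorbed.\<close>

locale gaussian_amplitude =
  fixes G :: "'b::euclidean_space \<Rightarrow> complex" and L :: "'b \<Rightarrow> 'b \<Rightarrow> complex"
  assumes G_derivative: "(G has_derivative (\<lambda>v. G u * L u v)) (at u)"
    and L_cpoly: "e \<in> Basis \<Longrightarrow> (\<lambda>u. L u e) \<in> cpoly"
    and G_bound: "cmod (G u) \<le> exp (- 2 * (norm u)\<^sup>2)"
begin

text \<open>\<open>T\<close> recentres the symbol, and bounds must be uniform in it; they are,
  because the symbol enters only through suprema over the whole space. The polynomial
  \<open>q\<close> records what integrations by parts have produced.\<close>

definition amp :: "('b \<Rightarrow> complex) \<Rightarrow> ('b \<Rightarrow> complex) \<Rightarrow> 'b \<Rightarrow> 'b \<Rightarrow> complex"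
  where "amp a q T u = a (u + T) * (q u * G u)"

definition osc :: "('b \<Rightarrow> complex) \<Rightarrow> ('b \<Rightarrow> complex) \<Rightarrow> 'b \<Rightarrow> 'b \<Rightarrow> complex"
  where "osc a q T \<theta> = (LINT u|lborel. cis (2 * pi * (u \<bullet> \<theta>)) * amp a q T u)"

lemma amp_bound:
  assumes "a \<in> symbol_S00" "q \<in> cpoly"
  shows "\<exists>c\<ge>0. \<forall>T u. cmod (amp a q T u) \<le> c * exp (- (norm u)\<^sup>2)"
proof -
  obtain M where M: "M \<ge> 0" "\<And>u. cmod (a u) \<le> M" using symbol_S00_bounded[OF assms(1)] by blast
  obtain c where c: "c \<ge> 0" "\<And>x. norm x ^ 0 * cmod (q x) \<le> c * exp ((norm x)\<^sup>2)"
    using cpoly_exp_growth[OF assms(2), of 0] by blast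
  have "cmod (amp a q T u) \<le> (M * c) * exp (- (norm u)\<^sup>2)" for T u
  proof -
    have "cmod (amp a q T u) \<le> M * ((c * exp ((norm u)\<^sup>2)) * exp (- 2 * (norm u)\<^sup>2))"
      unfolding amp_def norm_mult using M c(1) c(2)[of u] G_bound[of u] by (intro mult_mono) auto
    also have "\<dots> = M * (c * exp ((norm u)\<^sup>2 + - 2 * (norm u)\<^sup>2))" by (simp only: exp_add mult.assoc)
    also have "(norm u)\<^sup>2 + - 2 * (norm u)\<^sup>2 = - (norm u)\<^sup>2" by simp
    finally show ?thesis by (simp only: mult.assoc)
  qed
  then show ?thesis using M(1) c(1) by (intro exI[of _ "M * c"]) auto
qed

lemma cis_linear_derivative:
  fixes \<theta> :: 'b
  shows "((\<lambda>u. cis (2 * pi * (u \<bullet> \<theta>))) has_derivative (\<lambda>v. cis (2 * pi * (u \<bullet> \<theta>)) * (\<i> * complex_of_real (2 * pi * (v \<bullet> \<theta>))))) (at u)"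
proof -
  have a: "((\<lambda>u. 2 * pi * (u \<bullet> \<theta>)) has_derivative (\<lambda>v. 2 * pi * (v \<bullet> \<theta>))) (at u)"
    by (auto intro!: derivative_eq_intros)
  show ?thesis unfolding cis_conv_exp
    by (rule has_derivative_cexp[OF has_derivative_mult_right[OF has_derivative_of_real[OF a]]])
qed

lemma amp_derivative:
  assumes a: "a \<in> symbol_S00" and q: "\<And>u. (q has_derivative Dq u) (at u)"
  shows "(amp a q T has_derivative (\<lambda>v. a (u + T) * (q u * (G u * L u v) + Dq u v * G u) + frechet_derivative a (at (u + T)) v * (q u * G u))) (at u)"
proof -
  have "((\<lambda>u. u + T) has_derivative (\<lambda>v. v)) (at u)" by (auto intro!: derivative_eq_intros)
  from has_derivative_compose[OF this symbol_S00_has_derivative[OF a]]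
  have 1: "((\<lambda>u. a (u + T)) has_derivative (\<lambda>v. frechet_derivative a (at (u + T)) v)) (at u)" .
  show ?thesis unfolding amp_def[abs_def]
    by (rule has_derivative_mult[OF 1 has_derivative_mult[OF q G_derivative]])
qed

lemma amp_integrable:
  assumes a: "a \<in> symbol_S00" and q: "q \<in> cpoly"
  shows "integrable lborel (amp a q T)"
proof -
  obtain c where c: "c \<ge> 0" "\<And>T u. cmod (amp a q T u) \<le> c * exp (- (norm u)\<^sup>2)" using amp_bound[OF assms] by blast
  obtain Dq where D: "\<And>u. (q has_derivative Dq u) (at u)" using cpoly_derivative[OF q] by blast
  have "isCont (amp a q T) u" for u by (rule has_derivative_continuous[OF amp_derivative[OF a D]])
  then have "continuous_on UNIV (amp a q T)" by (simp add: continuous_at_imp_continuous_on)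
  then have m: "amp a q T \<in> borel_measurable lborel" by (simp add: borel_measurable_continuous_onI)
  have "integrable lborel (\<lambda>u::'b. c * exp (- (norm u)\<^sup>2))"
    using gaussian_integral(1)[of 1, where 'a='b] by (intro integrable_mult_right) simp
  then show ?thesis
    by (rule Bochner_Integration.integrable_bound[OF _ m]) (use c in \<open>auto intro!: AE_I2\<close>)
qed

text \<open>One integration by parts in direction \<open>e\<close>. The three terms arise as the
  derivative falls on the symbol, on the polynomial, or on the Gaussian, and each is again an
  integral of the same type.\<close>

lemma osc_step:
  assumes a: "a \<in> symbol_S00" and q: "q \<in> cpoly" and e: "e \<in> Basis" and D: "\<And>u. (q has_derivative Dq u) (at u)" "(\<lambda>u. Dq u e) \<in> cpoly"
  shows "\<bar>\<theta> \<bullet> e\<bar> * cmod (osc a q T \<theta>) \<le> cmod (osc (iter_partial [e] a) q T \<theta>) + cmod (osc a (\<lambda>u. Dq u e) T \<theta>) + cmod (osc a (\<lambda>u. q u * L u e) T \<theta>)"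
proof -
  let ?c = "\<lambda>u. cis (2 * pi * (u \<bullet> \<theta>))"
  let ?a' = "iter_partial [e] a"
  let ?l = "\<i> * complex_of_real (2 * pi * (e \<bullet> \<theta>))"
  let ?DA = "\<lambda>u v. a (u + T) * (q u * (G u * L u v) + Dq u v * G u) + frechet_derivative a (at (u + T)) v * (q u * G u)"
  let ?D = "\<lambda>u v. ?c u * ?DA u v + ?c u * (\<i> * complex_of_real (2 * pi * (v \<bullet> \<theta>))) * amp a q T u"
  have a': "?a' \<in> symbol_S00" by (rule symbol_S00_derivative[OF a e])
  have qL: "(\<lambda>u. q u * L u e) \<in> cpoly" by (intro cpoly.mult q L_cpoly e)
  have der: "((\<lambda>u. ?c u * amp a q T u) has_derivative ?D u) (at u)" for u
    by (rule has_derivative_mult[OF cis_linear_derivative amp_derivative[OF a D(1)]])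
  have DA: "?DA u e = amp ?a' q T u + amp a (\<lambda>u. Dq u e) T u + amp a (\<lambda>u. q u * L u e) T u" for u
    by (simp add: amp_def algebra_simps)
  have ci: "integrable lborel (\<lambda>u. ?c u * amp b p T u)" if "b \<in> symbol_S00" "p \<in> cpoly" for b p
    by (rule integrable_cis_mult[OF amp_integrable[OF that]]) measurable
  obtain c0 where c0: "c0 \<ge> 0" "\<And>T u. cmod (amp a q T u) \<le> c0 * exp (- (norm u)\<^sup>2)" using amp_bound[OF a q] by blast
  obtain c1 where c1: "c1 \<ge> 0" "\<And>T u. cmod (amp ?a' q T u) \<le> c1 * exp (- (norm u)\<^sup>2)" using amp_bound[OF a' q] by blast
  obtain c2 where c2: "c2 \<ge> 0" "\<And>T u. cmod (amp a (\<lambda>u. Dq u e) T u) \<le> c2 * exp (- (norm u)\<^sup>2)" using amp_bound[OF a D(2)] by blast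
  obtain c3 where c3: "c3 \<ge> 0" "\<And>T u. cmod (amp a (\<lambda>u. q u * L u e) T u) \<le> c3 * exp (- (norm u)\<^sup>2)" using amp_bound[OF a qL] by blast
  have bnd: "cmod (?D u e) \<le> (c1 + c2 + c3 + cmod ?l * c0) * exp (- (norm u)\<^sup>2)" for u
  proof -
    have "cmod (?D u e) \<le> cmod (amp ?a' q T u) + cmod (amp a (\<lambda>u. Dq u e) T u) + cmod (amp a (\<lambda>u. q u * L u e) T u) + cmod ?l * cmod (amp a q T u)"
      unfolding DA by (intro norm_triangle_mono order_refl | simp only: norm_mult norm_cis mult_1)+
    also have "\<dots> \<le> c1 * exp (- (norm u)\<^sup>2) + c2 * exp (- (norm u)\<^sup>2) + c3 * exp (- (norm u)\<^sup>2) + cmod ?l * (c0 * exp (- (norm u)\<^sup>2))"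
      by (intro add_mono mult_left_mono c0 c1 c2 c3) auto
    finally show ?thesis by (simp only: distrib_right mult.assoc)
  qed
  have z: "(LINT u|lborel. ?D u e) = 0"
    by (rule integral_directional_derivative(2)[where D = ?D and e = e, OF der ci[OF a q] bnd]) (use e in simp)
  have De: "?D u e = ?c u * amp ?a' q T u + ?c u * amp a (\<lambda>u. Dq u e) T u + ?c u * amp a (\<lambda>u. q u * L u e) T u + ?l * (?c u * amp a q T u)" for u
    unfolding DA by (simp only: distrib_left mult_ac)
  have lin: "(LINT u|lborel. f1 u + f2 u + f3 u + c * f4 u) = (LINT u|lborel. f1 u) + (LINT u|lborel. f2 u) + (LINT u|lborel. f3 u) + c * (LINT u|lborel. f4 u)"
    if "integrable lborel f1" "integrable lborel f2" "integrable lborel f3" "integrable lborel f4"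
    for f1 f2 f3 f4 :: "'b \<Rightarrow> complex" and c using that by simp
  have "osc ?a' q T \<theta> + osc a (\<lambda>u. Dq u e) T \<theta> + osc a (\<lambda>u. q u * L u e) T \<theta> + ?l * osc a q T \<theta> = 0"
    unfolding osc_def lin[OF ci[OF a' q] ci[OF a D(2)] ci[OF a qL] ci[OF a q], symmetric] De[symmetric] by (rule z)
  then have "?l * osc a q T \<theta> = - (osc ?a' q T \<theta> + osc a (\<lambda>u. Dq u e) T \<theta> + osc a (\<lambda>u. q u * L u e) T \<theta>)"
    by (rule minus_unique[symmetric])
  then have "cmod (?l * osc a q T \<theta>) \<le> cmod (osc ?a' q T \<theta>) + cmod (osc a (\<lambda>u. Dq u e) T \<theta>) + cmod (osc a (\<lambda>u. q u * L u e) T \<theta>)"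
    by (simp only: norm_minus_cancel) (intro norm_triangle_mono order_refl)
  moreover have "\<bar>\<theta> \<bullet> e\<bar> * cmod (osc a q T \<theta>) \<le> cmod (?l * osc a q T \<theta>)"
  proof -
    \<comment> \<open>The factor 2 pi gained by differentiating the phase is simply
      discarded.\<close>
    have "1 * \<bar>\<theta> \<bullet> e\<bar> \<le> (2 * pi) * \<bar>\<theta> \<bullet> e\<bar>" using pi_gt3 by (intro mult_right_mono) auto
    also have "\<dots> = cmod ?l" by (simp add: norm_mult abs_mult inner_commute)
    finally show ?thesis unfolding norm_mult[of ?l] by (intro mult_right_mono) auto
  qed
  ultimately show ?thesis by linarith
qed

text \<open>Iterated integration by parts. Symbol and polynomial have to be arbitrary in the
  induction because a step changes both.\<close>

lemma osc_decay_direction: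
  assumes "a \<in> symbol_S00" "q \<in> cpoly" and e: "e \<in> Basis"
  shows "\<exists>C. \<forall>T \<theta>. \<bar>\<theta> \<bullet> e\<bar> ^ N * cmod (osc a q T \<theta>) \<le> C"
  using assms(1,2)
proof (induction N arbitrary: a q)
  case 0
  obtain c where c: "c \<ge> 0" "\<And>T u. cmod (amp a q T u) \<le> c * exp (- (norm u)\<^sup>2)" using amp_bound[OF 0] by blast
  have gi: "integrable lborel (\<lambda>u::'b. c * exp (- (norm u)\<^sup>2))"
    using gaussian_integral(1)[of 1, where 'a='b] by (intro integrable_mult_right) simp
  have "cmod (osc a q T \<theta>) \<le> (LINT u|lborel. c * exp (- (norm (u::'b))\<^sup>2))" for T \<theta>
  proof -
    have "cmod (osc a q T \<theta>) \<le> (LINT u|lborel. cmod (amp a q T u))"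
      unfolding osc_def by (rule order_trans[OF integral_norm_bound]) (simp add: norm_mult)
    also have "\<dots> \<le> (LINT u|lborel. c * exp (- (norm (u::'b))\<^sup>2))"
      using amp_integrable[OF 0, of T] gi c(2) by (intro integral_mono) auto
    finally show ?thesis .
  qed
  then show ?case by (intro exI[of _ "LINT u|lborel. c * exp (- (norm (u::'b))\<^sup>2)"]) simp
next
  case (Suc N)
  obtain Dq where D: "\<And>u. (q has_derivative Dq u) (at u)" "\<And>v. (\<lambda>u. Dq u v) \<in> cpoly"
    using cpoly_derivative[OF Suc.prems(2)] by blast
  have qL: "(\<lambda>u. q u * L u e) \<in> cpoly" by (intro cpoly.mult Suc.prems L_cpoly e)
  obtain C1 where C1: "\<And>T \<theta>. \<bar>\<theta> \<bullet> e\<bar> ^ N * cmod (osc (iter_partial [e] a) q T \<theta>) \<le> C1"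
    using Suc.IH[OF symbol_S00_derivative[OF Suc.prems(1) e] Suc.prems(2)] by blast
  obtain C2 where C2: "\<And>T \<theta>. \<bar>\<theta> \<bullet> e\<bar> ^ N * cmod (osc a (\<lambda>u. Dq u e) T \<theta>) \<le> C2"
    using Suc.IH[OF Suc.prems(1) D(2)[of e]] by blast
  obtain C3 where C3: "\<And>T \<theta>. \<bar>\<theta> \<bullet> e\<bar> ^ N * cmod (osc a (\<lambda>u. q u * L u e) T \<theta>) \<le> C3"
    using Suc.IH[OF Suc.prems(1) qL] by blast
  have "\<bar>\<theta> \<bullet> e\<bar> ^ Suc N * cmod (osc a q T \<theta>) \<le> C1 + C2 + C3" for T \<theta>
  proof -
    have "\<bar>\<theta> \<bullet> e\<bar> ^ N * (\<bar>\<theta> \<bullet> e\<bar> * cmod (osc a q T \<theta>)) \<le> \<bar>\<theta> \<bullet> e\<bar> ^ N * (cmod (osc (iter_partial [e] a) q T \<theta>) + cmod (osc a (\<lambda>u. Dq u e) T \<theta>) + cmod (osc a (\<lambda>u. q u * L u e) T \<theta>))"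
      by (rule mult_left_mono[OF osc_step[OF Suc.prems e D]]) simp
    also have "\<dots> \<le> C1 + C2 + C3"
      unfolding distrib_left by (intro add_mono C1 C2 C3)
    finally show ?thesis by (simp add: mult_ac)
  qed
  then show ?case by blast
qed

text \<open>The bracket is at most 1 plus the sum of the coordinates, hence at most 1 +
  \<open>DIM('b)\<close> times the largest of 1 and the coordinates; the power of that maximum is
  one of the summands on the right.\<close>

lemma power_norm_bound:
  fixes \<theta> :: 'b
  shows "japanese_bracket \<theta> ^ N \<le> (1 + real DIM('b)) ^ N * (1 + (\<Sum>e\<in>Basis. \<bar>\<theta> \<bullet> e\<bar> ^ N))"
proof -
  let ?S = "insert 1 ((\<lambda>e. \<bar>\<theta> \<bullet> e\<bar>) ` Basis)"
  define M where "M = Max ?S"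
  have fin: "finite ?S" by simp
  have M1: "1 \<le> M" unfolding M_def using fin by (intro Max_ge) auto
  have Me: "\<bar>\<theta> \<bullet> e\<bar> \<le> M" if "e \<in> Basis" for e unfolding M_def using fin that by (intro Max_ge) auto
  have "japanese_bracket \<theta> \<le> 1 + norm \<theta>"
    unfolding japanese_bracket_def by (rule real_le_lsqrt) (auto simp: power2_sum)
  also have "norm \<theta> \<le> (\<Sum>e\<in>Basis. \<bar>\<theta> \<bullet> e\<bar>)" by (rule norm_le_l1)
  also have "(\<Sum>e\<in>Basis. \<bar>\<theta> \<bullet> e\<bar>) \<le> (\<Sum>e\<in>(Basis::'b set). M)" by (intro sum_mono Me)
  finally have "japanese_bracket \<theta> \<le> (1 + real DIM('b)) * M" using M1 by (simp add: distrib_right)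
  then have "japanese_bracket \<theta> ^ N \<le> ((1 + real DIM('b)) * M) ^ N"
    using japanese_bracket_ge1[of \<theta>] by (intro power_mono) auto
  also have "\<dots> = (1 + real DIM('b)) ^ N * M ^ N" by (rule power_mult_distrib)
  also have "M ^ N \<le> 1 + (\<Sum>e\<in>Basis. \<bar>\<theta> \<bullet> e\<bar> ^ N)"
  proof -
    have "M \<in> ?S" unfolding M_def using fin by (rule Max_in) simp
    then consider "M = 1" | e where "e \<in> Basis" "M = \<bar>\<theta> \<bullet> e\<bar>" by blast
    then show ?thesis
    proof cases
      case 1
      then show ?thesis by (simp add: sum_nonneg)
    next
      case 2
      then show ?thesis using member_le_sum[of e Basis "\<lambda>e. \<bar>\<theta> \<bullet> e\<bar> ^ N"] by simp
    qed
  qed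
  finally show ?thesis by (simp add: mult_left_mono)
qed

lemma osc_decay:
  assumes "a \<in> symbol_S00" "q \<in> cpoly"
  shows "\<exists>C\<ge>0. \<forall>T \<theta>. japanese_bracket \<theta> ^ N * cmod (osc a q T \<theta>) \<le> C"
proof -
  have "\<forall>e\<in>Basis. \<exists>C. \<forall>T \<theta>. \<bar>\<theta> \<bullet> e\<bar> ^ N * cmod (osc a q T \<theta>) \<le> C"
    using osc_decay_direction[OF assms] by blast
  then obtain C where C: "\<And>e T \<theta>. e \<in> Basis \<Longrightarrow> \<bar>\<theta> \<bullet> e\<bar> ^ N * cmod (osc a q T \<theta>) \<le> C e"
    using bchoice[of Basis] by metis
  \<comment> \<open>Any direction will do: with exponent 0 its estimate is a plain uniform bound,
    needed for the summand 1.\<close>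
  obtain e0 :: 'b where "e0 \<in> Basis" using nonempty_Basis by blast
  obtain C0 where C0: "\<And>T \<theta>. cmod (osc a q T \<theta>) \<le> C0"
    using osc_decay_direction[OF assms \<open>e0 \<in> Basis\<close>, of 0] by auto
  let ?C = "(1 + real DIM('b)) ^ N * (C0 + (\<Sum>e\<in>Basis. C e))"
  have b: "japanese_bracket \<theta> ^ N * cmod (osc a q T \<theta>) \<le> ?C" for T \<theta>
  proof -
    have "japanese_bracket \<theta> ^ N * cmod (osc a q T \<theta>) \<le> (1 + real DIM('b)) ^ N * (1 + (\<Sum>e\<in>Basis. \<bar>\<theta> \<bullet> e\<bar> ^ N)) * cmod (osc a q T \<theta>)"
      by (rule mult_right_mono[OF power_norm_bound]) simp
    also have "\<dots> = (1 + real DIM('b)) ^ N * (cmod (osc a q T \<theta>) + (\<Sum>e\<in>Basis. \<bar>\<theta> \<bullet> e\<bar> ^ N * cmod (osc a q T \<theta>)))"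
      by (simp add: sum_distrib_right distrib_right mult.assoc)
    also have "\<dots> \<le> ?C" by (intro mult_left_mono add_mono C0 sum_mono C) auto
    finally show ?thesis .
  qed
  moreover have "?C \<ge> 0"
  proof -
    have "0 \<le> japanese_bracket (0::'b) ^ N * cmod (osc a q 0 0)" using japanese_bracket_ge1[of "0::'b"] by simp
    then show ?thesis using b[of 0 0] by linarith
  qed
  ultimately show ?thesis by blast
qed

end

section \<open>Symplectic blocks and quadratic phases\<close>

lemma transpose_block_matrix:
  "transpose (block_matrix A B C D) = block_matrix (transpose A) (transpose C) (transpose B) (transpose D)"
  by (auto simp: block_matrix_def transpose_def vec_eq_iff split: sum.split)

lemma block_matrix_mult:
  fixes A B C D A' B' C' D' :: "real ^ 'n::finite ^ 'n"
  shows "block_matrix A B C D ** block_matrix A' B' C' D' =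
    block_matrix (A ** A' + B ** C') (A ** B' + B ** D') (C ** A' + D ** C') (C ** B' + D ** D')"
  by (auto simp: block_matrix_def matrix_matrix_mult_def vec_eq_iff sum_UNIV_Plus split: sum.split)

lemma block_matrix_eq_iff:
  "block_matrix A B C D = block_matrix A' B' C' D' \<longleftrightarrow> A = A' \<and> B = B' \<and> C = C' \<and> D = D'"
proof
  assume eq: "block_matrix A B C D = block_matrix A' B' C' D'"
  have "block_matrix A B C D $ i $ j = block_matrix A' B' C' D' $ i $ j" for i j by (simp only: eq)
  note e = this
  show "A = A' \<and> B = B' \<and> C = C' \<and> D = D'"
    unfolding vec_eq_iff
  proof (intro conjI allI)
    fix i j
    show "A $ i $ j = A' $ i $ j" using e[of "Inl i" "Inl j"] by (simp add: block_matrix_def)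
    show "B $ i $ j = B' $ i $ j" using e[of "Inl i" "Inr j"] by (simp add: block_matrix_def)
    show "C $ i $ j = C' $ i $ j" using e[of "Inr i" "Inl j"] by (simp add: block_matrix_def)
    show "D $ i $ j = D' $ i $ j" using e[of "Inr i" "Inr j"] by (simp add: block_matrix_def)
  qed
qed simp

lemma matrix_neg_mult: "(- A) ** B = - (A ** B)" "A ** (- B) = - (A ** B)"
  for A B :: "real ^ 'n::finite ^ 'n"
  by (simp_all add: matrix_matrix_mult_def vec_eq_iff sum_negf)

lemma Sp_block_matrix:
  fixes A B C D :: "real ^ 'n::finite ^ 'n"
  assumes "block_matrix A B C D \<in> Sp"
  shows "transpose A ** C = transpose C ** A" "transpose B ** D = transpose D ** B"
    "transpose A ** D - transpose C ** B = mat 1"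
proof -
  have "block_matrix (transpose A) (transpose C) (transpose B) (transpose D) ** block_matrix 0 (mat 1) (- mat 1) 0 ** block_matrix A B C D
    = block_matrix 0 (mat 1) (- mat 1) 0"
    using assms unfolding Sp_def mem_Collect_eq symplectic_J_def transpose_block_matrix .
  then have "- (transpose C ** A) + transpose A ** C = 0" "- (transpose C ** B) + transpose A ** D = mat 1" "- (transpose D ** B) + transpose B ** D = 0"
    unfolding block_matrix_mult block_matrix_eq_iff by (simp_all add: matrix_neg_mult)
  then show "transpose A ** C = transpose C ** A" "transpose B ** D = transpose D ** B"
    "transpose A ** D - transpose C ** B = mat 1" by simp_all
qed

lemma linear_cpoly:
  fixes l :: "'a::euclidean_space \<Rightarrow> real"
  assumes "linear l"
  shows "(\<lambda>u. complex_of_real (l u)) \<in> cpoly"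
proof -
  have s: "(\<lambda>u. \<Sum>b\<in>B. complex_of_real (u \<bullet> b) * complex_of_real (l b)) \<in> cpoly" if "finite B" "B \<subseteq> Basis" for B :: "'a set"
    using that
  proof (induction B rule: finite_induct)
    case empty
    show ?case using cpoly.const[of 0] by simp
  next
    case (insert b B)
    then have "(\<lambda>u. complex_of_real (u \<bullet> b) * complex_of_real (l b) + (\<Sum>b\<in>B. complex_of_real (u \<bullet> b) * complex_of_real (l b))) \<in> cpoly"
      by (intro cpoly.add cpoly.mult cpoly.coord cpoly.const) auto
    then show ?case unfolding sum.insert[OF insert(1,2)] .
  qed
  have lu: "l u = (\<Sum>b\<in>Basis. (u \<bullet> b) * l b)" for u
  proof -
    have "l u = l (\<Sum>b\<in>Basis. (u \<bullet> b) *\<^sub>R b)" by (simp add: euclidean_representation)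
    also have "\<dots> = (\<Sum>b\<in>Basis. (u \<bullet> b) * l b)" by (simp add: linear_sum[OF assms] linear_cmul[OF assms])
    finally show ?thesis .
  qed
  have "(\<lambda>u. complex_of_real (l u)) = (\<lambda>u. \<Sum>b\<in>Basis. complex_of_real (u \<bullet> b) * complex_of_real (l b))"
    by (rule ext, subst lu) simp
  then show ?thesis using s[of Basis] by simp
qed

text \<open>\<open>T\<close> is the Hessian of the quadratic phase.\<close>

locale quadratic_phase =
  fixes T :: "'b::euclidean_space \<Rightarrow> 'b"
  assumes T_linear: "linear T" and T_selfadjoint: "T x \<bullet> y = x \<bullet> T y"
begin

text \<open>The quadratic part of the phase is put into the amplitude, so that the remaining phase
  is linear. The modulus is that of a real Gaussian whatever \<open>T\<close> is.\<close>

definition chirp :: "'b \<Rightarrow> complex"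
  where "chirp u = cis (pi * (u \<bullet> T u)) * complex_of_real (exp (- pi * (norm u)\<^sup>2))"

definition chirp_factor :: "'b \<Rightarrow> 'b \<Rightarrow> complex"
  where "chirp_factor u v = \<i> * complex_of_real (2 * pi * (v \<bullet> T u)) + complex_of_real (- 2 * pi * (u \<bullet> v))"

lemma chirp_gaussian_amplitude: "gaussian_amplitude chirp chirp_factor"
proof
  fix u :: 'b
  have w: "chirp = (\<lambda>u. exp (\<i> * complex_of_real (pi * (u \<bullet> T u)) + complex_of_real (- pi * (u \<bullet> u))))"
    unfolding chirp_def exp_add cis_conv_exp by (simp only: exp_of_real power2_norm_eq_inner)
  have Td: "(T has_derivative T) (at u)"
    using T_linear by (intro bounded_linear_imp_has_derivative) (simp add: linear_conv_bounded_linear)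
  have c: "pi * (u \<bullet> T v + v \<bullet> T u) = 2 * pi * (v \<bullet> T u)" for v
    using T_selfadjoint[of v u] inner_commute[of u "T v"] by simp
  have "((\<lambda>u. pi * (u \<bullet> T u)) has_derivative (\<lambda>v. pi * (u \<bullet> T v + v \<bullet> T u))) (at u)"
    by (intro has_derivative_mult_right has_derivative_inner has_derivative_ident Td)
  then have a1: "((\<lambda>u. pi * (u \<bullet> T u)) has_derivative (\<lambda>v. 2 * pi * (v \<bullet> T u))) (at u)"
    unfolding c .
  have a2: "((\<lambda>u. - pi * (u \<bullet> u)) has_derivative (\<lambda>v. - 2 * pi * (u \<bullet> v))) (at u)"
    by (auto intro!: derivative_eq_intros simp: inner_commute[of _ u])
  show "(chirp has_derivative (\<lambda>v. chirp u * chirp_factor u v)) (at u)"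
    unfolding w chirp_factor_def
    by (rule has_derivative_cexp[OF has_derivative_add[OF has_derivative_mult_right[OF has_derivative_of_real[OF a1]] has_derivative_of_real[OF a2]]])
  show "cmod (chirp u) \<le> exp (- 2 * (norm u)\<^sup>2)"
    using pi_gt3 by (simp add: chirp_def norm_mult mult_right_mono)
next
  fix e :: 'b assume e: "e \<in> Basis"
  have "linear (\<lambda>u. 2 * pi * (e \<bullet> T u))"
    using T_linear by (intro linearI) (simp_all add: linear_add linear_cmul inner_add_right algebra_simps)
  moreover have "linear (\<lambda>u. - 2 * pi * (u \<bullet> e))"
    by (intro linearI) (simp_all add: inner_add_left algebra_simps)
  ultimately show "(\<lambda>u. chirp_factor u e) \<in> cpoly"
    unfolding chirp_factor_def by (intro cpoly.add cpoly.mult cpoly.const linear_cpoly)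
qed

sublocale gaussian_amplitude chirp chirp_factor by (rule chirp_gaussian_amplitude)

lemma quadratic_expansion: "(X + u) \<bullet> T (X + u) = X \<bullet> T X + 2 * (u \<bullet> T X) + u \<bullet> T u"
  using T_selfadjoint[of u X] by (simp add: linear_add[OF T_linear] inner_add_left inner_add_right inner_commute)

end

text \<open>The Gaussian of rate pi is its own Fourier transform, so position and frequency of the
  window merely exchange roles.\<close>

lemma fourier_window:
  fixes z :: "'a::euclidean_space \<times> 'a"
  shows "fourier (window z) \<xi> = cis (- 2 * pi * (fst z \<bullet> (\<xi> - snd z))) * complex_of_real (exp (- pi * (norm (\<xi> - snd z))\<^sup>2))"
proof -
  let ?g = "\<lambda>y::'a. cis (- 2 * pi * ((y + fst z) \<bullet> (\<xi> - snd z))) * complex_of_real (exp (- pi * (norm y)\<^sup>2))"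
  have "fourier (window z) \<xi> = (LINT y|lborel. ?g (y + - fst z))"
    unfolding fourier_def
  proof (rule Bochner_Integration.integral_cong[OF refl])
    fix y
    have "- 2 * pi * (y \<bullet> \<xi>) + 2 * pi * (y \<bullet> snd z) = - 2 * pi * ((y + - fst z + fst z) \<bullet> (\<xi> - snd z))"
      by (simp add: inner_diff_right algebra_simps)
    then have "cis (- 2 * pi * (y \<bullet> \<xi>)) * cis (2 * pi * (y \<bullet> snd z)) = cis (- 2 * pi * ((y + - fst z + fst z) \<bullet> (\<xi> - snd z)))"
      unfolding cis_mult by (rule arg_cong)
    then show "cis (- 2 * pi * (y \<bullet> \<xi>)) * window z y = ?g (y + - fst z)"
      by (simp add: window_def mult_ac)
  qed
  also have "\<dots> = (LINT y|lborel. ?g y)" by (rule integral_translate) measurable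
  also have "\<dots> = (LINT y|lborel. cis (- 2 * pi * (fst z \<bullet> (\<xi> - snd z))) * (cis (- 2 * pi * (y \<bullet> (\<xi> - snd z))) * complex_of_real (exp (- pi * (norm y)\<^sup>2))))"
    unfolding mult.assoc[symmetric] cis_mult
    by (intro Bochner_Integration.integral_cong refl) (simp add: inner_add_left algebra_simps)
  also have "\<dots> = cis (- 2 * pi * (fst z \<bullet> (\<xi> - snd z))) * complex_of_real (sqrt (pi / pi) ^ DIM('a) * exp (- (pi\<^sup>2 / pi * (norm (\<xi> - snd z))\<^sup>2)))"
    using gaussian_fourier(2)[of pi "\<xi> - snd z"] by simp
  also have "pi\<^sup>2 / pi = pi" by (simp add: power2_eq_square)
  finally show ?thesis by simp
qed

section \<open>Matrix elements of the Fourier integral operator\<close>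

lemma inner_matrix_transpose:
  fixes M :: "real ^ 'n::finite ^ 'm::finite"
  shows "(M *v y) \<bullet> x = y \<bullet> (transpose M *v x)"
  using dot_lmul_matrix[of x M y] by (simp add: inner_commute)

lemma is_quadratic_FIO_bounded: "is_quadratic_FIO A B C a K \<Longrightarrow> bounded_L2_operator K"
  by (simp add: is_quadratic_FIO_def)

lemma japanese_bracket_linear_le:
  fixes \<Lambda> :: "'b::euclidean_space \<Rightarrow> 'c::euclidean_space"
  assumes "linear \<Lambda>"
  obtains c where "c > 0" "\<And>x. japanese_bracket (\<Lambda> x) \<le> c * japanese_bracket x"
proof -
  obtain B0 where B0: "\<And>x. norm (\<Lambda> x) \<le> B0 * norm x" using linear_bounded[OF assms] by blast
  define B where "B = max 1 B0"
  have B: "B \<ge> 1" "norm (\<Lambda> x) \<le> B * norm x" for x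
    using B0[of x] mult_right_mono[of B0 B "norm x"] by (auto simp: B_def)
  have "japanese_bracket (\<Lambda> x) \<le> B * japanese_bracket x" for x
    unfolding japanese_bracket_def
  proof (rule real_le_lsqrt)
    have "(norm (\<Lambda> x))\<^sup>2 \<le> (B * norm x)\<^sup>2" using B by (intro power_mono) auto
    moreover have "1 \<le> B\<^sup>2" using B by (simp add: one_le_power)
    ultimately show "1 + (norm (\<Lambda> x))\<^sup>2 \<le> (B * sqrt (1 + (norm x)\<^sup>2))\<^sup>2"
      by (simp add: power_mult_distrib distrib_left)
  qed (use B in auto)
  then show ?thesis using B(1) that[of B] by simp
qed

locale free_symplectic =
  fixes A B C D :: "real ^ 'n::finite ^ 'n"
  assumes symplectic: "block_matrix A B C D \<in> Sp" and det: "det A \<noteq> 0"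
begin

lemma A_inverse: "A *v (matrix_inv A *v x) = x" "matrix_inv A *v (A *v x) = x"
proof -
  have "\<exists>A'. A ** A' = mat 1 \<and> A' ** A = mat 1" using det by (simp add: invertible_det_nz[symmetric] invertible_def)
  from someI_ex[OF this] have "A ** matrix_inv A = mat 1 \<and> matrix_inv A ** A = mat 1" unfolding matrix_inv_def .
  then show "A *v (matrix_inv A *v x) = x" "matrix_inv A *v (A *v x) = x" by (simp_all add: matrix_vector_mul_assoc)
qed

lemma block_relations:
  "(A *v u) \<bullet> (C *v v) = (C *v u) \<bullet> (A *v v)"
  "(B *v u) \<bullet> (D *v v) = (D *v u) \<bullet> (B *v v)"
  "(A *v u) \<bullet> (D *v v) - (C *v u) \<bullet> (B *v v) = u \<bullet> v"
proof -
  note r = Sp_block_matrix[OF symplectic]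
  show "(A *v u) \<bullet> (C *v v) = (C *v u) \<bullet> (A *v v)"
    unfolding inner_matrix_transpose matrix_vector_mul_assoc r(1) ..
  show "(B *v u) \<bullet> (D *v v) = (D *v u) \<bullet> (B *v v)"
    unfolding inner_matrix_transpose matrix_vector_mul_assoc r(2) ..
  show "(A *v u) \<bullet> (D *v v) - (C *v u) \<bullet> (B *v v) = u \<bullet> v"
    unfolding inner_matrix_transpose matrix_vector_mul_assoc inner_diff_right[symmetric] matrix_vector_mult_diff_rdistrib[symmetric] r(3) by simp
qed

text \<open>The Hessian of the phase applied to a vector, which for a homogeneous quadratic phase is
  also its gradient; the symmetry of the diagonal blocks is proved below.\<close>

definition hess :: "(real ^ 'n) \<times> (real ^ 'n) \<Rightarrow> (real ^ 'n) \<times> (real ^ 'n)"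
  where "hess X = (C *v (matrix_inv A *v fst X) + transpose (matrix_inv A) *v snd X,
                   matrix_inv A *v fst X - matrix_inv A *v (B *v snd X))"

lemma CA_symmetric: "(C *v (matrix_inv A *v x)) \<bullet> y = x \<bullet> (C *v (matrix_inv A *v y))"
  using block_relations(1)[of "matrix_inv A *v x" "matrix_inv A *v y"] by (simp only: A_inverse)

text \<open>The third block relation rewrites the left side as (B x).(D y) minus (C A^{-1} B x).(B
  y). Both terms are symmetric in \<open>x\<close> and \<open>y\<close>, by the second and the first
  relation.\<close>

lemma AB_symmetric: "(matrix_inv A *v (B *v x)) \<bullet> y = x \<bullet> (matrix_inv A *v (B *v y))"
  using block_relations(3)[of "matrix_inv A *v (B *v x)" y] block_relations(3)[of "matrix_inv A *v (B *v y)" x]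
    block_relations(2)[of x y] block_relations(1)[of "matrix_inv A *v (B *v x)" "matrix_inv A *v (B *v y)"]
    inner_commute[of "C *v (matrix_inv A *v (B *v y))" "B *v x"] inner_commute[of "B *v y" "D *v x"] inner_commute[of "matrix_inv A *v (B *v y)" x]
  unfolding A_inverse by linarith

text \<open>The third relation tested on the inverse image of \<open>y\<close> under
  \<open>A\<close>. It eliminates \<open>D\<close>, which does not occur in the phase.\<close>

lemma D_decomposition: "D *v x = C *v (matrix_inv A *v (B *v x)) + transpose (matrix_inv A) *v x"
proof (rule vector_eq_rdot[THEN iffD1], rule allI)
  fix y
  have f1: "(matrix_inv A *v y) \<bullet> x = y \<bullet> (transpose (matrix_inv A) *v x)" by (rule inner_matrix_transpose)
  have f2: "y \<bullet> (D *v x) - (C *v (matrix_inv A *v y)) \<bullet> (B *v x) = (matrix_inv A *v y) \<bullet> x"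
    using block_relations(3)[of "matrix_inv A *v y" x] unfolding A_inverse .
  show "(D *v x) \<bullet> y = (C *v (matrix_inv A *v (B *v x)) + transpose (matrix_inv A) *v x) \<bullet> y"
    unfolding inner_add_left
    using f1 f2 CA_symmetric[of "B *v x" y] inner_commute[of y "D *v x"] inner_commute[of "B *v x" "C *v (matrix_inv A *v y)"]
      inner_commute[of y "transpose (matrix_inv A) *v x"] by linarith
qed

lemma hess_quadratic_phase: "quadratic_phase hess"
proof (rule quadratic_phase.intro)
  show "linear hess"
    unfolding hess_def by (intro linearI)
      (simp_all add: matrix_vector_right_distrib scaleR_add_right scaleR_diff_right matrix_vector_mult_scaleR vector_scaleR_matrix_ac vector_matrix_left_distrib del: transpose_matrix_vector)
  fix x y :: "(real ^ 'n) \<times> (real ^ 'n)"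
  have t: "(transpose (matrix_inv A) *v u) \<bullet> v = u \<bullet> (matrix_inv A *v v)" for u v :: "real ^ 'n"
    using inner_matrix_transpose[of "matrix_inv A" v u] inner_commute[of "matrix_inv A *v v" u]
      inner_commute[of v "transpose (matrix_inv A) *v u"] by linarith
  show "hess x \<bullet> y = x \<bullet> hess y"
    unfolding hess_def inner_prod_def fst_conv snd_conv inner_add_left inner_add_right inner_diff_left inner_diff_right
    using CA_symmetric[of "fst x" "fst y"] AB_symmetric[of "snd x" "snd y"] t[of "snd x" "fst y"]
      inner_matrix_transpose[of "matrix_inv A" "fst x" "snd y"] by linarith
qed

sublocale quadratic_phase hess by (rule hess_quadratic_phase)

lemma FIO_phase_hess: "FIO_phase A B C x \<xi> = 1 / 2 * ((x, \<xi>) \<bullet> hess (x, \<xi>))"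
proof -
  have "x \<bullet> (transpose (matrix_inv A) *v \<xi>) = (matrix_inv A *v x) \<bullet> \<xi>" by (rule inner_matrix_transpose[symmetric])
  then show ?thesis
    unfolding FIO_phase_def hess_def inner_prod_def fst_conv snd_conv inner_add_right inner_diff_right matrix_vector_mul_assoc[symmetric]
    by (simp add: inner_commute algebra_simps del: transpose_matrix_vector)
qed

definition canonical_map :: "(real ^ 'n) \<times> (real ^ 'n) \<Rightarrow> (real ^ 'n) \<times> (real ^ 'n)"
  where "canonical_map X = (A *v fst X + B *v snd X, C *v fst X + D *v snd X)"

text \<open>The gradient of the total phase of the matrix element; it vanishes exactly at \<open>w = canonical_map z\<close>.\<close>

definition phase_gradient :: "(real ^ 'n) \<times> (real ^ 'n) \<Rightarrow> (real ^ 'n) \<times> (real ^ 'n) \<Rightarrow> (real ^ 'n) \<times> (real ^ 'n)"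
  where "phase_gradient w z = hess (fst w, snd z) - (snd w, fst z)"

lemma canonical_map_linear: "linear canonical_map"
  unfolding canonical_map_def
  by (intro linearI) (simp_all add: matrix_vector_right_distrib matrix_vector_mult_scaleR scaleR_add_right)

text \<open>Quantitative form of the fact that the phase generates the canonical map: the miss
  distance is a fixed linear image of the gradient, so decay in the gradient is decay in the miss
  distance.\<close>

lemma canonical_map_gradient:
  "w - canonical_map z = (A *v snd (phase_gradient w z), C *v snd (phase_gradient w z) - fst (phase_gradient w z))"
  unfolding canonical_map_def phase_gradient_def hess_def D_decomposition
  by (cases w) (simp add: matrix_vector_mult_diff_distrib A_inverse del: transpose_matrix_vector)

lemma canonical_map_inj: "inj canonical_map"
proof (rule linear_injective_0[OF canonical_map_linear, THEN iffD2], intro allI impI)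
  fix z assume "canonical_map z = 0"
  then have 1: "A *v fst z + B *v snd z = 0" "C *v fst z + D *v snd z = 0" by (auto simp: canonical_map_def prod_eq_iff)
  \<comment> \<open>Preservation of the symplectic form: pairing the image of \<open>z\<close> with
    the vector \<open>(A *v u, C *v u)\<close> recovers the frequency part of
    \<open>z\<close>.\<close>
  have s: "u \<bullet> snd z = 0" for u
  proof -
    have "(A *v u) \<bullet> (C *v fst z + D *v snd z) - (C *v u) \<bullet> (A *v fst z + B *v snd z) = u \<bullet> snd z"
      using block_relations(1)[of u "fst z"] block_relations(3)[of u "snd z"] by (simp add: inner_add_right)
    then show ?thesis unfolding 1 by simp
  qed
  have "snd z = 0" using s[of "snd z"] by simp
  with 1(1) have "A *v fst z = 0" by simp
  then have "fst z = 0" using A_inverse(2)[of "fst z"] by (metis matrix_vector_mult_0_right)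
  with \<open>snd z = 0\<close> show "z = 0" by (simp add: prod_eq_iff)
qed

text \<open>The expansion point \<open>X\<close> is where the integrand concentrates:
  \<open>window w\<close> sits at position \<open>fst w\<close>, the transform of
  \<open>window z\<close> at frequency \<open>snd z\<close>. Constant terms form a unimodular
  factor, linear terms the oscillation, quadratic terms the \<open>chirp\<close>.\<close>

lemma FIO_integrand:
  fixes w z Y :: "(real ^ 'n) \<times> (real ^ 'n)"
  defines "X \<equiv> (fst w, snd z)"
  shows "cis (2 * pi * FIO_phase A B C (fst Y) (snd Y)) * a Y * fourier (window z) (snd Y) * cnj (window w (fst Y))
    = cis (pi * (X \<bullet> hess X) - 2 * pi * (fst w \<bullet> snd w)) * (cis (2 * pi * ((Y - X) \<bullet> phase_gradient w z)) * amp a (\<lambda>_. 1) X (Y - X))"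
proof -
  let ?u = "Y - X"
  have Y: "Y = X + ?u" by simp
  have p1: "2 * pi * FIO_phase A B C (fst Y) (snd Y) = pi * (X \<bullet> hess X) + 2 * pi * (?u \<bullet> hess X) + pi * (?u \<bullet> hess ?u)"
    using quadratic_expansion[of X ?u] unfolding FIO_phase_hess Y[symmetric] by (simp add: distrib_left)
  \<comment> \<open>Linear terms: \<open>hess X\<close> comes from the phase, \<open>snd w\<close>
    from the modulation of one window, and \<open>fst z\<close> from the translation of the
    other.\<close>
  have p2: "?u \<bullet> phase_gradient w z = ?u \<bullet> hess X - ((fst Y - fst w) \<bullet> snd w + fst z \<bullet> (snd Y - snd z))"
    unfolding phase_gradient_def X_def[symmetric] inner_diff_right[of ?u] by (simp add: inner_prod_def X_def inner_commute)
  have e: "- pi * (norm ?u)\<^sup>2 = - pi * (norm (snd Y - snd z))\<^sup>2 + - pi * (norm (fst Y - fst w))\<^sup>2"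
    by (simp add: X_def norm_prod_def algebra_simps)
  have ph: "2 * pi * FIO_phase A B C (fst Y) (snd Y) + - 2 * pi * (fst z \<bullet> (snd Y - snd z)) + - (2 * pi * (fst Y \<bullet> snd w))
    = (pi * (X \<bullet> hess X) - 2 * pi * (fst w \<bullet> snd w)) + 2 * pi * (?u \<bullet> phase_gradient w z) + pi * (?u \<bullet> hess ?u)"
    unfolding p1 p2 by (simp add: inner_diff_left algebra_simps)
  have "cis (2 * pi * FIO_phase A B C (fst Y) (snd Y)) * a Y * fourier (window z) (snd Y) * cnj (window w (fst Y))
    = cis (2 * pi * FIO_phase A B C (fst Y) (snd Y) + - 2 * pi * (fst z \<bullet> (snd Y - snd z)) + - (2 * pi * (fst Y \<bullet> snd w))) * a Y * complex_of_real (exp (- pi * (norm (snd Y - snd z))\<^sup>2 + - pi * (norm (fst Y - fst w))\<^sup>2))"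
    unfolding fourier_window window_def exp_add of_real_mult cis_mult[symmetric] complex_cnj_mult cis_cnj complex_cnj_complex_of_real
    by (simp only: mult_ac)
  also have "\<dots> = cis (pi * (X \<bullet> hess X) - 2 * pi * (fst w \<bullet> snd w)) * (cis (2 * pi * (?u \<bullet> phase_gradient w z)) * amp a (\<lambda>_. 1) X ?u)"
    unfolding ph e[symmetric] amp_def chirp_def cis_mult[symmetric] diff_add_cancel
    by (simp only: mult_ac mult_1)
  finally show ?thesis .
qed

text \<open>The frequency integral of the operator and the position integral of the inner product
  merge into one phase space integral; Gaussian decay in both variables justifies Fubini.\<close>

lemma FIO_matrix_element:
  assumes a: "a \<in> symbol_S00" and K: "is_quadratic_FIO A B C a K"
  shows "cmod (ip (K (window z)) (window w)) = cmod (osc a (\<lambda>_. 1) (fst w, snd z) (phase_gradient w z))"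
proof -
  let ?X = "(fst w, snd z)"
  let ?c = "cis (pi * (?X \<bullet> hess ?X) - 2 * pi * (fst w \<bullet> snd w))"
  let ?g = "\<lambda>u. cis (2 * pi * (u \<bullet> phase_gradient w z)) * amp a (\<lambda>_. 1) ?X u"
  let ?J = "\<lambda>Y. cis (2 * pi * FIO_phase A B C (fst Y) (snd Y)) * a Y * fourier (window z) (snd Y) * cnj (window w (fst Y))"
  have gi: "integrable lborel ?g"
    by (rule integrable_cis_mult[OF amp_integrable[OF a cpoly.const]]) measurable
  have J: "?J = (\<lambda>Y. ?c * ?g (Y + - ?X))" unfolding diff_conv_add_uminus[symmetric] by (rule ext) (rule FIO_integrand)
  have Ji: "integrable lborel ?J" unfolding J by (intro integrable_mult_right integrable_translate[OF gi])
  have KL2: "K (window z) \<in> L2" using K window_L2[of z] unfolding is_quadratic_FIO_def bounded_L2_operator_def by blast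
  have KAE: "AE x in lborel. K (window z) x = FIO_integral A B C a (window z) x"
    using K window_schwartz[of z] unfolding is_quadratic_FIO_def by blast
  have FI: "FIO_integral A B C a (window z) x * cnj (window w x) = (LINT \<xi>|lborel. ?J (x, \<xi>))" for x
    unfolding FIO_integral_def fst_conv snd_conv by (rule integral_mult_left_zero[symmetric])
  have Jm: "(\<lambda>x. LINT \<xi>|lborel. ?J (x, \<xi>)) \<in> borel_measurable lborel"
  proof -
    have "?J \<in> borel_measurable (lborel \<Otimes>\<^sub>M lborel)" using Ji unfolding lborel_prod by (rule borel_measurable_integrable)
    then show ?thesis by (intro lborel.borel_measurable_lebesgue_integral) (simp add: split_beta')
  qed
  have "ip (K (window z)) (window w) = (LINT x|lborel. LINT \<xi>|lborel. ?J (x, \<xi>))"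
    unfolding ip_def
  proof (rule integral_cong_AE[OF _ Jm])
    have [measurable]: "K (window z) \<in> borel_measurable borel" using KL2 by auto
    show "(\<lambda>x. K (window z) x * cnj (window w x)) \<in> borel_measurable lborel" by measurable
    show "AE x in lborel. K (window z) x * cnj (window w x) = (LINT \<xi>|lborel. ?J (x, \<xi>))"
      using KAE by eventually_elim (simp only: FI)
  qed
  also have "\<dots> = (LINT Y|lborel. ?J Y)" by (rule integral_lborel_pair[OF Ji, symmetric])
  also have "\<dots> = ?c * (LINT Y|lborel. ?g (Y + - ?X))" unfolding J by (rule integral_mult_right_zero)
  also have "(LINT Y|lborel. ?g (Y + - ?X)) = osc a (\<lambda>_. 1) ?X (phase_gradient w z)"
    unfolding osc_def using borel_measurable_integrable[OF gi] by (intro integral_translate) simp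
  finally show ?thesis by (simp add: norm_mult)
qed

lemma FIO_matrix_decay:
  assumes a: "a \<in> symbol_S00" and K: "is_quadratic_FIO A B C a K"
  shows "\<exists>c\<ge>0. \<forall>w z. cmod (ip (K (window z)) (window w)) \<le> c * japanese_bracket (w - canonical_map z) powr (- real N)"
proof -
  obtain c0 where c0: "c0 \<ge> 0" "\<And>T \<theta>. japanese_bracket \<theta> ^ N * cmod (osc a (\<lambda>_. 1) T \<theta>) \<le> c0"
    using osc_decay[OF a cpoly.const] by blast
  let ?\<Lambda> = "\<lambda>\<theta>. (A *v snd \<theta>, C *v snd \<theta> - fst \<theta>)"
  have "linear ?\<Lambda>"
    by (intro linearI) (simp_all add: matrix_vector_right_distrib matrix_vector_mult_scaleR scaleR_diff_right)
  then obtain c1 where c1: "c1 > 0" "\<And>\<theta>. japanese_bracket (?\<Lambda> \<theta>) \<le> c1 * japanese_bracket \<theta>"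
    using japanese_bracket_linear_le by blast
  have "cmod (ip (K (window z)) (window w)) \<le> (c1 ^ N * c0) * japanese_bracket (w - canonical_map z) powr (- real N)" for w z
  proof -
    let ?h = "cmod (ip (K (window z)) (window w))" and ?j = "japanese_bracket (w - canonical_map z)"
    have j: "?j > 0" by (rule japanese_bracket_pos)
    have "?j \<le> c1 * japanese_bracket (phase_gradient w z)" unfolding canonical_map_gradient by (rule c1(2))
    then have "?j ^ N \<le> (c1 * japanese_bracket (phase_gradient w z)) ^ N" using j by (intro power_mono) auto
    then have "?j ^ N * ?h \<le> (c1 * japanese_bracket (phase_gradient w z)) ^ N * ?h" by (rule mult_right_mono) simp
    also have "\<dots> = c1 ^ N * (japanese_bracket (phase_gradient w z) ^ N * ?h)" by (simp add: power_mult_distrib mult.assoc)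
    also have "\<dots> \<le> c1 ^ N * c0" using c0(2) c1(1) unfolding FIO_matrix_element[OF a K] by (intro mult_left_mono) auto
    finally have "?h \<le> (c1 ^ N * c0) / ?j ^ N" using j by (simp add: pos_le_divide_eq mult.commute)
    also have "\<dots> = (c1 ^ N * c0) * ?j powr (- real N)" using j by (simp add: powr_minus powr_realpow divide_inverse)
    finally show ?thesis .
  qed
  then show ?thesis using c0(1) c1(1) by (intro exI[of _ "c1 ^ N * c0"]) auto
qed

end

text \<open>The operator is linear only up to null sets; pairing with \<open>v\<close> yields an
  exactly linear bounded functional.\<close>

lemma bounded_L2_operator_functional:
  fixes K :: "('a::euclidean_space \<Rightarrow> complex) \<Rightarrow> 'a \<Rightarrow> complex"
  assumes K: "bounded_L2_operator K" and v: "v \<in> L2"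
  shows "\<And>f g. f \<in> L2 \<Longrightarrow> g \<in> L2 \<Longrightarrow> ip (K (\<lambda>x. f x + g x)) v = ip (K f) v + ip (K g) v"
    and "\<And>c f. f \<in> L2 \<Longrightarrow> ip (K (\<lambda>x. c * f x)) v = c * ip (K f) v"
    and "\<exists>M. \<forall>f\<in>L2. cmod (ip (K f) v) \<le> M * L2_norm f"
proof -
  have KL2: "K f \<in> L2" if "f \<in> L2" for f using K that unfolding bounded_L2_operator_def by blast
  have cong: "ip u v = ip u' v" if "AE x in lborel. u x = u' x" "u \<in> L2" "u' \<in> L2" for u u'
  proof -
    have [measurable]: "u \<in> borel_measurable borel" "u' \<in> borel_measurable borel" "v \<in> borel_measurable borel" using that v by auto
    show ?thesis unfolding ip_def
    proof (rule integral_cong_AE)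
      show "AE x in lborel. u x * cnj (v x) = u' x * cnj (v x)" using that(1) by eventually_elim simp
    qed measurable
  qed
  show "ip (K (\<lambda>x. c * f x)) v = c * ip (K f) v" if f: "f \<in> L2" for c f
  proof -
    have "AE x in lborel. K (\<lambda>y. c * f y) x = c * K f x" using K f unfolding bounded_L2_operator_def by blast
    from cong[OF this KL2[OF L2_cmult[OF f]] L2_cmult[OF KL2[OF f]]] show ?thesis by (simp add: ip_cmult_left)
  qed
  show "ip (K (\<lambda>x. f x + g x)) v = ip (K f) v + ip (K g) v" if f: "f \<in> L2" and g: "g \<in> L2" for f g
  proof -
    have "AE x in lborel. K (\<lambda>y. f y + g y) x = K f x + K g x" using K f g unfolding bounded_L2_operator_def by blast
    from cong[OF this KL2[OF L2_add[OF f g]] L2_add[OF KL2[OF f] KL2[OF g]]]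
    show ?thesis by (simp add: ip_add_left[OF KL2[OF f] KL2[OF g] v])
  qed
  obtain M where M: "\<And>f. f \<in> L2 \<Longrightarrow> L2_norm (K f) \<le> M * L2_norm f" using K unfolding bounded_L2_operator_def by blast
  have "cmod (ip (K f) v) \<le> (M * L2_norm v) * L2_norm f" if f: "f \<in> L2" for f
    using order_trans[OF ip_bound[OF KL2[OF f] v] mult_right_mono[OF M[OF f] L2_norm_nonneg[of v]]] by (simp add: mult_ac)
  then show "\<exists>M. \<forall>f\<in>L2. cmod (ip (K f) v) \<le> M * L2_norm f" by blast
qed

text \<open>The kernel is integrated over its source variable. A linear left inverse of the
  canonical map compares the bracket of \<open>w - canonical_map z\<close> with that of
  \<open>S' w - z\<close>, after which reflection invariance removes \<open>w\<close>.\<close>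

lemma (in free_symplectic) canonical_map_kernel_integral:
  assumes M: "M \<ge> 2 * real DIM((real ^ 'n) \<times> (real ^ 'n))"
  shows "\<exists>I<\<infinity>. \<forall>w. (\<integral>\<^sup>+z. ennreal (japanese_bracket (w - canonical_map z) powr (- M)) \<partial>lborel) \<le> I"
proof -
  obtain S' where S': "linear S'" "S' \<circ> canonical_map = id"
    using linear_injective_left_inverse[OF canonical_map_linear canonical_map_inj] by blast
  obtain c where c: "c > 0" "\<And>x. japanese_bracket (S' x) \<le> c * japanese_bracket x"
    using japanese_bracket_linear_le[OF S'(1)] by blast
  have M0: "M \<ge> 0" by (rule order_trans[OF _ M]) simp
  let ?I = "\<integral>\<^sup>+x. ennreal (japanese_bracket (x :: (real ^ 'n) \<times> (real ^ 'n)) powr (- M)) \<partial>lborel"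
  have "(\<integral>\<^sup>+z. ennreal (japanese_bracket (w - canonical_map z) powr (- M)) \<partial>lborel) \<le> ennreal (c powr M) * ?I" for w
  proof -
    have pt: "japanese_bracket (w - canonical_map z) powr (- M) \<le> c powr M * japanese_bracket (S' w - z) powr (- M)" for z
    proof -
      have "S' (w - canonical_map z) = S' w - z" using fun_cong[OF S'(2), of z] by (simp add: linear_diff[OF S'(1)])
      then have "japanese_bracket (S' w - z) \<le> c * japanese_bracket (w - canonical_map z)" using c(2)[of "w - canonical_map z"] by simp
      then have "(c * japanese_bracket (w - canonical_map z)) powr (- M) \<le> japanese_bracket (S' w - z) powr (- M)"
        using M0 japanese_bracket_pos[of "S' w - z"] by (intro powr_mono2') auto
      then have "c powr M * (c * japanese_bracket (w - canonical_map z)) powr (- M) \<le> c powr M * japanese_bracket (S' w - z) powr (- M)"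
        by (rule mult_left_mono) simp
      also have "c powr M * (c * japanese_bracket (w - canonical_map z)) powr (- M) = (c powr M * c powr (- M)) * japanese_bracket (w - canonical_map z) powr (- M)"
        using c(1) japanese_bracket_pos[of "w - canonical_map z"] by (simp add: powr_mult)
      also have "c powr M * c powr (- M) = 1" using c(1) by (simp flip: powr_add)
      finally show ?thesis by simp
    qed
    have "(\<integral>\<^sup>+z. ennreal (japanese_bracket (w - canonical_map z) powr (- M)) \<partial>lborel)
       \<le> (\<integral>\<^sup>+z. ennreal (c powr M) * ennreal (japanese_bracket (S' w - z) powr (- M)) \<partial>lborel)"
      using pt by (intro nn_integral_mono) (simp add: ennreal_leI flip: ennreal_mult)
    also have "\<dots> = ennreal (c powr M) * (\<integral>\<^sup>+z. ennreal (japanese_bracket (S' w - z) powr (- M)) \<partial>lborel)"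
      by (rule nn_integral_cmult) measurable
    also have "(\<integral>\<^sup>+z. ennreal (japanese_bracket (S' w - z) powr (- M)) \<partial>lborel) = ?I"
      by (rule nn_integral_reflect) measurable
    finally show ?thesis .
  qed
  moreover have "?I < \<infinity>"
    using japanese_bracket_integral[of "M / 2", where 'a="(real ^ 'n) \<times> (real ^ 'n)"] M by simp
  ultimately show ?thesis by (intro exI[of _ "ennreal (c powr M) * ?I"]) (auto simp: ennreal_mult_less_top)
qed

text \<open>Schur's argument: the bound of \<open>L2_functional_stft_bound\<close> is linear in |V
  f|, and Cauchy-Schwarz with the kernel split evenly makes it linear in |V f|^2, the quantity that
  midpoint energies use.\<close>

lemma (in free_symplectic) FIO_stft_kernel:
  assumes a: "a \<in> symbol_S00" and K: "is_quadratic_FIO A B C a K" and f: "f \<in> L2" and N: "N \<ge> 0"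
  shows "\<exists>c<\<infinity>. \<forall>w. ennreal ((cmod (stft (K f) w))\<^sup>2)
    \<le> c * (\<integral>\<^sup>+z. ennreal (japanese_bracket (w - canonical_map z) powr (- 2 * N)) * ennreal ((cmod (stft f z))\<^sup>2) \<partial>lborel)"
proof -
  have [measurable]: "f \<in> borel_measurable borel" using f by auto
  have [measurable]: "canonical_map \<in> borel_measurable borel"
    using canonical_map_linear by (intro borel_measurable_continuous_onI linear_continuous_on) (simp add: linear_conv_bounded_linear)
  let ?d = "real DIM((real ^ 'n) \<times> (real ^ 'n))"
  \<comment> \<open>Large enough both to leave decay of order \<open>2 * N\<close> in one factor and
    to make the other factor integrable.\<close>
  define M where "M = nat \<lceil>2 * N + 2 * ?d\<rceil>"
  have M: "2 * N + 2 * ?d \<le> real M" unfolding M_def by (rule real_nat_ceiling_ge)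
  obtain c where c: "c \<ge> 0" "\<And>w z. cmod (ip (K (window z)) (window w)) \<le> c * japanese_bracket (w - canonical_map z) powr (- real M)"
    using FIO_matrix_decay[OF a K] by blast
  obtain I where I: "I < \<infinity>" "\<And>w. (\<integral>\<^sup>+z. ennreal (japanese_bracket (w - canonical_map z) powr (- real M)) \<partial>lborel) \<le> I"
    using canonical_map_kernel_integral[of "real M"] M N by auto
  let ?\<kappa> = "sqrt (1 / 2) ^ DIM(real ^ 'n)"
  have "ennreal ((cmod (stft (K f) w))\<^sup>2) \<le> ennreal (c\<^sup>2 / ?\<kappa>\<^sup>2) * I *
     (\<integral>\<^sup>+z. ennreal (japanese_bracket (w - canonical_map z) powr (- 2 * N)) * ennreal ((cmod (stft f z))\<^sup>2) \<partial>lborel)" for w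
  proof -
    let ?j = "\<lambda>z. japanese_bracket (w - canonical_map z)"
    \<comment> \<open>Half of the kernel stays with the transform of \<open>f\<close>, the other
      half is integrated out.\<close>
    let ?k = "\<lambda>z. sqrt (?j z powr (- real M))"
    note K' = bounded_L2_operator_functional[OF is_quadratic_FIO_bounded[OF K] window_L2[of w]]
    obtain B where B: "\<And>f. f \<in> L2 \<Longrightarrow> cmod (ip (K f) (window w)) \<le> B * L2_norm f" using K'(3) by blast
    have "ennreal (?\<kappa> * cmod (stft (K f) w)) \<le> (\<integral>\<^sup>+z. ennreal (cmod (stft f z) * (c * ?j z powr (- real M))) \<partial>lborel)"
      unfolding stft_def[of "K f"]
      by (rule L2_functional_stft_bound[where l = "\<lambda>f. ip (K f) (window w)", OF K'(1,2) B f c(2)]) measurable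
    also have "\<dots> = (\<integral>\<^sup>+z. ennreal c * ennreal \<bar>(cmod (stft f z) * ?k z) * ?k z\<bar> \<partial>lborel)"
      using c(1) by (intro nn_integral_cong) (simp add: mult.assoc mult.left_commute flip: ennreal_mult)
    also have "\<dots> = ennreal c * (\<integral>\<^sup>+z. ennreal \<bar>(cmod (stft f z) * ?k z) * ?k z\<bar> \<partial>lborel)"
      by (rule nn_integral_cmult) measurable
    finally have "(ennreal (?\<kappa> * cmod (stft (K f) w)))\<^sup>2 \<le> (ennreal c * (\<integral>\<^sup>+z. ennreal \<bar>(cmod (stft f z) * ?k z) * ?k z\<bar> \<partial>lborel))\<^sup>2"
      by (intro power_mono) auto
    also have "\<dots> = ennreal (c\<^sup>2) * (\<integral>\<^sup>+z. ennreal \<bar>(cmod (stft f z) * ?k z) * ?k z\<bar> \<partial>lborel)\<^sup>2"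
      using c(1) by (simp add: power_mult_distrib ennreal_power)
    also have "\<dots> \<le> ennreal (c\<^sup>2) * ((\<integral>\<^sup>+z. ennreal ((cmod (stft f z) * ?k z)\<^sup>2) \<partial>lborel) * (\<integral>\<^sup>+z. ennreal ((?k z)\<^sup>2) \<partial>lborel))"
    proof (rule mult_left_mono)
      have m: "(\<lambda>z. cmod (stft f z) * ?k z) \<in> borel_measurable lborel" "?k \<in> borel_measurable lborel" by measurable
      show "(\<integral>\<^sup>+z. ennreal \<bar>(cmod (stft f z) * ?k z) * ?k z\<bar> \<partial>lborel)\<^sup>2 \<le> (\<integral>\<^sup>+z. ennreal ((cmod (stft f z) * ?k z)\<^sup>2) \<partial>lborel) * (\<integral>\<^sup>+z. ennreal ((?k z)\<^sup>2) \<partial>lborel)"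
        by (rule Cauchy_Schwarz_nn_integral_sq[OF m])
    qed simp
    also have "\<dots> \<le> ennreal (c\<^sup>2) * ((\<integral>\<^sup>+z. ennreal (?j z powr (- 2 * N)) * ennreal ((cmod (stft f z))\<^sup>2) \<partial>lborel) * I)"
    proof (intro mult_left_mono mult_mono nn_integral_mono)
      show "(\<integral>\<^sup>+z. ennreal ((?k z)\<^sup>2) \<partial>lborel) \<le> I" using I(2)[of w] by simp
      fix z
      have "?j z powr (- real M) \<le> ?j z powr (- 2 * N)" using M japanese_bracket_ge1 by (intro powr_mono) auto
      then have "(cmod (stft f z) * ?k z)\<^sup>2 \<le> ?j z powr (- 2 * N) * (cmod (stft f z))\<^sup>2"
        by (simp add: power_mult_distrib mult.commute mult_left_mono)
      then show "ennreal ((cmod (stft f z) * ?k z)\<^sup>2) \<le> ennreal (?j z powr (- 2 * N)) * ennreal ((cmod (stft f z))\<^sup>2)"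
        by (simp add: ennreal_leI flip: ennreal_mult)
    qed auto
    finally have "ennreal (1 / ?\<kappa>\<^sup>2) * (ennreal (?\<kappa> * cmod (stft (K f) w)))\<^sup>2
      \<le> ennreal (1 / ?\<kappa>\<^sup>2) * (ennreal (c\<^sup>2) * ((\<integral>\<^sup>+z. ennreal (?j z powr (- 2 * N)) * ennreal ((cmod (stft f z))\<^sup>2) \<partial>lborel) * I))"
      by (rule mult_left_mono) simp
    also have "ennreal (1 / ?\<kappa>\<^sup>2) * (ennreal (?\<kappa> * cmod (stft (K f) w)))\<^sup>2 = ennreal ((cmod (stft (K f) w))\<^sup>2)"
    proof -
      have "ennreal (1 / k\<^sup>2) * (ennreal (k * x))\<^sup>2 = ennreal (x\<^sup>2)" if "k > 0" "x \<ge> 0" for k x :: real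
      proof -
        have "ennreal (1 / k\<^sup>2) * (ennreal (k * x))\<^sup>2 = ennreal (1 / k\<^sup>2 * (k * x)\<^sup>2)"
          using that by (simp add: ennreal_power flip: ennreal_mult)
        also have "1 / k\<^sup>2 * (k * x)\<^sup>2 = x\<^sup>2" using that by (simp add: power_mult_distrib)
        finally show ?thesis .
      qed
      then show ?thesis by simp
    qed
    also have "ennreal (1 / ?\<kappa>\<^sup>2) * (ennreal (c\<^sup>2) * ((\<integral>\<^sup>+z. ennreal (?j z powr (- 2 * N)) * ennreal ((cmod (stft f z))\<^sup>2) \<partial>lborel) * I))
      = (ennreal (1 / ?\<kappa>\<^sup>2) * ennreal (c\<^sup>2)) * I * (\<integral>\<^sup>+z. ennreal (?j z powr (- 2 * N)) * ennreal ((cmod (stft f z))\<^sup>2) \<partial>lborel)"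
      by (simp only: mult_ac)
    also have "ennreal (1 / ?\<kappa>\<^sup>2) * ennreal (c\<^sup>2) = ennreal (c\<^sup>2 / ?\<kappa>\<^sup>2)"
      by (subst ennreal_mult[symmetric]) auto
    finally show ?thesis .
  qed
  then show ?thesis using I(1) by (intro exI[of _ "ennreal (c\<^sup>2 / ?\<kappa>\<^sup>2) * I"]) (auto simp: ennreal_mult_less_top)
qed

theorem theorem1p7:
  fixes S :: "real ^ ('n::finite + 'n) ^ ('n + 'n)"
    and A B C D :: "real ^ 'n ^ 'n"
    and a :: "(real ^ 'n) \<times> (real ^ 'n) \<Rightarrow> complex"
    and K :: "(real ^ 'n \<Rightarrow> complex) \<Rightarrow> real ^ 'n \<Rightarrow> complex"
    and f :: "real ^ 'n \<Rightarrow> complex"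
  assumes "S \<in> Sp"
    and "S = block_matrix A B C D"
    and "det A \<noteq> 0"
    and "a \<in> symbol_S00"
    and "is_quadratic_FIO A B C a K"
    and "f \<in> L2"
  shows "WF_wigner (K f) \<subseteq> phase_map S ` WF_wigner f"
proof -
  interpret free_symplectic A B C D
    using assms(1-3) by unfold_locales auto
  have "phase_map S = canonical_map"
  proof
    fix X show "phase_map S X = canonical_map X"
      unfolding assms(2) canonical_map_def by (cases X) (simp add: phase_map_block_matrix)
  qed
  moreover have "K f \<in> L2"
    using assms(5,6) unfolding is_quadratic_FIO_def bounded_L2_operator_def by blast
  ultimately show ?thesis
    using WF_wigner_transport[OF assms(6) _ canonical_map_linear canonical_map_inj FIO_stft_kernel[OF assms(4-6)]] by simp
qed

end
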